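(* Let $d\ge2$ and let $\varphi,f,u_0,\Gamma_t$ $(0\le t\le T)$, $\lambda_0$, $d(t,v)$, $U_0$, $U_1$, $p$, $q$, $\gamma$, $t^N$ and $u^N$ be as in the context, under (BS), (BIP1), (BIP2). Let $K=K(N)\uparrow\infty$ with $K=o(N^{2/3})$, and set $$u^\pm(t,v)=U_0\big(K^{1/2}d(t,v)\pm p(t)\big)+K^{-1/2}U_1\big(t,v,K^{1/2}d(t,v)\pm p(t)\big)\pm q(t),$$ where the constants $\beta,\tilde\sigma,L,\hat L>0$ entering $p$ and $q$ are chosen as specified in the context. Assume that the inequality $$u^-(t,v)\le u^N(t+t^N,v)\le u^+(t,v)\qquad( * )$$ holds at $t=0$ (for all $v=x/N$, $x\in\mathbb{T}_N^d$). Then there exists $N_0\in\mathbb{N}$ such that $( * )$ holds for every $t\in[0,T-t^N]$, every $v=x/N$ with $x\in\mathbb{T}_N^d$, and every $N\ge N_0$.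
   Context: **The functions $\varphi$ and $f$.** $\mathbb{Z}_+=\{0,1,\dots\}$. $g:\mathbb{Z}_+\to[0,\infty)$ with $g(k)=0$ iff $k=0$; $g(0)!=1$, $g(k)!=g(1)\cdots g(k)$; $\varphi^*=\liminf_kg(k)$. For $0\le\varphi<\varphi^*$ let $\bar\nu_\varphi$ be the product measure on $\mathbb{Z}_+^{\mathbb{Z}^d}$ with marginal $\bar\nu_\varphi(k)=Z_\varphi^{-1}\varphi^k/g(k)!$; it is assumed that its mean $\rho(\varphi)$ diverges as $\varphi\uparrow\varphi^*$. $\varphi=\varphi(\rho)$, $\rho\ge0$, is the inverse of $\rho(\varphi)$, and $\nu_\rho=\bar\nu_{\varphi(\rho)}$, so $\varphi(\rho)=E_{\nu_\rho}[g(\eta_0)]$. Given nonnegative local functions $c^\pm$ on $\mathbb{Z}_+^{\mathbb{Z}^d}$ (with $c^-(\eta)=0$ if $\eta_0=0$), $f(\rho)=E_{\nu_\rho}[c^+]-E_{\nu_\rho}[c^-]$. It is known that $\varphi,f\in C^\infty(\mathbb{R}_+)$ and $\varphi'(\rho)>0$ for $\rho>0$; also $f(0)>0$. (BS) $f$ has exactly three zeros $0<\alpha_-<\alpha_*<\alpha_+$, with $f'(\alpha_-)<0$, $f'(\alpha_* )>0$, $f'(\alpha_+)<0$, and $\int_{\alpha_-}^{\alpha_+}f(\rho)\varphi'(\rho)\,d\rho=0$. Put $\gamma=f'(\alpha_* )$ and $t^N=\frac1{2\gamma K}\log K$. **Discrete equation.** $\mathbb{T}_N^d=(\mathbb{Z}/N\mathbb{Z})^d$,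 $\mathbb{T}^d=(\mathbb{R}/\mathbb{Z})^d$. $u^N(t,x)$, $x\in\mathbb{T}_N^d$, solves $\partial_tu^N=\Delta^N\varphi(u^N)+Kf(u^N)$ with $\Delta^N\varphi(u(x))=N^2\sum_{i=1}^d\{\varphi(u(x+e_i))+\varphi(u(x-e_i))-2\varphi(u(x))\}$; for $v=x/N$, $u^N(t,v):=u^N(t,x)$. **Initial data.** (BIP1) $u_-\le u^N(0,x)\le u_+$ for some $0<u_-<u_+$. (BIP2) $u^N(0,x)=u_0(x/N)$ with $u_0\in C^5(\mathbb{T}^d)$; $\Gamma_0=\{v:u_0(v)=\alpha_*\}$ is a $(d-1)$-dimensional $C^{5+\theta}$ $(\theta>0)$ hypersurface without boundary; $\nabla u_0$ is non-degenerate in the normal direction to $\Gamma_0$ at every point of $\Gamma_0$; $u_0>\alpha_*$ in $D_0^+$ and $u_-<u_0<\alpha_*$ in $D_0^-$, the regions separated by $\Gamma_0$. **Interface flow and signed distance.** $\Gamma_t$, $t\in[0,T]$, is the smooth ($\Gamma\in C^{(5+\theta)/2,5+\theta}$) solution of $V=\lambda_0\kappa$ starting from $\Gamma_0$ ($V$: normal velocity from the $D_t^-$ side to the $D_t^+$ side; $\kappa$: mean curvature times $d-1$), where $D_t^\pm$ are the regions separated by $\Gamma_t$ continued from $D_0^\pm$ and $$\lambda_0=\frac{\int_{\alpha_-}^{\alpha_+}\varphi'(u)\sqrt{W(u)}\,du}{\int_{\alpha_-}^{\alpha_+}\sqrt{W(u)}\,du},\qquad W(u)=\int_u^{\alpha_+}f(s)\varphi'(s)\,ds.$$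 $\bar d(t,v)$ is the signed distance to $\Gamma_t$: $\mathrm{dist}(v,\Gamma_t)$ on $\overline{D_t^-}$ and $-\mathrm{dist}(v,\Gamma_t)$ on $D_t^+$; thus $\partial_t\bar d=\lambda_0\Delta\bar d$ on $\Gamma_t$. Choose $d_0>0$ so that $\bar d$ is smooth on $\{|\bar d|<3d_0\}$, let $h$ be a smooth non-decreasing function on $\mathbb{R}$ with $h(s)=s$ for $|s|\le d_0$, $h(s)=-2d_0$ for $s\le-2d_0$, $h(s)=2d_0$ for $s\ge2d_0$, and set $d(t,v)=h(\bar d(t,v))$, of class $C^{(5+\theta)/2,5+\theta}$. **Profiles.** $U_0=U_0(z)$, $z\in\mathbb{R}$, is the solution of $(\varphi(U_0))_{zz}+f(U_0)=0$, $U_0(-\infty)=\alpha_+$, $U_0(0)=\alpha_*$, $U_0(\infty)=\alpha_-$. $U_1=U_1(t,v,z)$ is the solution of $$(\varphi'(U_0)U_1)_{zz}+f'(U_0)U_1=(\lambda_0U_{0z}-(\varphi(U_0))_z)\,\Delta d(t,v),\quad U_1(t,v,0)=0,\quad \varphi'(U_0)U_1(t,v,\cdot)\in L^\infty(\mathbb{R}).$$ With $\varepsilon=K^{-1/2}$, $$p(t)=e^{-\beta t/\varepsilon^2}-e^{Lt}-\hat L,\qquad q(t)=\tilde\sigma\big(\beta e^{-\beta t/\varepsilon^2}+\varepsilon^2Le^{Lt}\big).$$ **Choice of $\beta,\tilde\sigma,L,\hat L$.** By a known result on the continuum equation, one can choose $\beta,\tilde\sigma>0$ such that for each $\hat L>1$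 there are $L>0$ large and $\varepsilon_0>0$ small such that, for some constant $C>0$ and all $\varepsilon\in(0,\varepsilon_0)$, the functions $u^\pm$ above (with $\varepsilon=K^{-1/2}$) satisfy $\mathcal{L}u^-\le-C<C\le\mathcal{L}u^+$ on $[0,T]\times\mathbb{T}^d$, where $\mathcal{L}u=\partial_tu-\Delta\varphi(u)-\varepsilon^{-2}f(u)$, and $u^-(0,v)\le u^\varepsilon(t^\varepsilon,v)\le u^+(0,v)$, where $u^\varepsilon$ solves $\mathcal{L}u^\varepsilon=0$ on $\mathbb{T}^d$ with $u^\varepsilon(0,\cdot)=u_0$ and $t^\varepsilon=\gamma^{-1}\varepsilon^2|\log\varepsilon|$. The constants $\beta,\tilde\sigma,L,\hat L$ are fixed so that these properties hold. *)

theory Defs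
  imports "HOL-Probability.Probability" "HOL-Library.Landau_Symbols"
begin

text \<open>
  Conventions. The torus \<open>(R/Z)^d\<close> is represented by its universal cover \<open>real ^ 'n\<close> with
  \<open>d = CARD('n)\<close>: functions on and subsets of the torus are the \<open>Z^d\<close>-periodic functions on and
  subsets of \<open>real ^ 'n\<close>. Likewise functions on \<open>(Z/NZ)^d\<close> are the functions on \<open>int ^ 'n\<close> that are
  \<open>N\<close>-periodic in every coordinate. Time-dependent objects on \<open>[0,T]\<close> are functions of a real
  time that are only ever constrained on \<open>{0..T}\<close>.
\<close>

subsection \<open>Zero-range marginals and the macroscopic functions\<close>

definition gfact :: "(nat \<Rightarrow> real) \<Rightarrow> nat \<Rightarrow> real" where
  "gfact g k = (\<Prod>i=1..k. g i)"

definition phi_star :: "(nat \<Rightarrow> real) \<Rightarrow> ereal" where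
  "phi_star g = liminf (\<lambda>k. ereal (g k))"

definition partition_fun :: "(nat \<Rightarrow> real) \<Rightarrow> real \<Rightarrow> real" where
  "partition_fun g a = (\<Sum>k. a ^ k / gfact g k)"

definition site_marginal :: "(nat \<Rightarrow> real) \<Rightarrow> real \<Rightarrow> nat measure" where
  "site_marginal g a =
     density (count_space UNIV) (\<lambda>k. ennreal (a ^ k / gfact g k / partition_fun g a))"

definition mean_density :: "(nat \<Rightarrow> real) \<Rightarrow> real \<Rightarrow> real" where
  "mean_density g a = (\<integral>k. real k \<partial>site_marginal g a)"

definition fugacity :: "(nat \<Rightarrow> real) \<Rightarrow> real \<Rightarrow> real" where
  "fugacity g = inv_into {a. 0 \<le> a \<and> ereal a < phi_star g} (mean_density g)"

type_synonym 'n config = "int ^ 'n \<Rightarrow> nat"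

definition zr_measure :: "(nat \<Rightarrow> real) \<Rightarrow> real \<Rightarrow> 'n::finite config measure" where
  "zr_measure g \<rho> = PiM UNIV (\<lambda>_. site_marginal g (fugacity g \<rho>))"

definition local_fun :: "('n::finite config \<Rightarrow> real) \<Rightarrow> bool" where
  "local_fun c \<longleftrightarrow>
     (\<exists>A. finite A \<and> (\<forall>\<eta> \<xi>. (\<forall>x\<in>A. \<eta> x = \<xi> x) \<longrightarrow> c \<eta> = c \<xi>))"

definition net_rate ::
  "(nat \<Rightarrow> real) \<Rightarrow> ('n::finite config \<Rightarrow> real) \<Rightarrow> ('n config \<Rightarrow> real) \<Rightarrow> real \<Rightarrow> real" where
  "net_rate g cp cm \<rho> = (\<integral>\<eta>. cp \<eta> \<partial>zr_measure g \<rho>) - (\<integral>\<eta>. cm \<eta> \<partial>zr_measure g \<rho>)"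

text \<open>
  The last assumption makes the two expectations meaningful (the Bochner integral of a
  non-integrable function is \<open>0\<close>), and positivity of \<open>phi_star g\<close> says that the range
  of fugacities is not empty.
\<close>
definition zero_range_setting ::
  "(nat \<Rightarrow> real) \<Rightarrow> ('n::finite config \<Rightarrow> real) \<Rightarrow> ('n config \<Rightarrow> real) \<Rightarrow> bool" where
  "zero_range_setting g cp cm \<longleftrightarrow>
     (\<forall>k. 0 \<le> g k \<and> (g k = 0 \<longleftrightarrow> k = 0)) \<and>
     0 < phi_star g \<and>
     filterlim (\<lambda>e. mean_density g (real_of_ereal e)) at_top (at_left (phi_star g)) \<and>
     local_fun cp \<and> local_fun cm \<and>
     (\<forall>\<eta>. 0 \<le> cp \<eta> \<and> 0 \<le> cm \<eta>) \<and>
     (\<forall>\<eta>. \<eta> 0 = 0 \<longrightarrow> cm \<eta> = 0) \<and>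
     (\<forall>\<rho>\<ge>0. integrable (zr_measure g \<rho>) cp \<and> integrable (zr_measure g \<rho>) cm)"


subsection \<open>Periodicity, partial derivatives and regularity classes\<close>

definition torus_periodic :: "(real ^ 'n::finite \<Rightarrow> 'b) \<Rightarrow> bool" where
  "torus_periodic u \<longleftrightarrow> (\<forall>v (k :: int ^ 'n). u (v + (\<chi> i. of_int (k $ i))) = u v)"

definition discrete_periodic :: "nat \<Rightarrow> (int ^ 'n::finite \<Rightarrow> 'b) \<Rightarrow> bool" where
  "discrete_periodic N u \<longleftrightarrow> (\<forall>x k. u (x + (\<chi> i. int N * k $ i)) = u x)"

definition grid_point :: "nat \<Rightarrow> int ^ 'n::finite \<Rightarrow> real ^ 'n" where
  "grid_point N x = (\<chi> i. of_int (x $ i) / real N)"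

definition pderiv_along :: "('a::euclidean_space \<Rightarrow> real) \<Rightarrow> 'a \<Rightarrow> 'a \<Rightarrow> real" where
  "pderiv_along u b v = deriv (\<lambda>s. u (v + s *\<^sub>R b)) 0"

definition grad :: "('a::euclidean_space \<Rightarrow> real) \<Rightarrow> 'a \<Rightarrow> 'a" where
  "grad u v = (\<Sum>b\<in>Basis. pderiv_along u b v *\<^sub>R b)"

definition divergence :: "('a::euclidean_space \<Rightarrow> 'a) \<Rightarrow> 'a \<Rightarrow> real" where
  "divergence F v = (\<Sum>b\<in>Basis. pderiv_along (\<lambda>w. F w \<bullet> b) b v)"

definition laplacian :: "('a::euclidean_space \<Rightarrow> real) \<Rightarrow> 'a \<Rightarrow> real" where
  "laplacian u v = (\<Sum>b\<in>Basis. pderiv_along (pderiv_along u b) b v)"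

text \<open>The class \<open>C^k\<close> on a set \<open>S\<close> that is open or a non-degenerate real interval
  (one-sided derivatives at end points).\<close>
primrec Ck_on :: "nat \<Rightarrow> 'a::euclidean_space set \<Rightarrow> ('a \<Rightarrow> real) \<Rightarrow> bool" where
  "Ck_on 0 S u \<longleftrightarrow> continuous_on S u"
| "Ck_on (Suc k) S u \<longleftrightarrow>
     (\<exists>D. (\<forall>x\<in>S. (u has_derivative D x) (at x within S)) \<and>
          (\<forall>b\<in>Basis. Ck_on k S (\<lambda>x. D x b)))"

definition smooth_on :: "'a::euclidean_space set \<Rightarrow> ('a \<Rightarrow> real) \<Rightarrow> bool" where
  "smooth_on S u \<longleftrightarrow> (\<forall>k. Ck_on k S u)"

text \<open>The Hoelder class \<open>C^{k+\<theta>}\<close>, \<open>0 < \<theta> < 1\<close>, on a ball \<open>S\<close>.\<close>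
primrec holder_on :: "nat \<Rightarrow> real \<Rightarrow> 'a::euclidean_space set \<Rightarrow> ('a \<Rightarrow> real) \<Rightarrow> bool" where
  "holder_on 0 \<theta> S u \<longleftrightarrow>
     (\<exists>C. \<forall>x\<in>S. \<forall>y\<in>S. \<bar>u x - u y\<bar> \<le> C * dist x y powr \<theta>)"
| "holder_on (Suc k) \<theta> S u \<longleftrightarrow>
     (\<exists>D. (\<forall>x\<in>S. (u has_derivative D x) (at x within S)) \<and>
          (\<forall>b\<in>Basis. holder_on k \<theta> S (\<lambda>x. D x b)))"

text \<open>
  The parabolic Hoelder class \<open>C^{(k+\<theta>)/2, k+\<theta>}\<close>, \<open>0 < \<theta> < 1\<close>, on \<open>I \<times> B\<close> with \<open>I\<close> an interval
  and \<open>B\<close> a ball: all derivatives with \<open>r\<close> derivatives in time and \<open>s\<close> in space, \<open>2r + s \<le> k\<close>,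
  exist; those with \<open>2r + s = k\<close> are Hoelder of exponent \<open>\<theta>\<close> in space and \<open>\<theta>/2\<close> in time,
  those with \<open>2r + s = k - 1\<close> are Hoelder of exponent \<open>(1+\<theta>)/2\<close> in time.
\<close>
fun parabolic_holder_on ::
  "nat \<Rightarrow> real \<Rightarrow> real set \<Rightarrow> 'a::euclidean_space set \<Rightarrow> (real \<Rightarrow> 'a \<Rightarrow> real) \<Rightarrow> bool" where
  "parabolic_holder_on 0 \<theta> I B u \<longleftrightarrow>
     (\<exists>C. \<forall>s\<in>I. \<forall>t\<in>I. \<forall>x\<in>B. \<forall>y\<in>B.
        \<bar>u s x - u t y\<bar> \<le> C * (dist x y powr \<theta> + dist s t powr (\<theta> / 2)))"
| "parabolic_holder_on (Suc 0) \<theta> I B u \<longleftrightarrow>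
     (\<exists>D. (\<forall>t\<in>I. \<forall>x\<in>B. (u t has_derivative D t x) (at x within B)) \<and>
          (\<forall>b\<in>Basis. parabolic_holder_on 0 \<theta> I B (\<lambda>t x. D t x b))) \<and>
     (\<exists>C. \<forall>s\<in>I. \<forall>t\<in>I. \<forall>x\<in>B. \<bar>u s x - u t x\<bar> \<le> C * dist s t powr ((1 + \<theta>) / 2))"
| "parabolic_holder_on (Suc (Suc k)) \<theta> I B u \<longleftrightarrow>
     (\<exists>D. (\<forall>t\<in>I. \<forall>x\<in>B. (u t has_derivative D t x) (at x within B)) \<and>
          (\<forall>b\<in>Basis. parabolic_holder_on (Suc k) \<theta> I B (\<lambda>t x. D t x b))) \<and>
     (\<exists>E. (\<forall>t\<in>I. \<forall>x\<in>B. ((\<lambda>s. u s x) has_real_derivative E t x) (at t within I)) \<and>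
          parabolic_holder_on k \<theta> I B E)"


subsection \<open>The reaction term\<close>

definition bistable ::
  "(real \<Rightarrow> real) \<Rightarrow> (real \<Rightarrow> real) \<Rightarrow> real \<Rightarrow> real \<Rightarrow> real \<Rightarrow> bool" where
  "bistable \<phi> f \<alpha>m \<alpha>s \<alpha>p \<longleftrightarrow>
     0 < \<alpha>m \<and> \<alpha>m < \<alpha>s \<and> \<alpha>s < \<alpha>p \<and>
     {\<rho>. 0 \<le> \<rho> \<and> f \<rho> = 0} = {\<alpha>m, \<alpha>s, \<alpha>p} \<and>
     deriv f \<alpha>m < 0 \<and> deriv f \<alpha>s > 0 \<and> deriv f \<alpha>p < 0 \<and>
     integral {\<alpha>m..\<alpha>p} (\<lambda>\<rho>. f \<rho> * deriv \<phi> \<rho>) = 0"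

definition potential :: "(real \<Rightarrow> real) \<Rightarrow> (real \<Rightarrow> real) \<Rightarrow> real \<Rightarrow> real \<Rightarrow> real" where
  "potential \<phi> f \<alpha>p u = integral {u..\<alpha>p} (\<lambda>s. f s * deriv \<phi> s)"

definition flow_speed :: "(real \<Rightarrow> real) \<Rightarrow> (real \<Rightarrow> real) \<Rightarrow> real \<Rightarrow> real \<Rightarrow> real" where
  "flow_speed \<phi> f \<alpha>m \<alpha>p =
     integral {\<alpha>m..\<alpha>p} (\<lambda>u. deriv \<phi> u * sqrt (potential \<phi> f \<alpha>p u)) /
     integral {\<alpha>m..\<alpha>p} (\<lambda>u. sqrt (potential \<phi> f \<alpha>p u))"


subsection \<open>Hypersurfaces and the interface flow\<close>

definition holder_hypersurface :: "nat \<Rightarrow> real \<Rightarrow> 'a::euclidean_space set \<Rightarrow> bool" where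
  "holder_hypersurface k \<theta> \<Gamma> \<longleftrightarrow>
     closed \<Gamma> \<and> \<Gamma> \<noteq> {} \<and>
     (\<forall>v\<in>\<Gamma>. \<exists>r>0. \<exists>\<psi>. holder_on k \<theta> (ball v r) \<psi> \<and>
        (\<forall>w\<in>ball v r. grad \<psi> w \<noteq> 0 \<and> (w \<in> \<Gamma> \<longleftrightarrow> \<psi> w = 0)))"

definition unit_normal :: "'a::euclidean_space set \<Rightarrow> 'a \<Rightarrow> 'a \<Rightarrow> bool" where
  "unit_normal \<Gamma> v n \<longleftrightarrow>
     (\<exists>r>0. \<exists>\<psi>. Ck_on 1 (ball v r) \<psi> \<and> grad \<psi> v \<noteq> 0 \<and>
        (\<forall>w\<in>ball v r. w \<in> \<Gamma> \<longleftrightarrow> \<psi> w = 0) \<and> n = sgn (grad \<psi> v))"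

text \<open>
  Normal velocity and curvature (mean curvature times \<open>d - 1\<close>) of the moving hypersurface
  \<open>{v. \<psi> t v = 0}\<close>, where \<open>\<psi> > 0\<close> on the minus side and \<open>\<psi> < 0\<close> on the plus side. The unit normal
  from the minus to the plus side is \<open>n = - sgn (grad (\<psi> t) v)\<close>. A point \<open>v t\<close> of the hypersurface
  satisfies \<open>\<partial>\<psi>/\<partial>t + grad \<psi> \<bullet> v' = 0\<close>, so that \<open>v' \<bullet> n = (\<partial>\<psi>/\<partial>t) / norm (grad \<psi>)\<close>. The curvature is
  \<open>- div n\<close>, positive where the plus region is a ball; if \<open>\<psi>\<close> is the signed distance, velocity and
  curvature are \<open>\<partial>\<psi>/\<partial>t\<close> and the Laplacian of \<open>\<psi>\<close>.
\<close>
definition normal_velocity ::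
  "real \<Rightarrow> (real \<Rightarrow> 'a::euclidean_space \<Rightarrow> real) \<Rightarrow> real \<Rightarrow> 'a \<Rightarrow> real" where
  "normal_velocity T \<psi> t v =
     vector_derivative (\<lambda>s. \<psi> s v) (at t within {0..T}) / norm (grad (\<psi> t) v)"

definition curvature :: "('a::euclidean_space \<Rightarrow> real) \<Rightarrow> 'a \<Rightarrow> real" where
  "curvature \<psi> v = divergence (\<lambda>w. sgn (grad \<psi> w)) v"

text \<open>
  A solution of \<open>V = l * \<kappa>\<close> on \<open>[0,T]\<close> of class \<open>C^{(k+\<theta>)/2, k+\<theta>}\<close>, together with the two
  regions it separates. Openness of the regions in space-time expresses that the regions at time
  \<open>t\<close> are continued from those at time \<open>0\<close>.
\<close>
definition interface_flow ::
  "nat \<Rightarrow> real \<Rightarrow> real \<Rightarrow> real \<Rightarrow> (real \<Rightarrow> (real ^ 'n::finite) set) \<Rightarrow>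
   (real \<Rightarrow> (real ^ 'n) set) \<Rightarrow> (real \<Rightarrow> (real ^ 'n) set) \<Rightarrow> bool" where
  "interface_flow k \<theta> T l \<Gamma> Dp Dm \<longleftrightarrow>
     (\<forall>t\<in>{0..T}.
        torus_periodic (\<lambda>v. v \<in> \<Gamma> t) \<and>
        torus_periodic (\<lambda>v. v \<in> Dp t) \<and> torus_periodic (\<lambda>v. v \<in> Dm t) \<and>
        \<Gamma> t \<noteq> {} \<and>
        \<Gamma> t \<union> Dp t \<union> Dm t = UNIV \<and>
        \<Gamma> t \<inter> Dp t = {} \<and> \<Gamma> t \<inter> Dm t = {} \<and> Dp t \<inter> Dm t = {}) \<and>
     openin (top_of_set ({0..T} \<times> UNIV)) {(t, v). t \<in> {0..T} \<and> v \<in> Dp t} \<and>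
     openin (top_of_set ({0..T} \<times> UNIV)) {(t, v). t \<in> {0..T} \<and> v \<in> Dm t} \<and>
     (\<forall>t\<in>{0..T}. \<forall>v\<in>\<Gamma> t. \<exists>r>0. \<exists>\<psi>.
        parabolic_holder_on k \<theta> ({0..T} \<inter> ball t r) (ball v r) \<psi> \<and>
        (\<forall>s\<in>{0..T} \<inter> ball t r. \<forall>w\<in>ball v r.
           grad (\<psi> s) w \<noteq> 0 \<and>
           (w \<in> \<Gamma> s \<longleftrightarrow> \<psi> s w = 0) \<and> (w \<in> Dm s \<longleftrightarrow> 0 < \<psi> s w) \<and> (w \<in> Dp s \<longleftrightarrow> \<psi> s w < 0) \<and>
           (w \<in> \<Gamma> s \<longrightarrow> normal_velocity T \<psi> s w = l * curvature (\<psi> s) w)))"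

text \<open>For a periodic set the distance on the torus is the Euclidean distance to its lift.\<close>
definition signed_dist ::
  "(real \<Rightarrow> (real ^ 'n::finite) set) \<Rightarrow> (real \<Rightarrow> (real ^ 'n) set) \<Rightarrow> real \<Rightarrow> real ^ 'n \<Rightarrow> real" where
  "signed_dist \<Gamma> Dp t v = (if v \<in> Dp t then - infdist v (\<Gamma> t) else infdist v (\<Gamma> t))"

definition cutoff :: "real \<Rightarrow> (real \<Rightarrow> real) \<Rightarrow> bool" where
  "cutoff d0 h \<longleftrightarrow> smooth_on UNIV h \<and> mono h \<and>
     (\<forall>s. \<bar>s\<bar> \<le> d0 \<longrightarrow> h s = s) \<and>
     (\<forall>s. s \<le> - 2 * d0 \<longrightarrow> h s = - 2 * d0) \<and> (\<forall>s. 2 * d0 \<le> s \<longrightarrow> h s = 2 * d0)"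


subsection \<open>The discrete and the continuum equation\<close>

definition discrete_laplacian :: "nat \<Rightarrow> (int ^ 'n::finite \<Rightarrow> real) \<Rightarrow> int ^ 'n \<Rightarrow> real" where
  "discrete_laplacian N w x =
     (real N)\<^sup>2 * (\<Sum>i\<in>UNIV. w (x + axis i 1) + w (x - axis i 1) - 2 * w x)"

text \<open>In both equations the non-negativity clause only says that the solution takes values in
  the domain \<open>[0,\<infinity>)\<close> of \<open>\<phi>\<close> and \<open>f\<close>.\<close>
definition discrete_solution ::
  "(real \<Rightarrow> real) \<Rightarrow> (real \<Rightarrow> real) \<Rightarrow> nat \<Rightarrow> real \<Rightarrow> (real \<Rightarrow> int ^ 'n::finite \<Rightarrow> real) \<Rightarrow> bool" where
  "discrete_solution \<phi> f N K u \<longleftrightarrow>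
     (\<forall>t\<ge>0. discrete_periodic N (u t) \<and>
        (\<forall>x. 0 \<le> u t x \<and>
           ((\<lambda>s. u s x) has_real_derivative
              discrete_laplacian N (\<lambda>y. \<phi> (u t y)) x + K * f (u t x)) (at t within {0..})))"

definition continuum_solution ::
  "(real \<Rightarrow> real) \<Rightarrow> (real \<Rightarrow> real) \<Rightarrow> real \<Rightarrow> (real ^ 'n::finite \<Rightarrow> real) \<Rightarrow>
   (real \<Rightarrow> real ^ 'n \<Rightarrow> real) \<Rightarrow> bool" where
  "continuum_solution \<phi> f \<epsilon> u0 u \<longleftrightarrow>
     u 0 = u0 \<and>
     (\<forall>t\<ge>0. torus_periodic (u t) \<and> Ck_on 2 UNIV (u t) \<and>
        (\<forall>v. 0 \<le> u t v \<and>
           ((\<lambda>s. u s v) has_real_derivative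
              laplacian (\<lambda>w. \<phi> (u t w)) v + f (u t v) / \<epsilon>\<^sup>2) (at t within {0..}))) \<and>
     continuous_on ({0..} \<times> UNIV) (\<lambda>(t, v). u t v) \<and>
     (\<forall>b\<in>Basis. continuous_on ({0..} \<times> UNIV) (\<lambda>(t, v). pderiv_along (u t) b v)) \<and>
     (\<forall>b\<in>Basis. \<forall>c\<in>Basis.
        continuous_on ({0..} \<times> UNIV) (\<lambda>(t, v). pderiv_along (pderiv_along (u t) b) c v))"

definition ac_operator ::
  "(real \<Rightarrow> real) \<Rightarrow> (real \<Rightarrow> real) \<Rightarrow> real \<Rightarrow> real \<Rightarrow> (real \<Rightarrow> real ^ 'n::finite \<Rightarrow> real) \<Rightarrow>
   real \<Rightarrow> real ^ 'n \<Rightarrow> real" where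
  "ac_operator \<phi> f T \<epsilon> u t v =
     vector_derivative (\<lambda>s. u s v) (at t within {0..T})
       - laplacian (\<lambda>w. \<phi> (u t w)) v - f (u t v) / \<epsilon>\<^sup>2"


subsection \<open>Profiles and barriers\<close>

definition profile0 ::
  "(real \<Rightarrow> real) \<Rightarrow> (real \<Rightarrow> real) \<Rightarrow> real \<Rightarrow> real \<Rightarrow> real \<Rightarrow> (real \<Rightarrow> real) \<Rightarrow> bool" where
  "profile0 \<phi> f \<alpha>m \<alpha>s \<alpha>p U0 \<longleftrightarrow>
     (\<forall>z. 0 \<le> U0 z) \<and>
     (\<exists>D. \<forall>z. ((\<lambda>y. \<phi> (U0 y)) has_real_derivative D z) (at z) \<and>
              (D has_real_derivative - f (U0 z)) (at z)) \<and>
     (U0 \<longlongrightarrow> \<alpha>p) at_bot \<and> U0 0 = \<alpha>s \<and> (U0 \<longlongrightarrow> \<alpha>m) at_top"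

definition profile1 ::
  "(real \<Rightarrow> real) \<Rightarrow> (real \<Rightarrow> real) \<Rightarrow> real \<Rightarrow> real \<Rightarrow> (real \<Rightarrow> real ^ 'n::finite \<Rightarrow> real) \<Rightarrow>
   (real \<Rightarrow> real) \<Rightarrow> (real \<Rightarrow> real ^ 'n \<Rightarrow> real \<Rightarrow> real) \<Rightarrow> bool" where
  "profile1 \<phi> f l T d U0 U1 \<longleftrightarrow>
     (\<forall>t\<in>{0..T}. \<forall>v.
        (\<exists>D. \<forall>z. ((\<lambda>y. deriv \<phi> (U0 y) * U1 t v y) has_real_derivative D z) (at z) \<and>
           (D has_real_derivative
              (l * deriv U0 z - deriv (\<lambda>y. \<phi> (U0 y)) z) * laplacian (d t) v
                - deriv f (U0 z) * U1 t v z) (at z)) \<and>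
        U1 t v 0 = 0 \<and>
        bounded (range (\<lambda>z. deriv \<phi> (U0 z) * U1 t v z)))"

definition p_fun :: "real \<Rightarrow> real \<Rightarrow> real \<Rightarrow> real \<Rightarrow> real \<Rightarrow> real" where
  "p_fun \<beta> L Lh \<epsilon> t = exp (- \<beta> * t / \<epsilon>\<^sup>2) - exp (L * t) - Lh"

definition q_fun :: "real \<Rightarrow> real \<Rightarrow> real \<Rightarrow> real \<Rightarrow> real \<Rightarrow> real" where
  "q_fun \<beta> \<sigma> L \<epsilon> t = \<sigma> * (\<beta> * exp (- \<beta> * t / \<epsilon>\<^sup>2) + \<epsilon>\<^sup>2 * L * exp (L * t))"

text \<open>The functions \<open>u\<^sup>\<plusminus>\<close>, for \<open>sg = 1\<close> and \<open>sg = - 1\<close>; \<open>\<epsilon> = K powr (- 1/2)\<close>.\<close>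
definition barrier ::
  "(real \<Rightarrow> real) \<Rightarrow> (real \<Rightarrow> real ^ 'n::finite \<Rightarrow> real \<Rightarrow> real) \<Rightarrow> (real \<Rightarrow> real ^ 'n \<Rightarrow> real) \<Rightarrow>
   real \<Rightarrow> real \<Rightarrow> real \<Rightarrow> real \<Rightarrow> real \<Rightarrow> real \<Rightarrow> real \<Rightarrow> real ^ 'n \<Rightarrow> real" where
  "barrier U0 U1 d \<beta> \<sigma> L Lh sg K t v =
     (let \<epsilon> = K powr (- 1/2);
          z = K powr (1/2) * d t v + sg * p_fun \<beta> L Lh \<epsilon> t
      in U0 z + K powr (- 1/2) * U1 t v z + sg * q_fun \<beta> \<sigma> L \<epsilon> t)"

text \<open>
  The requirement on the constants, in terms of \<open>um \<epsilon>\<close>, \<open>up \<epsilon>\<close> (the barriers for \<open>K = 1/\<epsilon>\<^sup>2\<close>) and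
  the solutions \<open>ue \<epsilon>\<close> of the continuum equation. Non-negativity of \<open>um\<close> and \<open>up\<close> is
  what it takes for \<open>\<phi>\<close> and \<open>f\<close> to be applicable to them.
\<close>
definition admissible_barriers ::
  "(real \<Rightarrow> real) \<Rightarrow> (real \<Rightarrow> real) \<Rightarrow> real \<Rightarrow> real \<Rightarrow>
   (real \<Rightarrow> real \<Rightarrow> real ^ 'n::finite \<Rightarrow> real) \<Rightarrow> (real \<Rightarrow> real \<Rightarrow> real ^ 'n \<Rightarrow> real) \<Rightarrow>
   (real \<Rightarrow> real \<Rightarrow> real ^ 'n \<Rightarrow> real) \<Rightarrow> bool" where
  "admissible_barriers \<phi> f \<gamma> T um up ue \<longleftrightarrow>
     (\<exists>\<epsilon>0>0. \<exists>C>0. \<forall>\<epsilon>. 0 < \<epsilon> \<and> \<epsilon> < \<epsilon>0 \<longrightarrow>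
        (\<forall>t\<in>{0..T}. \<forall>v.
           0 \<le> um \<epsilon> t v \<and> 0 \<le> up \<epsilon> t v \<and>
           ac_operator \<phi> f T \<epsilon> (um \<epsilon>) t v \<le> - C \<and>
           C \<le> ac_operator \<phi> f T \<epsilon> (up \<epsilon>) t v) \<and>
        (\<forall>v. um \<epsilon> 0 v \<le> ue \<epsilon> (\<epsilon>\<^sup>2 * \<bar>ln \<epsilon>\<bar> / \<gamma>) v \<and>
             ue \<epsilon> (\<epsilon>\<^sup>2 * \<bar>ln \<epsilon>\<bar> / \<gamma>) v \<le> up \<epsilon> 0 v))"

end

theory Submission
  imports Defs
begin

text \<open>
  The functions \<open>u\<^sup>\<plusminus>\<close> miss the continuum equation by a margin \<open>C\<close> that does not depend on \<open>K\<close>. Passing to the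
  lattice changes the Laplacian only. Hence, as soon as the discretisation error of \<open>\<phi>(u\<^sup>\<plusminus>)\<close> is at most \<open>C\<close>,
  the barriers are a sub- and a supersolution of the discrete equation, and the maximum principle for
  that equation (\<open>discrete_comparison\<close>) propagates the ordering from time \<open>0\<close> to all times.
  
  The barriers vary on the length scale \<open>\<epsilon> = K powr (-1/2)\<close>. In the stretched variable the functions
  \<open>x \<mapsto> \<phi>(u\<^sup>\<plusminus>(t, \<epsilon> x))\<close> have derivatives up to order three bounded uniformly in \<open>t\<close> and \<open>\<epsilon>\<close>
  (\<open>barrier_regularity\<close>). Taylor's formula then bounds the discretisation error by a multiple of
  \<open>1 / (N \<epsilon>\<^sup>3) = K powr (3/2) / N\<close> (\<open>discretisation_error\<close>), and this tends to \<open>0\<close> precisely when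
  \<open>K = o(N powr (2/3))\<close>.
  
  The uniform bounds rest on three facts. The cut-off distance \<open>d\<close> is locally either a smooth function of
  a signed distance of parabolic class \<open>C\<^sup>5\<close> or constant (\<open>cut_distance_local\<close>), and compactness and
  periodicity turn this into global bounds (\<open>uniform_Ck_of_local_periodic\<close>). The profile \<open>U\<^sub>0\<close> stays in a compact
  subset of \<open>(0,\<infinity>)\<close>, where its equation is non-degenerate and can be differentiated repeatedly
  (\<open>profile0_standing_wave\<close>, \<open>uniform_Ck1_U_D\<close>). Finally, the equation for \<open>U\<^sub>1\<close> is linear with a right-hand side
  proportional to the Laplacian of \<open>d\<close>, and its bounded solutions vanishing at \<open>z = 0\<close> are unique
  (\<open>linearised_kernel\<close>). Hence \<open>U\<^sub>1(t, v, z)\<close> is the product of that Laplacian at \<open>(t, v)\<close> and a function of \<open>z\<close>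
  (\<open>corrector_separates\<close>), which is how the dependence on \<open>t\<close> and \<open>v\<close> becomes explicit. Three
  derivatives of the Laplacian of \<open>d\<close> are five derivatives of \<open>d\<close>.
\<close>

section \<open>Families of functions with uniformly bounded derivatives\<close>

text \<open>
  A family \<open>F p\<close> of functions, each on its slice \<open>{x. (p, x) \<in> Q}\<close>, whose derivatives up to order \<open>k\<close> have a
  common bound. Derivatives are taken within the slice, so that closed intervals are covered as well as
  open sets. The bound \<open>M\<close> is a parameter because it has to be the same for the infinitely many
  translates of a fundamental cell that are put together later on.
\<close>
primrec bounded_Ck ::
  "nat \<Rightarrow> real \<Rightarrow> ('p \<times> 'a::euclidean_space) set \<Rightarrow> ('p \<Rightarrow> 'a \<Rightarrow> real) \<Rightarrow> bool" where
  "bounded_Ck 0 M Q F \<longleftrightarrow> (\<forall>p x. (p, x) \<in> Q \<longrightarrow> \<bar>F p x\<bar> \<le> M)"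
| "bounded_Ck (Suc k) M Q F \<longleftrightarrow>
     (\<forall>p x. (p, x) \<in> Q \<longrightarrow> \<bar>F p x\<bar> \<le> M) \<and>
     (\<exists>D. (\<forall>p x. (p, x) \<in> Q \<longrightarrow> (F p has_derivative D p x) (at x within {y. (p, y) \<in> Q})) \<and>
          (\<forall>b\<in>Basis. bounded_Ck k M Q (\<lambda>p x. D p x b)))"

definition uniform_Ck ::
  "nat \<Rightarrow> ('p \<times> 'a::euclidean_space) set \<Rightarrow> ('p \<Rightarrow> 'a \<Rightarrow> real) \<Rightarrow> bool" where
  "uniform_Ck k Q F \<longleftrightarrow> (\<exists>M. bounded_Ck k M Q F)"

lemma bounded_Ck_bound: "bounded_Ck k M Q F \<Longrightarrow> (p, x) \<in> Q \<Longrightarrow> \<bar>F p x\<bar> \<le> M"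
  by (cases k) auto

lemma bounded_Ck_mono: "bounded_Ck k M Q F \<Longrightarrow> M \<le> M' \<Longrightarrow> bounded_Ck k M' Q F"
proof (induction k arbitrary: F)
  case 0 then show ?case by fastforce
next
  case (Suc k)
  then obtain D where
    D: "\<forall>p x. (p, x) \<in> Q \<longrightarrow> (F p has_derivative D p x) (at x within {y. (p, y) \<in> Q})"
       "\<forall>b\<in>Basis. bounded_Ck k M Q (\<lambda>p x. D p x b)" by auto
  have "\<forall>b\<in>Basis. bounded_Ck k M' Q (\<lambda>p x. D p x b)" using D(2) Suc.IH Suc.prems(2) by blast
  moreover have "\<forall>p x. (p, x) \<in> Q \<longrightarrow> \<bar>F p x\<bar> \<le> M'" using Suc.prems by fastforce
  ultimately show ?case using D(1) by auto
qed

lemma bounded_Ck_cong: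
  assumes "\<And>p x. (p, x) \<in> Q \<Longrightarrow> F p x = G p x" "bounded_Ck k M Q F"
  shows "bounded_Ck k M Q G"
proof (cases k)
  case 0 then show ?thesis using assms by auto
next
  case (Suc j)
  then obtain D where
    D: "\<forall>p x. (p, x) \<in> Q \<longrightarrow> (F p has_derivative D p x) (at x within {y. (p, y) \<in> Q})"
       "\<forall>b\<in>Basis. bounded_Ck j M Q (\<lambda>p x. D p x b)" using assms(2) by auto
  have "(G p has_derivative D p x) (at x within {y. (p, y) \<in> Q})" if "(p, x) \<in> Q" for p x
    using has_derivative_transform[of x "{y. (p, y) \<in> Q}" "G p" "F p" "D p x"] D(1) that assms(1)
    by auto
  moreover have "\<forall>p x. (p, x) \<in> Q \<longrightarrow> \<bar>G p x\<bar> \<le> M"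
    using assms bounded_Ck_bound[OF assms(2)] by metis
  ultimately show ?thesis using D(2) Suc by auto
qed

lemma uniform_Ck_cong:
  "(\<And>p x. (p, x) \<in> Q \<Longrightarrow> F p x = G p x) \<Longrightarrow> uniform_Ck k Q F \<Longrightarrow> uniform_Ck k Q G"
  unfolding uniform_Ck_def using bounded_Ck_cong by metis

lemma uniform_Ck_0: "uniform_Ck 0 Q F \<longleftrightarrow> (\<exists>M. \<forall>p x. (p, x) \<in> Q \<longrightarrow> \<bar>F p x\<bar> \<le> M)"
  by (simp add: uniform_Ck_def)

lemma uniform_Ck_Suc:
  "uniform_Ck (Suc k) Q F \<longleftrightarrow> uniform_Ck 0 Q F \<and>
     (\<exists>D. (\<forall>p x. (p, x) \<in> Q \<longrightarrow> (F p has_derivative D p x) (at x within {y. (p, y) \<in> Q})) \<and>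
          (\<forall>b\<in>Basis. uniform_Ck k Q (\<lambda>p x. D p x b)))" (is "?L \<longleftrightarrow> ?R")
proof
  show "?L \<Longrightarrow> ?R" unfolding uniform_Ck_def by (simp, blast)
next
  assume ?R
  then obtain D M where
    D: "\<forall>p x. (p, x) \<in> Q \<longrightarrow> (F p has_derivative D p x) (at x within {y. (p, y) \<in> Q})"
       "\<forall>b\<in>Basis. uniform_Ck k Q (\<lambda>p x. D p x b)" 
    and M: "\<forall>p x. (p, x) \<in> Q \<longrightarrow> \<bar>F p x\<bar> \<le> M" unfolding uniform_Ck_def by auto
  from D(2) obtain m where m: "\<forall>b\<in>Basis. bounded_Ck k (m b) Q (\<lambda>p x. D p x b)"
    unfolding uniform_Ck_def by metis
  define M' where "M' = Max (insert M (m ` (Basis::'b set)))"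
  have le: "M \<le> M'" "\<And>b. b \<in> Basis \<Longrightarrow> m b \<le> M'"
    unfolding M'_def by (auto intro!: Max_ge simp del: Max_insert)
  have "bounded_Ck (Suc k) M' Q F"
    using D(1) m bounded_Ck_mono[OF _ le(2)] M le(1) order_trans by (simp, blast)
  then show ?L unfolding uniform_Ck_def by blast
qed

lemma uniform_Ck_SucE:
  assumes "uniform_Ck (Suc k) Q F"
  obtains D where
    "\<And>p x. (p, x) \<in> Q \<Longrightarrow> (F p has_derivative D p x) (at x within {y. (p, y) \<in> Q})"
    "\<And>b. b \<in> Basis \<Longrightarrow> uniform_Ck k Q (\<lambda>p x. D p x b)"
  using assms unfolding uniform_Ck_Suc by blast

lemma uniform_Ck_SucI:
  assumes "uniform_Ck 0 Q F"
    "\<And>p x. (p, x) \<in> Q \<Longrightarrow> (F p has_derivative D p x) (at x within {y. (p, y) \<in> Q})"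
    "\<And>b. b \<in> Basis \<Longrightarrow> uniform_Ck k Q (\<lambda>p x. D p x b)"
  shows "uniform_Ck (Suc k) Q F"
  unfolding uniform_Ck_Suc using assms by blast

lemma uniform_Ck_imp_bounded: "uniform_Ck k Q F \<Longrightarrow> uniform_Ck 0 Q F"
  unfolding uniform_Ck_def using bounded_Ck_bound by fastforce

lemma uniform_Ck_Suc_lower: "uniform_Ck (Suc k) Q F \<Longrightarrow> uniform_Ck k Q F"
proof (induction k arbitrary: F)
  case 0 then show ?case by (rule uniform_Ck_imp_bounded)
next
  case (Suc k)
  obtain D where
    D: "\<And>p x. (p, x) \<in> Q \<Longrightarrow> (F p has_derivative D p x) (at x within {y. (p, y) \<in> Q})"
       "\<And>b. b \<in> Basis \<Longrightarrow> uniform_Ck (Suc k) Q (\<lambda>p x. D p x b)"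
    using uniform_Ck_SucE[OF Suc.prems] by blast
  show ?case
    by (rule uniform_Ck_SucI[of Q F D]) (use D Suc uniform_Ck_imp_bounded in blast)+
qed

lemma uniform_Ck_lower: "uniform_Ck k Q F \<Longrightarrow> j \<le> k \<Longrightarrow> uniform_Ck j Q F"
  by (induction k) (auto simp: le_Suc_eq dest: uniform_Ck_Suc_lower)

lemma uniform_Ck_const:
  assumes "\<And>p x. (p, x) \<in> Q \<Longrightarrow> \<bar>c p\<bar> \<le> M"
  shows "uniform_Ck k Q (\<lambda>p x. c p)"
proof -
  have "uniform_Ck k Q (\<lambda>p x. c p)" if "\<forall>p x. (p, x) \<in> Q \<longrightarrow> \<bar>c p\<bar> \<le> M" for c :: "'a \<Rightarrow> real" and M
    using that
  proof (induction k arbitrary: c M)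
    case 0 then show ?case by (auto simp: uniform_Ck_0)
  next
    case (Suc k)
    show ?case
    proof (rule uniform_Ck_SucI[where D = "\<lambda>p x b. 0"])
      show "uniform_Ck 0 Q (\<lambda>p x. c p)" using Suc.prems by (auto simp: uniform_Ck_0)
      show "uniform_Ck k Q (\<lambda>p x. 0)" for b using Suc.IH[of "\<lambda>_. 0" 0] by simp
    qed auto
  qed
  then show ?thesis using assms by blast
qed

lemma uniform_Ck_add:
  "uniform_Ck k Q F \<Longrightarrow> uniform_Ck k Q G \<Longrightarrow> uniform_Ck k Q (\<lambda>p x. F p x + G p x)"
proof (induction k arbitrary: F G)
  case 0
  then obtain M M' where "\<forall>p x. (p, x) \<in> Q \<longrightarrow> \<bar>F p x\<bar> \<le> M" "\<forall>p x. (p, x) \<in> Q \<longrightarrow> \<bar>G p x\<bar> \<le> M'"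
    unfolding uniform_Ck_0 by auto
  then have "\<forall>p x. (p, x) \<in> Q \<longrightarrow> \<bar>F p x + G p x\<bar> \<le> M + M'"
    by (smt (verit))
  then show ?case unfolding uniform_Ck_0 by blast
next
  case (Suc k)
  obtain D where
    D: "\<And>p x. (p, x) \<in> Q \<Longrightarrow> (F p has_derivative D p x) (at x within {y. (p, y) \<in> Q})"
       "\<And>b. b \<in> Basis \<Longrightarrow> uniform_Ck k Q (\<lambda>p x. D p x b)"
    using uniform_Ck_SucE[OF Suc.prems(1)] by blast
  obtain E where
    E: "\<And>p x. (p, x) \<in> Q \<Longrightarrow> (G p has_derivative E p x) (at x within {y. (p, y) \<in> Q})"
       "\<And>b. b \<in> Basis \<Longrightarrow> uniform_Ck k Q (\<lambda>p x. E p x b)"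
    using uniform_Ck_SucE[OF Suc.prems(2)] by blast
  have "uniform_Ck 0 Q F" "uniform_Ck 0 Q G"
    using Suc.prems uniform_Ck_imp_bounded by blast+
  then obtain M M' where "\<forall>p x. (p, x) \<in> Q \<longrightarrow> \<bar>F p x\<bar> \<le> M" "\<forall>p x. (p, x) \<in> Q \<longrightarrow> \<bar>G p x\<bar> \<le> M'"
    unfolding uniform_Ck_0 by auto
  then have "\<forall>p x. (p, x) \<in> Q \<longrightarrow> \<bar>F p x + G p x\<bar> \<le> M + M'" by (smt (verit))
  then have b: "uniform_Ck 0 Q (\<lambda>p x. F p x + G p x)" unfolding uniform_Ck_0 by blast
  show ?case
    by (rule uniform_Ck_SucI[OF b, where D = "\<lambda>p x b. D p x b + E p x b"])
      (auto intro: has_derivative_add D E Suc.IH)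
qed

lemma uniform_Ck_mult:
  "uniform_Ck k Q F \<Longrightarrow> uniform_Ck k Q G \<Longrightarrow> uniform_Ck k Q (\<lambda>p x. F p x * G p x)"
proof (induction k arbitrary: F G)
  case 0
  then obtain M M' where M: "\<forall>p x. (p, x) \<in> Q \<longrightarrow> \<bar>F p x\<bar> \<le> M" "\<forall>p x. (p, x) \<in> Q \<longrightarrow> \<bar>G p x\<bar> \<le> M'"
    unfolding uniform_Ck_0 by auto
  have "\<forall>p x. (p, x) \<in> Q \<longrightarrow> \<bar>F p x * G p x\<bar> \<le> M * M'"
    using M by (simp add: abs_mult mult_mono')
  then show ?case unfolding uniform_Ck_0 by blast
next
  case (Suc k)
  obtain D where
    D: "\<And>p x. (p, x) \<in> Q \<Longrightarrow> (F p has_derivative D p x) (at x within {y. (p, y) \<in> Q})"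
       "\<And>b. b \<in> Basis \<Longrightarrow> uniform_Ck k Q (\<lambda>p x. D p x b)"
    using uniform_Ck_SucE[OF Suc.prems(1)] by blast
  obtain E where
    E: "\<And>p x. (p, x) \<in> Q \<Longrightarrow> (G p has_derivative E p x) (at x within {y. (p, y) \<in> Q})"
       "\<And>b. b \<in> Basis \<Longrightarrow> uniform_Ck k Q (\<lambda>p x. E p x b)"
    using uniform_Ck_SucE[OF Suc.prems(2)] by blast
  have "uniform_Ck 0 Q F" "uniform_Ck 0 Q G"
    using Suc.prems uniform_Ck_imp_bounded by blast+
  then obtain M M' where M: "\<forall>p x. (p, x) \<in> Q \<longrightarrow> \<bar>F p x\<bar> \<le> M" "\<forall>p x. (p, x) \<in> Q \<longrightarrow> \<bar>G p x\<bar> \<le> M'"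
    unfolding uniform_Ck_0 by auto
  have "\<forall>p x. (p, x) \<in> Q \<longrightarrow> \<bar>F p x * G p x\<bar> \<le> M * M'"
    using M by (simp add: abs_mult mult_mono')
  then have b: "uniform_Ck 0 Q (\<lambda>p x. F p x * G p x)" unfolding uniform_Ck_0 by blast
  show ?case
    by (rule uniform_Ck_SucI[OF b, where D = "\<lambda>p x b. F p x * E p x b + D p x b * G p x"])
      (auto intro!: has_derivative_mult D E Suc.IH uniform_Ck_add
        uniform_Ck_Suc_lower[OF Suc.prems(1)] uniform_Ck_Suc_lower[OF Suc.prems(2)])
qed

lemma uniform_Ck_cmult:
  assumes "uniform_Ck k Q F" shows "uniform_Ck k Q (\<lambda>p x. c * F p x)"
  by (rule uniform_Ck_mult[OF uniform_Ck_const assms]) (rule order_refl)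

lemma uniform_Ck_minus: "uniform_Ck k Q F \<Longrightarrow> uniform_Ck k Q (\<lambda>p x. - F p x)"
  using uniform_Ck_cmult[of k Q F "-1"] by simp

lemma uniform_Ck_sum:
  assumes "finite B" "\<And>b. b \<in> B \<Longrightarrow> uniform_Ck k Q (F b)"
  shows "uniform_Ck k Q (\<lambda>p x. \<Sum>b\<in>B. F b p x)"
  using assms
proof (induction B rule: finite_induct)
  case empty then show ?case using uniform_Ck_const[of Q "\<lambda>_. 0" 0] by simp
next
  case (insert b B) then show ?case using uniform_Ck_add[of k Q "F b"] by simp
qed

text \<open>
  Functions of one real variable, as families with a trivial parameter: in this way one set of closure
  properties serves the profiles, \<open>\<phi>\<close> and \<open>f\<close> as well as the functions of space.
\<close>
abbreviation uniform_Ck1 :: "nat \<Rightarrow> real set \<Rightarrow> (real \<Rightarrow> real) \<Rightarrow> bool" where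
  "uniform_Ck1 k A g \<equiv> uniform_Ck k (UNIV \<times> A) (\<lambda>_ :: unit. g)"

lemma uniform_Ck1_0: "uniform_Ck1 0 A g \<longleftrightarrow> (\<exists>M. \<forall>x\<in>A. \<bar>g x\<bar> \<le> M)"
  by (auto simp: uniform_Ck_0)

lemma uniform_Ck1_SucI:
  assumes "uniform_Ck1 0 A g" "\<And>x. x \<in> A \<Longrightarrow> (g has_real_derivative g' x) (at x within A)"
    "uniform_Ck1 k A g'"
  shows "uniform_Ck1 (Suc k) A g"
  by (rule uniform_Ck_SucI[where D = "\<lambda>_ x h. g' x * h"])
    (use assms in \<open>auto simp: has_field_derivative_def\<close>)

lemma uniform_Ck1_SucE:
  assumes "uniform_Ck1 (Suc k) A g"
  obtains g' where "\<And>x. x \<in> A \<Longrightarrow> (g has_real_derivative g' x) (at x within A)"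
    "uniform_Ck1 k A g'"
proof -
  obtain D where
    D': "\<And>p x. (p, x) \<in> UNIV \<times> A \<Longrightarrow>
          (g has_derivative D p x) (at x within {y. (p :: unit, y) \<in> UNIV \<times> A})"
       "\<And>b. b \<in> Basis \<Longrightarrow> uniform_Ck k (UNIV \<times> A) (\<lambda>p x. D p x b)"
    using uniform_Ck_SucE[OF assms] by blast
  have D: "(g has_derivative D () x) (at x within A)" if "x \<in> A" for x
    using D'(1)[of "()" x] that by simp
  have "(g has_real_derivative D () x 1) (at x within A)" if "x \<in> A" for x
  proof -
    have "D () x = (*) (D () x 1)"
      using has_derivative_bounded_linear[OF D[OF that]]
      by (auto simp: real_bounded_linear)
    then show ?thesis using D[OF that] by (simp add: has_field_derivative_def)
  qed
  moreover have "uniform_Ck1 k A (\<lambda>x. D () x 1)" 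
    by (rule uniform_Ck_cong[OF _ D'(2)[of 1]]) auto
  ultimately show ?thesis by (rule that)
qed

lemma uniform_C0_compose:
  assumes "uniform_Ck1 0 A g" "\<And>p x. (p, x) \<in> Q \<Longrightarrow> F p x \<in> A"
  shows "uniform_Ck 0 Q (\<lambda>p x. g (F p x))"
proof -
  obtain M where M: "\<forall>x\<in>A. \<bar>g x\<bar> \<le> M" using assms(1) unfolding uniform_Ck1_0 ..
  have "\<forall>p x. (p, x) \<in> Q \<longrightarrow> \<bar>g (F p x)\<bar> \<le> M" using M assms(2) by simp
  then show ?thesis unfolding uniform_Ck_0 by (rule exI)
qed

text \<open>
  The bounds on \<open>F\<close> concern its derivatives only. The inner function will be a distance divided by \<open>\<epsilon>\<close>,
  which is unbounded as \<open>\<epsilon>\<close> tends to \<open>0\<close> although its derivatives in the stretched variable are not.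
\<close>
lemma uniform_Ck_compose_gen:
  assumes "uniform_Ck1 k A g" "\<And>p x. (p, x) \<in> Q \<Longrightarrow> F p x \<in> A"
    "\<And>p x. (p, x) \<in> Q \<Longrightarrow> (F p has_derivative D p x) (at x within {y. (p, y) \<in> Q})"
    "\<And>b. b \<in> Basis \<Longrightarrow> uniform_Ck j Q (\<lambda>p x. D p x b)"
    "k \<le> Suc j"
  shows "uniform_Ck k Q (\<lambda>p x. g (F p x))"
  using assms(1,5)
proof (induction k arbitrary: g)
  case 0 show ?case by (rule uniform_C0_compose[OF 0(1) assms(2)])
next
  case (Suc k)
  obtain g' where g': "\<And>x. x \<in> A \<Longrightarrow> (g has_real_derivative g' x) (at x within A)"
    "uniform_Ck1 k A g'" using uniform_Ck1_SucE[OF Suc.prems(1)] by blast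
  show ?case
  proof (rule uniform_Ck_SucI[where D = "\<lambda>p x h. g' (F p x) * D p x h"])
    show "uniform_Ck 0 Q (\<lambda>p x. g (F p x))"
      by (rule uniform_C0_compose[OF uniform_Ck_imp_bounded[OF Suc.prems(1)] assms(2)])
    show "((\<lambda>x. g (F p x)) has_derivative (\<lambda>h. g' (F p x) * D p x h)) (at x within {y. (p, y) \<in> Q})"
      if "(p, x) \<in> Q" for p x
    proof -
      have "(g has_derivative (*) (g' (F p x))) (at (F p x) within F p ` {y. (p, y) \<in> Q})"
        using assms(2)
        by (intro has_derivative_subset[OF g'(1)[OF assms(2)[OF that], unfolded has_field_derivative_def]]) auto
      from has_derivative_in_compose[OF assms(3)[OF that] this] show ?thesis by simp
    qed
    show "uniform_Ck k Q (\<lambda>p x. g' (F p x) * D p x b)" if "b \<in> Basis" for b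
      by (rule uniform_Ck_mult[OF Suc.IH[OF g'(2)] uniform_Ck_lower[OF assms(4)[OF that]]])
        (use Suc.prems(2) in auto)
  qed
qed

lemma uniform_Ck_compose:
  assumes g: "uniform_Ck1 k A g" and FA: "\<And>p x. (p, x) \<in> Q \<Longrightarrow> F p x \<in> A" and F: "uniform_Ck k Q F"
  shows "uniform_Ck k Q (\<lambda>p x. g (F p x))"
  using g F
proof (cases k)
  case 0
  have g0: "uniform_Ck1 0 A g" using g by (simp only: 0)
  have "uniform_Ck 0 Q (\<lambda>p x. g (F p x))" by (rule uniform_C0_compose[OF g0 FA])
  then show ?thesis by (simp only: 0)
next
  case (Suc j)
  have "uniform_Ck (Suc j) Q F" using F by (simp only: Suc)
  then obtain D where
    D: "\<And>p x. (p, x) \<in> Q \<Longrightarrow> (F p has_derivative D p x) (at x within {y. (p, y) \<in> Q})"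
       "\<And>b. b \<in> Basis \<Longrightarrow> uniform_Ck j Q (\<lambda>p x. D p x b)"
    using uniform_Ck_SucE[of j Q F] by blast
  have "k \<le> Suc j" using Suc by (rule eq_imp_le)
  show ?thesis by (rule uniform_Ck_compose_gen[OF g FA D \<open>k \<le> Suc j\<close>])
qed

text \<open>
  The derivative of \<open>1 / F\<close> is a product of \<open>1 / F\<close>, \<open>1 / F\<close> and a derivative of \<open>F\<close>, so bounds of order \<open>k\<close> for
  \<open>1 / F\<close> give those of order \<open>k + 1\<close>.
\<close>
lemma uniform_Ck_inverse:
  assumes "uniform_Ck k Q F" "0 < c" "\<And>p x. (p, x) \<in> Q \<Longrightarrow> c \<le> F p x"
  shows "uniform_Ck k Q (\<lambda>p x. inverse (F p x))"
  using assms(1)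
proof (induction k)
  have pos: "0 < F p x" if "(p, x) \<in> Q" for p x using assms(2) assms(3)[OF that] by linarith
  have "\<bar>inverse (F p x)\<bar> \<le> inverse c" if "(p, x) \<in> Q" for p x
    using le_imp_inverse_le[OF assms(3)[OF that] assms(2)] pos[OF that] by simp
  then have b: "uniform_Ck 0 Q (\<lambda>p x. inverse (F p x))" unfolding uniform_Ck_0 by blast
  {
    case 0 show ?case using b .
  next
    case (Suc k)
    obtain D where
      D: "\<And>p x. (p, x) \<in> Q \<Longrightarrow> (F p has_derivative D p x) (at x within {y. (p, y) \<in> Q})"
         "\<And>b. b \<in> Basis \<Longrightarrow> uniform_Ck k Q (\<lambda>p x. D p x b)"
      using uniform_Ck_SucE[OF Suc.prems] by blast
    have I: "uniform_Ck k Q (\<lambda>p x. inverse (F p x))"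
      using Suc.IH uniform_Ck_Suc_lower[OF Suc.prems] by blast
    show ?case
    proof (rule uniform_Ck_SucI[OF b, where D = "\<lambda>p x h. - (inverse (F p x) * D p x h * inverse (F p x))"])
      show "((\<lambda>x. inverse (F p x)) has_derivative
            (\<lambda>h. - (inverse (F p x) * D p x h * inverse (F p x)))) (at x within {y. (p, y) \<in> Q})"
        if "(p, x) \<in> Q" for p x
        using pos[OF that] by (intro Deriv.has_derivative_inverse[OF _ D(1)[OF that]]) simp
      show "uniform_Ck k Q (\<lambda>p x. - (inverse (F p x) * D p x b * inverse (F p x)))" if "b \<in> Basis" for b
        by (intro uniform_Ck_minus uniform_Ck_mult I D(2)[OF that])
    qed
  }
qed

text \<open>
  Every derivative of \<open>x \<mapsto> F (e x)\<close> produces a factor \<open>e\<close>, which the condition on \<open>e\<close> renders harmless.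
\<close>
lemma uniform_Ck_rescale:
  assumes "uniform_Ck k (I \<times> UNIV) F" "\<And>q. q \<in> P \<Longrightarrow> \<tau> q \<in> I" "\<And>q. q \<in> P \<Longrightarrow> \<bar>e q\<bar> \<le> 1"
  shows "uniform_Ck k (P \<times> UNIV) (\<lambda>q x. F (\<tau> q) (e q *\<^sub>R x))"
  using assms(1)
proof (induction k arbitrary: F)
  case 0 then show ?case using assms(2) by (auto simp: uniform_Ck_0)
next
  case (Suc k)
  obtain D where
    D: "\<And>p x. (p, x) \<in> I \<times> UNIV \<Longrightarrow> (F p has_derivative D p x) (at x within {y. (p, y) \<in> I \<times> UNIV})"
       "\<And>b. b \<in> Basis \<Longrightarrow> uniform_Ck k (I \<times> UNIV) (\<lambda>p x. D p x b)"
    using uniform_Ck_SucE[OF Suc.prems] by blast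
  show ?case
  proof (rule uniform_Ck_SucI[where D = "\<lambda>q x h. e q * D (\<tau> q) (e q *\<^sub>R x) h"])
    show "uniform_Ck 0 (P \<times> UNIV) (\<lambda>q x. F (\<tau> q) (e q *\<^sub>R x))"
      using uniform_Ck_imp_bounded[OF Suc.prems] assms(2) by (auto simp: uniform_Ck_0)
    show "((\<lambda>x. F (\<tau> q) (e q *\<^sub>R x)) has_derivative (\<lambda>h. e q * D (\<tau> q) (e q *\<^sub>R x) h))
            (at x within {y. (q, y) \<in> P \<times> UNIV})" if "(q, x) \<in> P \<times> UNIV" for q x
    proof -
      have q: "\<tau> q \<in> I" using that assms(2) by auto
      have d: "(F (\<tau> q) has_derivative D (\<tau> q) (e q *\<^sub>R x)) (at (e q *\<^sub>R x))"
        using D(1)[of "\<tau> q" "e q *\<^sub>R x"] q by simp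
      have "((\<lambda>x. e q *\<^sub>R x) has_derivative (\<lambda>h. e q *\<^sub>R h)) (at x)"
        by (intro has_derivative_scaleR_right has_derivative_ident)
      from has_derivative_compose[OF this d]
      have "((\<lambda>x. F (\<tau> q) (e q *\<^sub>R x)) has_derivative (\<lambda>h. D (\<tau> q) (e q *\<^sub>R x) (e q *\<^sub>R h))) (at x)" .
      moreover have "D (\<tau> q) (e q *\<^sub>R x) (e q *\<^sub>R h) = e q * D (\<tau> q) (e q *\<^sub>R x) h" for h
        using has_derivative_bounded_linear[OF d] by (simp add: linear_simps)
      ultimately show ?thesis using that by simp
    qed
    show "uniform_Ck k (P \<times> UNIV) (\<lambda>q x. e q * D (\<tau> q) (e q *\<^sub>R x) b)" if "b \<in> Basis" for b
      by (intro uniform_Ck_mult Suc.IH D(2)[OF that] uniform_Ck_const[where M = 1])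
        (use assms(3) in auto)
  qed
qed

lemma bounded_Ck_translate:
  assumes "bounded_Ck k M Q F"
  shows "bounded_Ck k M {(p, x). (p, x + c) \<in> Q} (\<lambda>p x. F p (x + c))"
  using assms
proof (induction k arbitrary: F)
  case 0 then show ?case by auto
next
  case (Suc k)
  then obtain D where
    D: "\<forall>p x. (p, x) \<in> Q \<longrightarrow> (F p has_derivative D p x) (at x within {y. (p, y) \<in> Q})"
       "\<forall>b\<in>Basis. bounded_Ck k M Q (\<lambda>p x. D p x b)" by auto
  have "((\<lambda>x. F p (x + c)) has_derivative D p (x + c)) (at x within {y. (p, y + c) \<in> Q})"
    if "(p, x + c) \<in> Q" for p x
  proof -
    have 1: "((\<lambda>x. x + c) has_derivative (\<lambda>h. h)) (at x within {y. (p, y + c) \<in> Q})"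
      using has_derivative_add[OF has_derivative_ident has_derivative_const] by fastforce
    have 2: "(F p has_derivative D p (x + c)) (at (x + c) within (\<lambda>x. x + c) ` {y. (p, y + c) \<in> Q})"
      using D(1) that by (auto intro: has_derivative_subset)
    show ?thesis using has_derivative_in_compose[OF 1 2] by simp
  qed
  moreover have "\<forall>p x. (p, x + c) \<in> Q \<longrightarrow> \<bar>F p (x + c)\<bar> \<le> M" using Suc.prems by auto
  moreover have "\<forall>b\<in>Basis. bounded_Ck k M {(p, x). (p, x + c) \<in> Q} (\<lambda>p x. D p (x + c) b)"
    using D(2) by (intro ballI Suc.IH) simp
  ultimately show ?case by (auto intro!: exI[of _ "\<lambda>p x. D p (x + c)"])
qed

text \<open>
  On open slices a derivative is determined by the function, so the derivatives provided by different
  pieces agree and the pieces fit together with the same bound.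
\<close>
lemma bounded_Ck_local:
  assumes "\<And>p. open {x. (p, x) \<in> Q}"
    and "\<And>p x. (p, x) \<in> Q \<Longrightarrow> \<exists>R\<subseteq>Q. (p, x) \<in> R \<and> (\<forall>p. open {x. (p, x) \<in> R}) \<and> bounded_Ck k M R F"
  shows "bounded_Ck k M Q F"
  using assms(2)
proof (induction k arbitrary: F)
  case 0 then show ?case by (force dest: bounded_Ck_bound)
next
  case (Suc k)
  define D where "D p x = frechet_derivative (F p) (at x)" for p x
  have loc: "\<exists>R\<subseteq>Q. (p, x) \<in> R \<and> (\<forall>p. open {x. (p, x) \<in> R}) \<and>
      (\<forall>b\<in>Basis. bounded_Ck k M R (\<lambda>p x. D p x b)) \<and> (F p has_derivative D p x) (at x)"
    if px: "(p, x) \<in> Q" for p x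
  proof -
    obtain R where R: "R \<subseteq> Q" "(p, x) \<in> R" "\<forall>p. open {x. (p, x) \<in> R}" "bounded_Ck (Suc k) M R F"
      using Suc.prems[OF px] by blast
    then obtain E where
      E: "\<forall>p x. (p, x) \<in> R \<longrightarrow> (F p has_derivative E p x) (at x within {y. (p, y) \<in> R})"
         "\<forall>b\<in>Basis. bounded_Ck k M R (\<lambda>p x. E p x b)" by auto
    have E': "(F p has_derivative E p x) (at x)" if "(p, x) \<in> R" for p x
      using E(1) that R(3) at_within_open[of x "{y. (p, y) \<in> R}"] by fastforce
    then have eq: "E p x = D p x" if "(p, x) \<in> R" for p x
      unfolding D_def using that by (metis frechet_derivative_at)
    have "\<forall>b\<in>Basis. bounded_Ck k M R (\<lambda>p x. D p x b)"
      using E(2) eq by (auto intro: bounded_Ck_cong[of R "\<lambda>p x. E p x _"])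
    then show ?thesis using R E'[OF R(2)] eq[OF R(2)] by metis
  qed
  have 1: "\<forall>p x. (p, x) \<in> Q \<longrightarrow> \<bar>F p x\<bar> \<le> M"
    using Suc.prems by (meson bounded_Ck_bound)
  have 2: "bounded_Ck k M Q (\<lambda>p x. D p x b)" if b: "b \<in> Basis" for b
  proof (rule Suc.IH)
    fix p x assume "(p, x) \<in> Q"
    from loc[OF this] obtain R where "R \<subseteq> Q" "(p, x) \<in> R" "\<forall>p. open {x. (p, x) \<in> R}"
      "\<forall>b\<in>Basis. bounded_Ck k M R (\<lambda>p x. D p x b)" by auto
    then show "\<exists>R\<subseteq>Q. (p, x) \<in> R \<and> (\<forall>p. open {x. (p, x) \<in> R}) \<and> bounded_Ck k M R (\<lambda>p x. D p x b)"
      using b by (intro exI[of _ R]) simp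
  qed
  have 3: "\<forall>p x. (p, x) \<in> Q \<longrightarrow> (F p has_derivative D p x) (at x within {y. (p, y) \<in> Q})"
  proof (intro allI impI)
    fix p x assume "(p, x) \<in> Q"
    from loc[OF this] show "(F p has_derivative D p x) (at x within {y. (p, y) \<in> Q})"
      using has_derivative_at_withinI by auto
  qed
  show ?case using 1 2 3 by auto
qed

lemma Ck_on_real_SucE:
  assumes "Ck_on (Suc k) S (g :: real \<Rightarrow> real)"
  obtains g' where "\<And>x. x \<in> S \<Longrightarrow> (g has_real_derivative g' x) (at x within S)" "Ck_on k S g'"
proof -
  obtain D where D: "\<forall>x\<in>S. (g has_derivative D x) (at x within S)" "Ck_on k S (\<lambda>x. D x 1)"
    using assms by auto
  have "(g has_real_derivative D x 1) (at x within S)" if "x \<in> S" for x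
  proof -
    have d: "(g has_derivative D x) (at x within S)" using D(1) that by blast
    then have "D x = (*) (D x 1)"
      using has_derivative_bounded_linear[OF d]
      by (auto simp: real_bounded_linear)
    then show ?thesis using d by (simp add: has_field_derivative_def)
  qed
  from this D(2) show ?thesis by (rule that)
qed

lemma Ck_on_imp_continuous: "Ck_on k S g \<Longrightarrow> continuous_on S g"
  by (cases k) (auto simp: continuous_on_eq_continuous_within intro: has_derivative_continuous)

lemma uniform_Ck1_of_Ck_on:
  assumes "Ck_on k S g" "A \<subseteq> S" "compact A"
  shows "uniform_Ck1 k A g"
  using assms(1)
proof (induction k arbitrary: g)
  have b: "uniform_Ck1 0 A g" if "continuous_on S g" for g :: "real \<Rightarrow> real"
  proof -
    have "bounded (g ` A)"
      using compact_continuous_image[OF continuous_on_subset[OF that assms(2)] assms(3)]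
      by (rule compact_imp_bounded)
    then show ?thesis unfolding uniform_Ck1_0 by (auto simp: bounded_iff)
  qed
  {
    case 0 then show ?case using b by simp
  next
    case (Suc k)
    obtain g' where g': "\<And>x. x \<in> S \<Longrightarrow> (g has_real_derivative g' x) (at x within S)" "Ck_on k S g'"
      using Ck_on_real_SucE[OF Suc.prems] by metis
    show ?case
    proof (rule uniform_Ck1_SucI)
      show "uniform_Ck1 0 A g" by (rule b[OF Ck_on_imp_continuous[OF Suc.prems]])
      show "(g has_real_derivative g' x) (at x within A)" if "x \<in> A" for x
        using has_field_derivative_subset[OF g'(1) assms(2)] that assms(2) by blast
      show "uniform_Ck1 k A g'" by (rule Suc.IH[OF g'(2)])
    qed
  }
qed

section \<open>The standing wave and its linearisation\<close>

text \<open>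
  A smooth function on \<open>[0,\<infinity>)\<close> has one-sided derivatives at \<open>0\<close>. The operator \<open>deriv\<close> is two-sided and
  meaningful at positive arguments, which is why bounds on \<open>deriv g\<close> are stated away from \<open>0\<close>.
\<close>
lemma smooth_half_line_DERIV:
  fixes g :: "real \<Rightarrow> real"
  assumes "smooth_on {0..} g" "0 < x"
  shows "(g has_real_derivative deriv g x) (at x)"
proof -
  have "Ck_on (Suc 0) {0..} g" using assms(1) unfolding smooth_on_def by blast
  then obtain g' where "\<And>x. x \<in> {0..} \<Longrightarrow> (g has_real_derivative g' x) (at x within {0..})"
    using Ck_on_real_SucE by blast
  moreover have "at x within {0..} = at x" by (rule at_within_interior) (use assms(2) in simp)
  ultimately have "(g has_real_derivative g' x) (at x)" using assms(2) by (metis atLeast_iff less_imp_le)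
  then show ?thesis using DERIV_imp_deriv by metis
qed

lemma smooth_half_line_isCont:
  "smooth_on {0..} g \<Longrightarrow> 0 < x \<Longrightarrow> isCont g (x :: real)"
  by (rule DERIV_isCont[OF smooth_half_line_DERIV])

lemma smooth_half_line_continuous: "smooth_on {0..} (g :: real \<Rightarrow> real) \<Longrightarrow> continuous_on {0..} g"
  unfolding smooth_on_def using Ck_on_imp_continuous by blast

lemma smooth_half_line_uniform_Ck1:
  "smooth_on {0..} g \<Longrightarrow> 0 \<le> a \<Longrightarrow> uniform_Ck1 k {a..b} g"
  by (rule uniform_Ck1_of_Ck_on[where S = "{0..}"]) (auto simp: smooth_on_def)

lemma smooth_half_line_uniform_Ck1_deriv:
  assumes "smooth_on {0..} g" "0 < a"
  shows "uniform_Ck1 k {a..b} (deriv g)"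
proof -
  have "Ck_on (Suc k) {0..} g" using assms(1) unfolding smooth_on_def by blast
  then obtain g' where g': "\<And>x. x \<in> {0..} \<Longrightarrow> (g has_real_derivative g' x) (at x within {0..})"
    "Ck_on k {0..} g'"
    using Ck_on_real_SucE by blast
  have "g' x = deriv g x" if "a \<le> x" for x
  proof -
    have "at x within {0..} = at x" by (rule at_within_interior) (use that assms(2) in simp)
    then have "(g has_real_derivative g' x) (at x)" using g'(1)[of x] that assms(2) by simp
    then show ?thesis using DERIV_imp_deriv by metis
  qed
  moreover have "uniform_Ck1 k {a..b} g'"
    by (rule uniform_Ck1_of_Ck_on[OF g'(2)]) (use assms(2) in auto)
  ultimately show ?thesis by (intro uniform_Ck_cong[of "UNIV \<times> {a..b}" "\<lambda>_. g'" "\<lambda>_. deriv g"]) auto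
qed

lemma smooth_half_line_continuous_deriv:
  assumes "smooth_on {0..} g" "0 < a"
  shows "continuous_on {a..b} (deriv g)"
proof -
  obtain g' where "\<And>x. x \<in> {a..b} \<Longrightarrow> (deriv g has_real_derivative g' x) (at x within {a..b})"
    using uniform_Ck1_SucE[OF smooth_half_line_uniform_Ck1_deriv[OF assms, of "Suc 0" b]] by blast
  then show ?thesis by (rule DERIV_continuous_on)
qed

text \<open>
  The mean value theorem gives the value \<open>w (z + 1) - w z\<close> to \<open>D\<close> at a point of \<open>(z, z + 1)\<close>, and \<open>D\<close> differs
  there from \<open>D z\<close> by a value of the second derivative. Boundedness or decay of a function and of its
  second derivative therefore carries over to the first derivative.
\<close>
lemma derivative_interpolation:
  fixes w D D2 :: "real \<Rightarrow> real"
  assumes "\<And>z. (w has_real_derivative D z) (at z)" "\<And>z. (D has_real_derivative D2 z) (at z)"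
  shows "\<exists>\<eta>>z. \<bar>D z\<bar> \<le> \<bar>w (z + 1) - w z\<bar> + \<bar>D2 \<eta>\<bar>"
proof -
  obtain \<xi> where \<xi>: "z < \<xi>" "\<xi> < z + 1" "w (z + 1) - w z = (z + 1 - z) * D \<xi>"
    using MVT2[of z "z + 1" w D] assms(1) by auto
  obtain \<eta> where \<eta>: "z < \<eta>" "\<eta> < \<xi>" "D \<xi> - D z = (\<xi> - z) * D2 \<eta>"
    using MVT2[of z \<xi> D D2] \<xi>(1) assms(2) by auto
  have "\<bar>D \<xi> - D z\<bar> \<le> 1 * \<bar>D2 \<eta>\<bar>"
    unfolding \<eta>(3) abs_mult using \<xi> by (intro mult_right_mono) auto
  then have "\<bar>D z\<bar> \<le> \<bar>w (z + 1) - w z\<bar> + \<bar>D2 \<eta>\<bar>" using \<xi>(3) by simp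
  then show ?thesis using \<eta>(1) by blast
qed

lemma derivative_tendsto_0:
  fixes w D D2 :: "real \<Rightarrow> real"
  assumes D: "\<And>z. (w has_real_derivative D z) (at z)" "\<And>z. (D has_real_derivative D2 z) (at z)"
    and w: "(w \<longlongrightarrow> c) at_top" and D2: "(D2 \<longlongrightarrow> 0) at_top"
  shows "(D \<longlongrightarrow> 0) at_top"
proof (rule tendstoI)
  fix e :: real assume e: "0 < e"
  obtain a where a: "\<And>z. a \<le> z \<Longrightarrow> dist (w z) c < e / 3"
    using tendstoD[OF w, of "e / 3"] e by (auto simp: eventually_at_top_linorder)
  obtain b where b: "\<And>z. b \<le> z \<Longrightarrow> dist (D2 z) 0 < e / 3"
    using tendstoD[OF D2, of "e / 3"] e by (auto simp: eventually_at_top_linorder)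
  have "dist (D z) 0 < e" if z: "max a b \<le> z" for z
  proof -
    obtain \<eta> where \<eta>: "z < \<eta>" "\<bar>D z\<bar> \<le> \<bar>w (z + 1) - w z\<bar> + \<bar>D2 \<eta>\<bar>"
      using derivative_interpolation[OF D] by blast
    have "dist (w (z + 1)) c < e / 3" "dist (w z) c < e / 3" "dist (D2 \<eta>) 0 < e / 3"
      using a[of "z + 1"] a[of z] b[of \<eta>] z \<eta>(1) by auto
    then show ?thesis using \<eta>(2) unfolding dist_real_def by linarith
  qed
  then show "\<forall>\<^sub>F x in at_top. dist (D x) 0 < e" unfolding eventually_at_top_linorder by blast
qed

lemma derivative_bounded:
  fixes w D D2 :: "real \<Rightarrow> real"
  assumes D: "\<And>z. (w has_real_derivative D z) (at z)" "\<And>z. (D has_real_derivative D2 z) (at z)"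
    and w: "\<And>z. \<bar>w z\<bar> \<le> A" and D2: "\<And>z. \<bar>D2 z\<bar> \<le> B"
  shows "\<bar>D z\<bar> \<le> 2 * A + B"
proof -
  obtain \<eta> where \<eta>: "z < \<eta>" "\<bar>D z\<bar> \<le> \<bar>w (z + 1) - w z\<bar> + \<bar>D2 \<eta>\<bar>"
    using derivative_interpolation[OF D] by blast
  then show ?thesis using w[of "z + 1"] w[of z] D2[of \<eta>] by linarith
qed

text \<open>
  Gronwall's argument for the energy \<open>y\<^sup>2 + Y\<^sup>2\<close>, whose derivative is at most \<open>1 + M\<close> times the energy itself.
\<close>
lemma linear_ode_unique_zero:
  fixes y Y c :: "real \<Rightarrow> real"
  assumes y: "\<And>z. (y has_real_derivative Y z) (at z)"
    and Y: "\<And>z. (Y has_real_derivative c z * y z) (at z)"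
    and c: "\<And>z. \<bar>c z\<bar> \<le> M" and init: "y 0 = 0" "Y 0 = 0"
  shows "y z = 0"
proof -
  define E where "E z = (y z)\<^sup>2 + (Y z)\<^sup>2" for z
  define E' where "E' z = 2 * y z * Y z * (1 + c z)" for z
  have E: "(E has_real_derivative E' z) (at z)" for z
    unfolding E_def E'_def
    by (rule derivative_eq_intros y Y refl)+ (simp add: algebra_simps)
  have E'_le: "\<bar>E' z\<bar> \<le> (1 + M) * E z" for z
  proof -
    have "\<bar>2 * y z * Y z\<bar> \<le> E z"
      using sum_squares_bound[of "\<bar>y z\<bar>" "\<bar>Y z\<bar>"] unfolding E_def by (simp add: abs_mult)
    moreover have "\<bar>1 + c z\<bar> \<le> 1 + M" using c[of z] by linarith
    ultimately have "\<bar>2 * y z * Y z\<bar> * \<bar>1 + c z\<bar> \<le> E z * (1 + M)" by (intro mult_mono') auto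
    then show ?thesis unfolding E'_def by (simp add: abs_mult mult.commute)
  qed
  have E0: "E 0 = 0" using init by (simp add: E_def)
  have "E z \<le> 0"
  proof (cases "0 \<le> z")
    case True
    have "exp (- (1 + M) * z) * E z \<le> exp (- (1 + M) * 0) * E 0"
    proof (rule DERIV_nonpos_imp_nonincreasing[OF True])
      fix x
      have "((\<lambda>x. exp (- (1 + M) * x) * E x) has_real_derivative
              exp (- (1 + M) * x) * (E' x - (1 + M) * E x)) (at x)"
        by (rule derivative_eq_intros E refl)+ (simp add: algebra_simps)
      moreover have "exp (- (1 + M) * x) * (E' x - (1 + M) * E x) \<le> 0"
        using E'_le[of x] by (intro mult_nonneg_nonpos) auto
      ultimately show "\<exists>y. ((\<lambda>x. exp (- (1 + M) * x) * E x) has_real_derivative y) (at x) \<and> y \<le> 0"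
        by blast
    qed
    then show ?thesis using E0 by (simp add: mult_le_0_iff)
  next
    case False
    then have "z \<le> 0" by simp
    have "exp ((1 + M) * z) * E z \<le> exp ((1 + M) * 0) * E 0"
    proof (rule DERIV_nonneg_imp_nondecreasing[OF \<open>z \<le> 0\<close>])
      fix x
      have "((\<lambda>x. exp ((1 + M) * x) * E x) has_real_derivative
              exp ((1 + M) * x) * (E' x + (1 + M) * E x)) (at x)"
        by (rule derivative_eq_intros E refl)+ (simp add: algebra_simps)
      moreover have "exp ((1 + M) * x) * (E' x + (1 + M) * E x) \<ge> 0"
        using E'_le[of x] by (intro mult_nonneg_nonneg) auto
      ultimately show "\<exists>y. ((\<lambda>x. exp ((1 + M) * x) * E x) has_real_derivative y) (at x) \<and> 0 \<le> y"
        by blast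
    qed
    then show ?thesis using E0 by (simp add: mult_le_0_iff)
  qed
  then show ?thesis unfolding E_def by (metis add_nonneg_nonneg sum_power2_le_zero_iff)
qed

lemma strictly_increasing_half_line:
  fixes \<phi> :: "real \<Rightarrow> real"
  assumes "smooth_on {0..} \<phi>" "\<And>\<rho>. 0 < \<rho> \<Longrightarrow> 0 < deriv \<phi> \<rho>" "0 \<le> a" "a < b"
  shows "\<phi> a < \<phi> b"
proof (rule DERIV_pos_imp_increasing_open[OF assms(4)])
  show "\<exists>y. (\<phi> has_real_derivative y) (at x) \<and> 0 < y" if "a < x" "x < b" for x
    using smooth_half_line_DERIV[OF assms(1), of x] assms(2)[of x] assms(3) that by auto
  show "continuous_on {a..b} \<phi>"
    by (rule continuous_on_subset[OF smooth_half_line_continuous[OF assms(1)]]) (use assms(3) in auto)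
qed

text \<open>
  What the profile equation \<open>(\<phi>(U))'' + f(U) = 0\<close> amounts to when \<open>U\<close> stays in a compact subset of \<open>(0,\<infinity>)\<close>,
  where \<open>\<phi>' > 0\<close>: a first order system for \<open>U\<close> and \<open>D = (\<phi>(U))'\<close>. The decay of \<open>D\<close> and \<open>f(U)\<close> at infinity and
  \<open>D 0 \<noteq> 0\<close> enter through the linearised equation, of which \<open>D\<close> is a solution.
\<close>
locale standing_wave =
  fixes \<phi> f U D :: "real \<Rightarrow> real" and m B :: real
  assumes phi_smooth: "smooth_on {0..} \<phi>" and f_smooth: "smooth_on {0..} f"
    and phi_pos: "\<And>\<rho>. 0 < \<rho> \<Longrightarrow> 0 < deriv \<phi> \<rho>"
    and m: "0 < m" and U_range: "\<And>z. m \<le> U z" "\<And>z. U z \<le> B"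
    and DERIV_U: "\<And>z. (U has_real_derivative D z / deriv \<phi> (U z)) (at z)"
    and DERIV_D: "\<And>z. (D has_real_derivative - f (U z)) (at z)"
    and D_lim: "(D \<longlongrightarrow> 0) at_top" and fU_lim: "((\<lambda>z. f (U z)) \<longlongrightarrow> 0) at_top"
    and D_bounded: "\<exists>A. \<forall>z. \<bar>D z\<bar> \<le> A"
    and D0: "D 0 \<noteq> 0"
begin

lemma phi_U_pos: "0 < deriv \<phi> (U z)"
  using phi_pos[of "U z"] U_range(1)[of z] m by linarith

lemma phi_U_lower: "\<exists>c>0. \<forall>z. c \<le> deriv \<phi> (U z)"
proof -
  have "m \<le> B" using U_range[of 0] by linarith
  have "\<exists>x\<in>{m..B}. \<forall>y\<in>{m..B}. deriv \<phi> x \<le> deriv \<phi> y"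
    using \<open>m \<le> B\<close> by (intro continuous_attains_inf smooth_half_line_continuous_deriv phi_smooth m) auto
  then obtain x where x: "x \<in> {m..B}" "\<And>y. y \<in> {m..B} \<Longrightarrow> deriv \<phi> x \<le> deriv \<phi> y" by blast
  show ?thesis
    by (rule exI[of _ "deriv \<phi> x"]) (use x phi_pos m U_range in auto)
qed

lemma uniform_Ck1_compose_U:
  assumes "uniform_Ck1 k {m..B} g" "uniform_Ck1 k UNIV U"
  shows "uniform_Ck1 k UNIV (\<lambda>z. g (U z))"
  by (rule uniform_Ck_compose[OF assms(1) _ assms(2)]) (use U_range in auto)

lemma uniform_Ck1_inverse_phi_U:
  assumes "uniform_Ck1 k UNIV U"
  shows "uniform_Ck1 k UNIV (\<lambda>z. inverse (deriv \<phi> (U z)))"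
proof -
  obtain c where c: "0 < c" "\<And>z. c \<le> deriv \<phi> (U z)" using phi_U_lower by blast
  show ?thesis
    by (rule uniform_Ck_inverse[OF _ c])
      (rule uniform_Ck1_compose_U[OF smooth_half_line_uniform_Ck1_deriv[OF phi_smooth m] assms])
qed

text \<open>
  In \<open>U' = D / \<phi>'(U)\<close> and \<open>D' = - f(U)\<close> the right-hand sides inherit the bounds on \<open>U\<close> and \<open>D\<close>, so that each use of
  the equations gains one derivative.
\<close>
lemma uniform_Ck1_U_D: "uniform_Ck1 k UNIV U \<and> uniform_Ck1 k UNIV D"
proof (induction k)
  case 0
  have "\<bar>U z\<bar> \<le> B" for z using U_range[of z] m by linarith
  then show ?case using D_bounded unfolding uniform_Ck1_0 by blast
next
  case (Suc k)
  have U: "uniform_Ck1 (Suc k) UNIV U"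
  proof (rule uniform_Ck1_SucI)
    show "uniform_Ck1 0 UNIV U" using Suc.IH uniform_Ck_imp_bounded by blast
    show "(U has_real_derivative D x * inverse (deriv \<phi> (U x))) (at x within UNIV)" for x
      using DERIV_U[of x] by (simp add: divide_inverse)
    show "uniform_Ck1 k UNIV (\<lambda>x. D x * inverse (deriv \<phi> (U x)))"
      by (rule uniform_Ck_mult[OF conjunct2[OF Suc.IH] uniform_Ck1_inverse_phi_U[OF conjunct1[OF Suc.IH]]])
  qed
  have "uniform_Ck1 (Suc k) UNIV D"
  proof (rule uniform_Ck1_SucI)
    show "uniform_Ck1 0 UNIV D" using Suc.IH uniform_Ck_imp_bounded by blast
    show "(D has_real_derivative - f (U x)) (at x within UNIV)" for x using DERIV_D by simp
    show "uniform_Ck1 k UNIV (\<lambda>x. - f (U x))"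
      by (rule uniform_Ck_minus[OF uniform_Ck1_compose_U[OF
              smooth_half_line_uniform_Ck1[OF f_smooth less_imp_le[OF m]] conjunct1[OF Suc.IH]]])
  qed
  then show ?case using U by blast
qed

lemmas uniform_Ck1_U = uniform_Ck1_U_D[THEN conjunct1]
lemmas uniform_Ck1_D = uniform_Ck1_U_D[THEN conjunct2]

lemma uniform_Ck1_linearised:
  "uniform_Ck1 k UNIV (\<lambda>z. deriv f (U z) * inverse (deriv \<phi> (U z)))"
  by (rule uniform_Ck_mult[OF uniform_Ck1_compose_U[OF
          smooth_half_line_uniform_Ck1_deriv[OF f_smooth m] uniform_Ck1_U]
          uniform_Ck1_inverse_phi_U[OF uniform_Ck1_U]])

lemma linearised_bound: "\<exists>M. \<forall>z. \<bar>deriv f (U z) * inverse (deriv \<phi> (U z))\<bar> \<le> M"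
  using uniform_Ck1_linearised[of 0] unfolding uniform_Ck1_0 by simp

text \<open>
  \<open>D\<close> and \<open>y\<close> satisfy the same linear equation of second order, so their Wronskian is constant. It tends
  to \<open>0\<close> at infinity because \<open>D\<close> and \<open>D' = - f(U)\<close> decay while \<open>y\<close> and its derivative stay bounded. At \<open>z = 0\<close> it
  equals \<open>Y 0 * D 0\<close>, hence \<open>Y 0 = 0\<close> and \<open>y\<close> has zero initial data.
\<close>
lemma linearised_kernel:
  assumes y: "\<And>z. (y has_real_derivative Y z) (at z)"
    and Y: "\<And>z. (Y has_real_derivative - (deriv f (U z) * inverse (deriv \<phi> (U z))) * y z) (at z)"
    and bdd: "\<And>z. \<bar>y z\<bar> \<le> A" and y0: "y 0 = 0"
  shows "y z = 0"
proof -
  obtain M where M: "\<And>z. \<bar>deriv f (U z) * inverse (deriv \<phi> (U z))\<bar> \<le> M"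
    using linearised_bound by blast
  have "\<bar>- (deriv f (U z) * inverse (deriv \<phi> (U z))) * y z\<bar> \<le> M * A" for z
    using M[of z] bdd[of z] by (simp add: abs_mult mult_mono')
  from derivative_bounded[OF y Y bdd this] have Ybdd: "\<bar>Y z\<bar> \<le> 2 * A + M * A" for z .
  define W where "W z = y z * f (U z) + Y z * D z" for z
  have "(W has_real_derivative 0) (at z)" for z
  proof -
    have f: "((\<lambda>z. f (U z)) has_real_derivative deriv f (U z) * (D z / deriv \<phi> (U z))) (at z)"
      by (rule DERIV_chain2[OF smooth_half_line_DERIV[OF f_smooth] DERIV_U])
        (use U_range(1)[of z] m in linarith)
    show ?thesis unfolding W_def
      by (rule derivative_eq_intros y Y f DERIV_D refl)+
        (use phi_U_pos[of z] in \<open>simp add: field_simps\<close>)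
  qed
  then have const: "W z = W 0" for z using DERIV_isconst_all[of W z 0] by blast
  have "(W \<longlongrightarrow> 0) at_top"
    unfolding W_def
  proof (rule tendsto_add_zero)
    show "((\<lambda>z. y z * f (U z)) \<longlongrightarrow> 0) at_top"
    proof (rule Lim_null_comparison)
      show "((\<lambda>z. A * \<bar>f (U z)\<bar>) \<longlongrightarrow> 0) at_top"
        by (intro tendsto_mult_right_zero tendsto_rabs_zero fU_lim)
      show "\<forall>\<^sub>F z in at_top. norm (y z * f (U z)) \<le> A * \<bar>f (U z)\<bar>"
        using bdd by (simp add: abs_mult mult_right_mono)
    qed
    show "((\<lambda>z. Y z * D z) \<longlongrightarrow> 0) at_top"
    proof (rule Lim_null_comparison)
      show "((\<lambda>z. (2 * A + M * A) * \<bar>D z\<bar>) \<longlongrightarrow> 0) at_top"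
        by (intro tendsto_mult_right_zero tendsto_rabs_zero D_lim)
      show "\<forall>\<^sub>F z in at_top. norm (Y z * D z) \<le> (2 * A + M * A) * \<bar>D z\<bar>"
        using Ybdd by (simp add: abs_mult mult_right_mono)
    qed
  qed
  moreover have "(W \<longlongrightarrow> W 0) at_top"
    by (rule tendsto_eventually, rule always_eventually, rule allI, rule const)
  ultimately have "0 = W 0" by (rule tendsto_unique[OF trivial_limit_at_top_linorder])
  then have "Y 0 = 0" using y0 D0 unfolding W_def by simp
  show ?thesis
    by (rule linear_ode_unique_zero[OF y Y _ y0 \<open>Y 0 = 0\<close>, of M]) (use M in simp)
qed

lemma linearised_regularity:
  assumes y: "\<And>z. (y has_real_derivative Y z) (at z)"
    and Y: "\<And>z. (Y has_real_derivative r z - deriv f (U z) * inverse (deriv \<phi> (U z)) * y z) (at z)"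
    and bdd: "\<And>z. \<bar>y z\<bar> \<le> A" and r: "\<And>k. uniform_Ck1 k UNIV r"
  shows "uniform_Ck1 k UNIV y"
proof -
  have "uniform_Ck1 k UNIV y \<and> uniform_Ck1 k UNIV Y"
  proof (induction k)
    case 0
    obtain M where M: "\<And>z. \<bar>deriv f (U z) * inverse (deriv \<phi> (U z))\<bar> \<le> M"
      using linearised_bound by blast
    obtain R where R: "\<And>z. \<bar>r z\<bar> \<le> R" using r[of 0] unfolding uniform_Ck1_0 by auto
    have "\<bar>r z - deriv f (U z) * inverse (deriv \<phi> (U z)) * y z\<bar> \<le> R + M * A" for z
    proof -
      have "\<bar>deriv f (U z) * inverse (deriv \<phi> (U z)) * y z\<bar> \<le> M * A"
        using mult_mono'[OF M[of z] bdd[of z]] by (simp add: abs_mult)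
      then show ?thesis using R[of z] by linarith
    qed
    from derivative_bounded[OF y Y bdd this] show ?case using bdd unfolding uniform_Ck1_0 by blast
  next
    case (Suc k)
    have "uniform_Ck1 (Suc k) UNIV y"
      by (rule uniform_Ck1_SucI[where g' = Y]) (use Suc uniform_Ck_imp_bounded y in auto)
    moreover have "uniform_Ck1 (Suc k) UNIV Y"
    proof (rule uniform_Ck1_SucI)
      show "uniform_Ck1 0 UNIV Y" using Suc uniform_Ck_imp_bounded by blast
      show "(Y has_real_derivative r x + - (deriv f (U x) * inverse (deriv \<phi> (U x)) * y x)) (at x within UNIV)"
        for x using Y by simp
      show "uniform_Ck1 k UNIV (\<lambda>x. r x + - (deriv f (U x) * inverse (deriv \<phi> (U x)) * y x))"
        by (rule uniform_Ck_add[OF r uniform_Ck_minus[OF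
                uniform_Ck_mult[OF uniform_Ck1_linearised conjunct1[OF Suc]]]])
    qed
    ultimately show ?case by blast
  qed
  then show ?thesis by blast
qed

text \<open>
  By uniqueness the solution with right-hand side \<open>r * a i\<close> is \<open>a i / a j\<close> times the one with right-hand side
  \<open>r * a j\<close>, for any \<open>j\<close> with \<open>a j \<noteq> 0\<close>. So the common factor \<open>V\<close> can be read off from one member of the family.
\<close>
lemma corrector_separates:
  fixes U1 :: "'i \<Rightarrow> real \<Rightarrow> real" and a :: "'i \<Rightarrow> real" and r :: "real \<Rightarrow> real"
  assumes U1: "\<And>i. i \<in> I \<Longrightarrow> \<exists>Y. \<forall>z. ((\<lambda>y. deriv \<phi> (U y) * U1 i y) has_real_derivative Y z) (at z) \<and>
        (Y has_real_derivative r z * a i - deriv f (U z) * U1 i z) (at z)"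
    and init: "\<And>i. i \<in> I \<Longrightarrow> U1 i 0 = 0"
    and bdd: "\<And>i. i \<in> I \<Longrightarrow> bounded (range (\<lambda>z. deriv \<phi> (U z) * U1 i z))"
    and r: "\<And>k. uniform_Ck1 k UNIV r"
  shows "\<exists>V. (\<forall>k. uniform_Ck1 k UNIV V) \<and> (\<forall>i\<in>I. \<forall>z. U1 i z = a i * V z)"
proof -
  define y where "y i z = deriv \<phi> (U z) * U1 i z" for i z
  have Uy: "U1 i z = inverse (deriv \<phi> (U z)) * y i z" for i z
    using phi_U_pos[of z] unfolding y_def by simp
  have "\<forall>i\<in>I. \<exists>Y. \<forall>z. (y i has_real_derivative Y z) (at z) \<and>
        (Y has_real_derivative r z * a i - deriv f (U z) * inverse (deriv \<phi> (U z)) * y i z) (at z)"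
  proof
    fix i assume "i \<in> I"
    have e: "deriv f (U z) * U1 i z = deriv f (U z) * inverse (deriv \<phi> (U z)) * y i z" for z
      unfolding Uy by simp
    show "\<exists>Y. \<forall>z. (y i has_real_derivative Y z) (at z) \<and>
        (Y has_real_derivative r z * a i - deriv f (U z) * inverse (deriv \<phi> (U z)) * y i z) (at z)"
      using U1[OF \<open>i \<in> I\<close>] unfolding e y_def[abs_def] .
  qed
  then obtain Y where Y: "\<And>i z. i \<in> I \<Longrightarrow> (y i has_real_derivative Y i z) (at z)"
    "\<And>i z. i \<in> I \<Longrightarrow> (Y i has_real_derivative r z * a i - deriv f (U z) * inverse (deriv \<phi> (U z)) * y i z) (at z)"
    by metis
  have ybdd: "\<exists>A. \<forall>z. \<bar>y i z\<bar> \<le> A" if "i \<in> I" for i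
    using bdd[OF that] unfolding y_def by (auto simp: bounded_iff)
  have y0: "y i 0 = 0" if "i \<in> I" for i using init[OF that] by (simp add: y_def)
  show ?thesis
  proof (cases "\<exists>j\<in>I. a j \<noteq> 0")
    case False
    have "U1 i z = 0" if i: "i \<in> I" for i z
    proof -
      obtain A where A: "\<And>z. \<bar>y i z\<bar> \<le> A" using ybdd[OF i] by blast
      have "y i z = 0"
        by (rule linearised_kernel[OF Y(1)[OF i] _ A y0[OF i]])
          (use Y(2)[OF i] False i in auto)
      then show ?thesis using Uy by simp
    qed
    moreover have "uniform_Ck1 k UNIV (\<lambda>_. 0)" for k
      by (rule uniform_Ck_const[where M = 0]) simp
    ultimately show ?thesis by (intro exI[of _ "\<lambda>_. 0"]) simp
  next
    case True
    then obtain j where j: "j \<in> I" "a j \<noteq> 0" by blast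
    define V where "V z = U1 j z / a j" for z
    have Vreg: "uniform_Ck1 k UNIV V" for k
    proof -
      obtain A where A: "\<And>z. \<bar>y j z\<bar> \<le> A" using ybdd[OF j(1)] by blast
      have "uniform_Ck1 k UNIV (\<lambda>z. r z * a j)" for k
        using uniform_Ck_cmult[OF r[of k], of "a j"] by (simp add: mult.commute)
      from linearised_regularity[OF Y[OF j(1)] A this] have "uniform_Ck1 k UNIV (y j)" .
      then have "uniform_Ck1 k UNIV (\<lambda>z. inverse (a j) * (inverse (deriv \<phi> (U z)) * y j z))"
        by (rule uniform_Ck_cmult[OF uniform_Ck_mult[OF uniform_Ck1_inverse_phi_U[OF uniform_Ck1_U]]])
      moreover have "(\<lambda>z. inverse (a j) * (inverse (deriv \<phi> (U z)) * y j z)) = V"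
        unfolding V_def Uy by (simp add: fun_eq_iff divide_inverse mult.commute)
      ultimately show ?thesis by simp
    qed
    have "U1 i z = a i * V z" if i: "i \<in> I" for i z
    proof -
      define c where "c = a i / a j"
      have ca: "a i = c * a j" using j(2) by (simp add: c_def)
      obtain A A' where A: "\<And>z. \<bar>y i z\<bar> \<le> A" "\<And>z. \<bar>y j z\<bar> \<le> A'" using ybdd i j(1) by meson
      have "y i z - c * y j z = 0"
      proof (rule linearised_kernel[where z = z and y = "\<lambda>z. y i z - c * y j z" and Y = "\<lambda>z. Y i z - c * Y j z"])
        show "((\<lambda>z. y i z - c * y j z) has_real_derivative Y i z - c * Y j z) (at z)" for z
          by (intro DERIV_diff DERIV_cmult Y(1) i j)
        show "((\<lambda>z. Y i z - c * Y j z) has_real_derivative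
            - (deriv f (U z) * inverse (deriv \<phi> (U z))) * (y i z - c * y j z)) (at z)" for z
          by (rule DERIV_cong[OF DERIV_diff[OF Y(2)[OF i] DERIV_cmult[OF Y(2)[OF j(1)]]]])
            (simp add: ca algebra_simps)
        show "\<bar>y i z - c * y j z\<bar> \<le> A + \<bar>c\<bar> * A'" for z
        proof -
          have "\<bar>c * y j z\<bar> \<le> \<bar>c\<bar> * A'" using A(2) by (simp add: abs_mult mult_left_mono)
          then show ?thesis using A(1)[of z] by linarith
        qed
        show "y i 0 - c * y j 0 = 0" using y0 i j by simp
      qed
      then show ?thesis unfolding V_def Uy c_def by (simp add: field_simps)
    qed
    then show ?thesis using Vreg by blast
  qed
qed

end

text \<open>
  If \<open>U\<close> vanished at a point, \<open>\<phi>(U)\<close> would have a minimum there, although its second derivative is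
  \<open>- f 0 < 0\<close>. So \<open>U > 0\<close>, and the limits at infinity keep it in a compact subset of \<open>(0,\<infinity>)\<close>. For \<open>D 0 \<noteq> 0\<close>, let
  \<open>G\<close> be a primitive of \<open>f \<phi>'\<close>. The energy \<open>D\<^sup>2 / 2 + G(U)\<close> is constant and tends to \<open>G \<alpha>m\<close> at infinity. If \<open>D\<close> vanished
  at \<open>0\<close>, then \<open>G \<alpha>s = G \<alpha>m\<close>, and by Rolle's theorem \<open>f\<close> would have a zero between \<open>\<alpha>m\<close> and \<open>\<alpha>s\<close>.
\<close>
lemma profile0_standing_wave:
  assumes phi: "smooth_on {0..} \<phi>" and f: "smooth_on {0..} f"
    and pos: "\<And>\<rho>. 0 < \<rho> \<Longrightarrow> 0 < deriv \<phi> \<rho>" and f0: "0 < f 0"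
    and am: "0 < \<alpha>m" "\<alpha>m < \<alpha>s" "f \<alpha>m = 0" and ap: "0 < \<alpha>p"
    and nz: "\<And>\<rho>. \<alpha>m < \<rho> \<Longrightarrow> \<rho> < \<alpha>s \<Longrightarrow> f \<rho> \<noteq> 0"
    and U: "profile0 \<phi> f \<alpha>m \<alpha>s \<alpha>p U"
  shows "\<exists>D m B. standing_wave \<phi> f U D m B \<and> (\<forall>z. ((\<lambda>y. \<phi> (U y)) has_real_derivative D z) (at z))"
proof -
  obtain D where D: "\<And>z. ((\<lambda>y. \<phi> (U y)) has_real_derivative D z) (at z)"
    "\<And>z. (D has_real_derivative - f (U z)) (at z)" using U unfolding profile0_def by blast
  have U0: "\<And>z. 0 \<le> U z" and lims: "(U \<longlongrightarrow> \<alpha>p) at_bot" "U 0 = \<alpha>s" "(U \<longlongrightarrow> \<alpha>m) at_top"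
    using U unfolding profile0_def by auto
  note mono = strictly_increasing_half_line[OF phi pos]
  have Upos: "0 < U z" for z
  proof (rule ccontr)
    assume "\<not> 0 < U z"
    then have Uz: "U z = 0" using U0[of z] by simp
    have min: "\<phi> (U z) \<le> \<phi> (U x)" for x
      using mono[of 0 "U x"] U0[of x] Uz by (cases "U x = 0") auto
    have Dz: "D z = 0" by (rule DERIV_local_min[OF D(1), of 1]) (use min in auto)
    obtain e where e: "0 < e" "\<And>h. 0 < h \<Longrightarrow> h < e \<Longrightarrow> D (z + h) < D z"
      using DERIV_neg_dec_right[OF D(2)[of z]] f0 Uz by auto
    obtain x where x: "z < x" "x < z + e / 2" "\<phi> (U (z + e / 2)) - \<phi> (U z) = (z + e / 2 - z) * D x"
      using MVT2[of z "z + e / 2" "\<lambda>y. \<phi> (U y)" D] D(1) e(1) by auto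
    have "D x < 0" using e(2)[of "x - z"] x e(1) Dz by auto
    then have "(z + e / 2 - z) * D x < 0" using e(1) by (intro mult_pos_neg) auto
    then show False using x(3) min[of "z + e / 2"] by linarith
  qed
  define g where "g = inv_into {0<..} \<phi>"
  have inj: "inj_on \<phi> {0<..}"
    by (rule inj_onI) (metis greaterThan_iff less_imp_le linorder_neqE_linordered_idom mono order_less_irrefl)
  have g: "g (\<phi> x) = x" if "0 < x" for x unfolding g_def using inj that by simp
  have DU: "(U has_real_derivative D z / deriv \<phi> (U z)) (at z)" for z
  proof -
    have "(g has_real_derivative inverse (deriv \<phi> (U z))) (at (\<phi> (U z)))"
      unfolding has_field_derivative_def
    proof (rule has_derivative_inverse_strong[where S = "{0<..}" and f = \<phi> and x = "U z" and f' = "(*) (deriv \<phi> (U z))"])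
      show "(\<phi> has_derivative (*) (deriv \<phi> (U z))) (at (U z))"
        using smooth_half_line_DERIV[OF phi Upos] by (simp add: has_field_derivative_def)
      show "(*) (deriv \<phi> (U z)) \<circ> (*) (inverse (deriv \<phi> (U z))) = id"
        using pos[OF Upos[of z]] by (simp add: fun_eq_iff)
      show "continuous_on {0<..} \<phi>"
        by (rule continuous_on_subset[OF smooth_half_line_continuous[OF phi]]) auto
    qed (use Upos g in auto)
    from DERIV_chain2[OF this D(1)] have "((\<lambda>y. g (\<phi> (U y))) has_real_derivative inverse (deriv \<phi> (U z)) * D z) (at z)" .
    then show ?thesis using g[OF Upos] by (simp add: divide_inverse mult.commute)
  qed
  have cont: "isCont U z" for z by (rule DERIV_isCont[OF DU])
  obtain a where a: "\<And>z. z \<le> a \<Longrightarrow> dist (U z) \<alpha>p < \<alpha>p / 2"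
    using tendstoD[OF lims(1), of "\<alpha>p / 2"] ap by (auto simp: eventually_at_bot_linorder)
  obtain b where b: "\<And>z. b \<le> z \<Longrightarrow> dist (U z) \<alpha>m < \<alpha>m / 2"
    using tendstoD[OF lims(3), of "\<alpha>m / 2"] am by (auto simp: eventually_at_top_linorder)
  have ne: "{min a b..max a b} \<noteq> {}" by auto
  have contU: "continuous_on {min a b..max a b} U" using cont continuous_at_imp_continuous_on by blast
  obtain x1 where x1: "\<And>y. y \<in> {min a b..max a b} \<Longrightarrow> U x1 \<le> U y"
    using continuous_attains_inf[OF compact_Icc ne contU] by blast
  obtain x2 where x2: "\<And>y. y \<in> {min a b..max a b} \<Longrightarrow> U y \<le> U x2"
    using continuous_attains_sup[OF compact_Icc ne contU] by blast
  define m where "m = min (U x1) (min (\<alpha>p / 2) (\<alpha>m / 2))"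
  define B where "B = max (U x2) (max (2 * \<alpha>p) (2 * \<alpha>m))"
  have m: "0 < m" unfolding m_def using Upos[of x1] ap am by auto
  have range: "m \<le> U z \<and> U z \<le> B" for z
  proof -
    consider "z \<le> a" | "b \<le> z" | "z \<in> {min a b..max a b}" by fastforce
    then show ?thesis
    proof cases
      case 1 then show ?thesis using a[OF 1] ap unfolding m_def B_def dist_real_def by linarith
    next
      case 2 then show ?thesis using b[OF 2] am unfolding m_def B_def dist_real_def by linarith
    next
      case 3 then show ?thesis using x1[OF 3] x2[OF 3] unfolding m_def B_def by linarith
    qed
  qed
  have fU: "((\<lambda>z. f (U z)) \<longlongrightarrow> 0) at_top"
    using isCont_tendsto_compose[OF smooth_half_line_isCont[OF f am(1)] lims(3)] am(3) by simp
  have phiU: "((\<lambda>z. \<phi> (U z)) \<longlongrightarrow> \<phi> \<alpha>m) at_top"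
    by (rule isCont_tendsto_compose[OF smooth_half_line_isCont[OF phi am(1)] lims(3)])
  have Dlim: "(D \<longlongrightarrow> 0) at_top"
    by (rule derivative_tendsto_0[OF D phiU]) (use tendsto_minus[OF fU] in simp)
  obtain A1 where A1: "\<And>x. x \<in> {0..B} \<Longrightarrow> \<bar>\<phi> x\<bar> \<le> A1"
    using smooth_half_line_uniform_Ck1[OF phi order_refl, of 0 B] unfolding uniform_Ck1_0 by blast
  obtain A2 where A2: "\<And>x. x \<in> {0..B} \<Longrightarrow> \<bar>f x\<bar> \<le> A2"
    using smooth_half_line_uniform_Ck1[OF f order_refl, of 0 B] unfolding uniform_Ck1_0 by blast
  have Dbdd: "\<bar>D z\<bar> \<le> 2 * A1 + A2" for z
    by (rule derivative_bounded[OF D]) (use A1 A2 range Upos in \<open>auto simp: less_imp_le\<close>)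
  \<comment> \<open>The lower limit \<open>m / 2\<close> makes every value of \<open>U\<close> an interior point of the interval of integration.\<close>
  define G where "G u = integral {m / 2..u} (\<lambda>s. f s * deriv \<phi> s)" for u
  have G: "(G has_real_derivative f u * deriv \<phi> u) (at u)" if "m \<le> u" "u \<le> B" for u
  proof -
    have c: "continuous_on {m / 2..B + 1} (\<lambda>s. f s * deriv \<phi> s)"
      using m by (intro continuous_on_mult smooth_half_line_continuous_deriv phi
          continuous_on_subset[OF smooth_half_line_continuous[OF f]]) auto
    have "(G has_real_derivative f u * deriv \<phi> u) (at u within {m / 2..B + 1})"
      unfolding G_def by (rule integral_has_real_derivative[OF c]) (use that m in auto)
    moreover have "at u within {m / 2..B + 1} = at u"
      by (rule at_within_interior) (use that m in simp)
    ultimately show ?thesis by simp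
  qed
  define E where "E z = (D z)\<^sup>2 / 2 + G (U z)" for z
  have "(E has_real_derivative 0) (at z)" for z
  proof -
    have GU: "((\<lambda>z. G (U z)) has_real_derivative f (U z) * deriv \<phi> (U z) * (D z / deriv \<phi> (U z))) (at z)"
      by (rule DERIV_chain2[OF G DU]) (use range in auto)
    show ?thesis unfolding E_def
      by (rule DERIV_cong[OF DERIV_add[OF DERIV_cdivide[OF DERIV_power[OF D(2), of 2]] GU]])
        (use pos[OF Upos[of z]] in \<open>simp add: field_simps\<close>)
  qed
  then have const: "E z = E 0" for z using DERIV_isconst_all[of E z 0] by blast
  have amr: "m \<le> \<alpha>m" "\<alpha>m \<le> B" unfolding m_def B_def using am by auto
  have "(E \<longlongrightarrow> 0\<^sup>2 / 2 + G \<alpha>m) at_top"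
    unfolding E_def
    by (intro tendsto_add tendsto_divide tendsto_power Dlim tendsto_const
        isCont_tendsto_compose[OF DERIV_isCont[OF G] lims(3)] amr) simp
  moreover have "(E \<longlongrightarrow> E 0) at_top"
    by (rule tendsto_eventually, rule always_eventually, rule allI, rule const)
  ultimately have "0\<^sup>2 / 2 + G \<alpha>m = E 0" by (rule tendsto_unique[OF trivial_limit_at_top_linorder])
  then have "E 0 = G \<alpha>m" by simp
  have asr: "\<alpha>s \<le> B" using range[of 0] lims(2) by simp
  have D0: "D 0 \<noteq> 0"
  proof
    assume "D 0 = 0"
    then have eq: "G \<alpha>m = G \<alpha>s" using \<open>E 0 = G \<alpha>m\<close> lims(2) unfolding E_def by simp
    obtain z where z: "\<alpha>m < z" "z < \<alpha>s" "G \<alpha>s - G \<alpha>m = (\<alpha>s - \<alpha>m) * (f z * deriv \<phi> z)"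
      using MVT2[OF am(2), of G "\<lambda>u. f u * deriv \<phi> u"] G amr asr by auto
    then show False using eq nz[OF z(1,2)] pos[of z] am by auto
  qed
  have "standing_wave \<phi> f U D m B"
    by unfold_locales (use phi f pos m range DU D Dlim fU Dbdd D0 in auto)
  then show ?thesis using D(1) by blast
qed

section \<open>The comparison principle for the discrete equation\<close>

lemma finite_discrete_cube: "finite {x :: int ^ 'n::finite. \<forall>i. x $ i \<in> {0..<int N}}"
proof -
  have "{x :: int ^ 'n. \<forall>i. x $ i \<in> {0..<int N}} \<subseteq> vec_lambda ` (UNIV \<rightarrow>\<^sub>E {0..<int N})"
  proof
    fix x :: "int ^ 'n" assume "x \<in> {x. \<forall>i. x $ i \<in> {0..<int N}}"
    then have "($) x \<in> UNIV \<rightarrow>\<^sub>E {0..<int N}" by auto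
    then show "x \<in> vec_lambda ` (UNIV \<rightarrow>\<^sub>E {0..<int N})"
      using image_eqI[of x vec_lambda "($) x"] by simp
  qed
  moreover have "finite (UNIV \<rightarrow>\<^sub>E {0..<int N} :: ('n \<Rightarrow> int) set)" by (intro finite_PiE) auto
  ultimately show ?thesis using finite_surj by blast
qed

lemma discrete_periodic_representative:
  assumes "1 \<le> N" shows "\<exists>y. (\<forall>i. y $ i \<in> {0..<int N}) \<and> (\<forall>u. discrete_periodic N u \<longrightarrow> u x = u y)"
proof -
  define y :: "int ^ 'a" where "y = (\<chi> i. x $ i mod int N)"
  have x: "x = y + (\<chi> i. int N * (\<chi> i. x $ i div int N) $ i)"
    by (simp add: y_def vec_eq_iff)
  have "u x = u y" if "discrete_periodic N u" for u :: "int ^ 'a \<Rightarrow> 'b"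
    using that unfolding discrete_periodic_def by (subst x) blast
  moreover have "\<forall>i. y $ i \<in> {0..<int N}" using assms by (simp add: y_def)
  ultimately show ?thesis by blast
qed

text \<open>
  Suppose \<open>v - u\<close> is positive somewhere and look at a maximum of \<open>exp (- \<Lambda> t) * (v - u)\<close>, which exists since
  periodicity leaves finitely many sites. There \<open>v' - u'\<close> is at least \<open>\<Lambda> (v - u)\<close>. The difference of the
  right-hand sides, on the other hand, is at most a constant times \<open>v - u\<close>: the Laplacian involves
  finitely many neighbours, at which \<open>v - u\<close> is no larger than at the maximum, and \<open>\<phi>\<close> and \<open>f\<close> are
  Lipschitz continuous on the bounded range of \<open>u\<close> and \<open>v\<close>. A large \<open>\<Lambda>\<close> makes the two estimates incompatible.
  The constant depends on \<open>N\<close> and \<open>K\<close>, which is harmless because the conclusion does not involve it.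
\<close>
lemma discrete_comparison:
  fixes v u v' u' :: "real \<Rightarrow> int ^ 'n::finite \<Rightarrow> real" and \<phi> f :: "real \<Rightarrow> real"
  assumes N: "1 \<le> N" and K: "0 \<le> K"
    and mono: "\<And>a b. 0 \<le> a \<Longrightarrow> a \<le> b \<Longrightarrow> \<phi> a \<le> \<phi> b"
    and lip_phi: "\<And>B. \<exists>\<Lambda>. \<forall>a\<in>{0..B}. \<forall>b\<in>{0..B}. \<bar>\<phi> a - \<phi> b\<bar> \<le> \<Lambda> * \<bar>a - b\<bar>"
    and lip_f: "\<And>B. \<exists>\<Lambda>. \<forall>a\<in>{0..B}. \<forall>b\<in>{0..B}. \<bar>f a - f b\<bar> \<le> \<Lambda> * \<bar>a - b\<bar>"
    and per: "\<And>t. t \<in> {0..T} \<Longrightarrow> discrete_periodic N (v t) \<and> discrete_periodic N (u t)"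
    and nonneg: "\<And>t x. t \<in> {0..T} \<Longrightarrow> 0 \<le> v t x \<and> 0 \<le> u t x"
    and v: "\<And>t x. t \<in> {0..T} \<Longrightarrow> ((\<lambda>s. v s x) has_real_derivative v' t x) (at t within {0..T})"
    and u: "\<And>t x. t \<in> {0..T} \<Longrightarrow> ((\<lambda>s. u s x) has_real_derivative u' t x) (at t within {0..T})"
    and sub: "\<And>t x. t \<in> {0..T} \<Longrightarrow> v' t x \<le> discrete_laplacian N (\<lambda>y. \<phi> (v t y)) x + K * f (v t x)"
    and super: "\<And>t x. t \<in> {0..T} \<Longrightarrow> discrete_laplacian N (\<lambda>y. \<phi> (u t y)) x + K * f (u t x) \<le> u' t x"
    and init: "\<And>x. v 0 x \<le> u 0 x"
    and t: "t \<in> {0..T}"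
  shows "v t x \<le> u t x"
proof (rule ccontr)
  assume "\<not> v t x \<le> u t x"
  define R where "R = {x :: int ^ 'n. \<forall>i. x $ i \<in> {0..<int N}}"
  have finR: "finite R" unfolding R_def by (rule finite_discrete_cube)
  have rep: "\<exists>y\<in>R. \<forall>t\<in>{0..T}. v t x = v t y \<and> u t x = u t y" for x
  proof -
    obtain y where "\<forall>i. y $ i \<in> {0..<int N}"
      "\<forall>w :: int ^ 'n \<Rightarrow> real. discrete_periodic N w \<longrightarrow> w x = w y"
      using discrete_periodic_representative[OF N] by blast
    then show ?thesis using per unfolding R_def by blast
  qed
  have contv: "continuous_on {0..T} (\<lambda>s. v s x)" for x by (rule DERIV_continuous_on) (rule v)
  have contu: "continuous_on {0..T} (\<lambda>s. u s x)" for x by (rule DERIV_continuous_on) (rule u)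
  have bdd: "\<exists>b. \<forall>t\<in>{0..T}. v t x \<le> b \<and> u t x \<le> b" for x
  proof -
    have "bounded ((\<lambda>s. v s x) ` {0..T})" "bounded ((\<lambda>s. u s x) ` {0..T})"
      by (intro compact_imp_bounded compact_continuous_image contv contu compact_Icc)+
    then obtain b b' where "\<forall>t\<in>{0..T}. \<bar>v t x\<bar> \<le> b" "\<forall>t\<in>{0..T}. \<bar>u t x\<bar> \<le> b'"
      by (auto simp: bounded_iff)
    then have "v s x \<le> max b b' \<and> u s x \<le> max b b'" if "s \<in> {0..T}" for s
      using that by (metis abs_le_D1 max.coboundedI1 max.coboundedI2)
    then show ?thesis by blast
  qed
  then obtain b where b: "\<And>t x. t \<in> {0..T} \<Longrightarrow> v t x \<le> b x \<and> u t x \<le> b x" by metis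
  define B where "B = Max (b ` R)"
  have B: "v t x \<in> {0..B}" "u t x \<in> {0..B}" if "t \<in> {0..T}" for t x
  proof -
    obtain y where "y \<in> R" "\<forall>t\<in>{0..T}. v t x = v t y \<and> u t x = u t y" using rep[of x] by auto
    then have y: "y \<in> R" "v t x = v t y" "u t x = u t y" using that by auto
    have "b y \<le> B" unfolding B_def using y(1) finR by auto
    then show "v t x \<in> {0..B}" "u t x \<in> {0..B}"
      using b[OF that, of y] nonneg[OF that, of x] y(2,3) by auto
  qed
  obtain \<Lambda>1' where L1': "\<forall>a\<in>{0..B}. \<forall>b\<in>{0..B}. \<bar>\<phi> a - \<phi> b\<bar> \<le> \<Lambda>1' * \<bar>a - b\<bar>" using lip_phi by blast
  obtain \<Lambda>2' where L2': "\<forall>a\<in>{0..B}. \<forall>b\<in>{0..B}. \<bar>f a - f b\<bar> \<le> \<Lambda>2' * \<bar>a - b\<bar>" using lip_f by blast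
  define \<Lambda>1 where "\<Lambda>1 = max 0 \<Lambda>1'"
  define \<Lambda>2 where "\<Lambda>2 = max 0 \<Lambda>2'"
  have pos: "0 \<le> \<Lambda>1" "0 \<le> \<Lambda>2" by (auto simp: \<Lambda>1_def \<Lambda>2_def)
  have L1: "\<bar>\<phi> a - \<phi> b\<bar> \<le> \<Lambda>1 * \<bar>a - b\<bar>" if "a \<in> {0..B}" "b \<in> {0..B}" for a b
    using L1' that mult_right_mono[of \<Lambda>1' \<Lambda>1 "\<bar>a - b\<bar>"] unfolding \<Lambda>1_def by fastforce
  have L2: "\<bar>f a - f b\<bar> \<le> \<Lambda>2 * \<bar>a - b\<bar>" if "a \<in> {0..B}" "b \<in> {0..B}" for a b
    using L2' that mult_right_mono[of \<Lambda>2' \<Lambda>2 "\<bar>a - b\<bar>"] unfolding \<Lambda>2_def by fastforce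
  define \<Lambda> where "\<Lambda> = (real N)\<^sup>2 * (real CARD('n) * (2 * \<Lambda>1)) + K * \<Lambda>2 + 1"
  define m where "m t x = exp (- \<Lambda> * t) * (v t x - u t x)" for t x
  have contm: "continuous_on {0..T} (\<lambda>s. m s x)" for x
    unfolding m_def by (intro continuous_intros contv contu)
  have ne: "{0..T} \<noteq> {}" using t by auto
  have "\<exists>\<tau>\<in>{0..T}. \<forall>s\<in>{0..T}. m s x \<le> m \<tau> x" for x
    by (rule continuous_attains_sup[OF compact_Icc ne contm])
  then obtain \<tau> where \<tau>: "\<And>x. \<tau> x \<in> {0..T}" "\<And>x s. s \<in> {0..T} \<Longrightarrow> m s x \<le> m (\<tau> x) x" by metis
  have repm: "\<exists>y\<in>R. \<forall>s\<in>{0..T}. m s x = m s y" for x using rep[of x] unfolding m_def by auto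
  obtain y where y: "y \<in> R" using rep[of x] by auto
  define \<mu> where "\<mu> = Max ((\<lambda>x. m (\<tau> x) x) ` R)"
  have "\<mu> \<in> (\<lambda>x. m (\<tau> x) x) ` R" unfolding \<mu>_def using finR y by (intro Max_in) auto
  then obtain x1 where x1: "x1 \<in> R" "\<mu> = m (\<tau> x1) x1" by blast
  define t1 where "t1 = \<tau> x1"
  have t1: "t1 \<in> {0..T}" using \<tau>(1) by (simp add: t1_def)
  have max: "m s x \<le> m t1 x1" if "s \<in> {0..T}" for s x
  proof -
    obtain z where "z \<in> R" "\<forall>s\<in>{0..T}. m s x = m s z" using repm[of x] by auto
    then have z: "z \<in> R" "m s x = m s z" using that by auto
    have "m (\<tau> z) z \<le> \<mu>" unfolding \<mu>_def using z finR by auto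
    then show ?thesis using \<tau>(2)[OF that, of z] z(2) x1(2) by (simp add: t1_def)
  qed
  have "0 < m t x" using \<open>\<not> v t x \<le> u t x\<close> by (simp add: m_def)
  then have mpos: "0 < m t1 x1" using max[OF t, of x] by linarith
  define \<delta> where "\<delta> = v t1 x1 - u t1 x1"
  have \<delta>: "0 < \<delta>" using mpos by (simp add: m_def \<delta>_def zero_less_mult_iff)
  have diff: "v t1 z - u t1 z \<le> \<delta>" for z
    using max[OF t1, of z] unfolding m_def \<delta>_def by simp
  have "t1 \<noteq> 0" using \<delta> init[of x1] unfolding \<delta>_def by auto
  then have "0 < t1" using t1 by simp
  \<comment> \<open>The maximum may lie at the final time; the one-sided derivative still has a sign since \<open>t1 > 0\<close>.\<close>
  have dm: "((\<lambda>s. m s x1) has_real_derivative exp (- \<Lambda> * t1) * (v' t1 x1 - u' t1 x1 - \<Lambda> * \<delta>))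
          (at t1 within {0..T})"
    unfolding m_def \<delta>_def
    by (rule derivative_eq_intros v[OF t1] u[OF t1] refl)+ (simp add: algebra_simps)
  have "0 \<le> exp (- \<Lambda> * t1) * (v' t1 x1 - u' t1 x1 - \<Lambda> * \<delta>)"
  proof (rule ccontr)
    assume "\<not> 0 \<le> exp (- \<Lambda> * t1) * (v' t1 x1 - u' t1 x1 - \<Lambda> * \<delta>)"
    then obtain e where e: "0 < e" "\<And>h. 0 < h \<Longrightarrow> t1 - h \<in> {0..T} \<Longrightarrow> h < e \<Longrightarrow> m t1 x1 < m (t1 - h) x1"
      using has_real_derivative_neg_dec_left[OF dm] by auto
    define h where "h = min t1 (e / 2)"
    have "0 < h" "h < e" "t1 - h \<in> {0..T}" using e(1) \<open>0 < t1\<close> t1 by (auto simp: h_def)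
    then show False using e(2)[of h] max[of "t1 - h" x1] by auto
  qed
  then have low: "\<Lambda> * \<delta> \<le> v' t1 x1 - u' t1 x1" by (simp add: zero_le_mult_iff)
  \<comment> \<open>The maximum of \<open>v - u\<close> need not be one of \<open>\<phi>(v) - \<phi>(u)\<close>, but the latter is nonnegative there and at most
    \<open>\<Lambda>1 * \<delta>\<close> everywhere. Monotonicity of \<open>\<phi>\<close> is used for both.\<close>
  have phi_diff: "\<phi> (v t1 z) - \<phi> (u t1 z) \<le> \<Lambda>1 * \<delta>" for z
  proof (cases "v t1 z \<le> u t1 z")
    case True
    then have "\<phi> (v t1 z) \<le> \<phi> (u t1 z)" using mono nonneg[OF t1] by blast
    moreover have "0 \<le> \<Lambda>1 * \<delta>" using pos \<delta> by simp
    ultimately show ?thesis by linarith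
  next
    case False
    have "\<phi> (v t1 z) - \<phi> (u t1 z) \<le> \<Lambda>1 * \<bar>v t1 z - u t1 z\<bar>"
      using L1[OF B[OF t1, of z]] by linarith
    also have "\<dots> \<le> \<Lambda>1 * \<delta>" using diff[of z] False pos by (intro mult_left_mono) auto
    finally show ?thesis .
  qed
  have center: "0 \<le> \<phi> (v t1 x1) - \<phi> (u t1 x1)"
    using mono[of "u t1 x1" "v t1 x1"] nonneg[OF t1] \<delta> by (simp add: \<delta>_def)
  have key: "a + b - 2 * c \<le> 2 * e" if "a \<le> e" "b \<le> e" "0 \<le> c" for a b c e :: real
    using that by linarith
  have "discrete_laplacian N (\<lambda>y. \<phi> (v t1 y)) x1 - discrete_laplacian N (\<lambda>y. \<phi> (u t1 y)) x1
      = (real N)\<^sup>2 * (\<Sum>i\<in>UNIV. (\<phi> (v t1 (x1 + axis i 1)) - \<phi> (u t1 (x1 + axis i 1)))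
          + (\<phi> (v t1 (x1 - axis i 1)) - \<phi> (u t1 (x1 - axis i 1))) - 2 * (\<phi> (v t1 x1) - \<phi> (u t1 x1)))"
    unfolding discrete_laplacian_def right_diff_distrib[symmetric] sum_subtractf[symmetric]
    by (simp add: algebra_simps)
  also have "\<dots> \<le> (real N)\<^sup>2 * (\<Sum>i\<in>(UNIV :: 'n set). 2 * (\<Lambda>1 * \<delta>))"
  proof (intro mult_left_mono sum_mono)
    fix i
    show "(\<phi> (v t1 (x1 + axis i 1)) - \<phi> (u t1 (x1 + axis i 1)))
          + (\<phi> (v t1 (x1 - axis i 1)) - \<phi> (u t1 (x1 - axis i 1))) - 2 * (\<phi> (v t1 x1) - \<phi> (u t1 x1))
        \<le> 2 * (\<Lambda>1 * \<delta>)"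
      by (rule key[OF phi_diff phi_diff center])
  qed simp
  finally have lap: "discrete_laplacian N (\<lambda>y. \<phi> (v t1 y)) x1 - discrete_laplacian N (\<lambda>y. \<phi> (u t1 y)) x1
      \<le> (real N)\<^sup>2 * (real CARD('n) * (2 * \<Lambda>1)) * \<delta>" by (simp add: algebra_simps)
  have "f (v t1 x1) - f (u t1 x1) \<le> \<Lambda>2 * \<bar>v t1 x1 - u t1 x1\<bar>" using L2[OF B[OF t1, of x1]] by linarith
  then have "f (v t1 x1) - f (u t1 x1) \<le> \<Lambda>2 * \<delta>" using \<delta> by (simp add: \<delta>_def)
  from mult_left_mono[OF this K] have "K * f (v t1 x1) - K * f (u t1 x1) \<le> K * \<Lambda>2 * \<delta>"
    by (simp add: algebra_simps)
  then have "v' t1 x1 - u' t1 x1 \<le> (real N)\<^sup>2 * (real CARD('n) * (2 * \<Lambda>1)) * \<delta> + K * \<Lambda>2 * \<delta>"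
    using sub[OF t1, of x1] super[OF t1, of x1] lap by linarith
  then have "v' t1 x1 - u' t1 x1 \<le> (\<Lambda> - 1) * \<delta>" unfolding \<Lambda>_def by (simp add: algebra_simps)
  then show False using low \<delta> by (simp add: algebra_simps)
qed

section \<open>Regularity of the cut-off distance\<close>

lemma bounded_partials_imp_Lipschitz:
  fixes w :: "'a::euclidean_space \<Rightarrow> real"
  assumes "convex B" "\<And>x. x \<in> B \<Longrightarrow> (w has_derivative D x) (at x within B)"
    and "\<And>b x. b \<in> Basis \<Longrightarrow> x \<in> B \<Longrightarrow> \<bar>D x b\<bar> \<le> M b" "x \<in> B" "y \<in> B"
  shows "\<bar>w x - w y\<bar> \<le> (\<Sum>b\<in>Basis. M b) * norm (x - y)"
proof -
  have "norm (w x - w y) \<le> (\<Sum>b\<in>Basis. M b) * norm (x - y)"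
  proof (rule differentiable_bound[OF assms(1,2) _ assms(4,5)])
    fix x assume x: "x \<in> B"
    have "onorm (D x) \<le> (\<Sum>b\<in>Basis. norm (D x b))"
      by (rule onorm_componentwise[OF has_derivative_bounded_linear[OF assms(2)[OF x]]])
    also have "\<dots> \<le> (\<Sum>b\<in>Basis. M b)" using assms(3) x by (intro sum_mono) auto
    finally show "onorm (D x) \<le> (\<Sum>b\<in>Basis. M b)" .
  qed
  then show ?thesis by simp
qed

text \<open>
  The parabolic class bounds the Hoelder quotients of the top derivatives. Over a bounded region this
  bounds the derivatives themselves, and then the lower ones by induction on the order.
\<close>
lemma parabolic_holder_uniform_Ck:
  fixes u :: "real \<Rightarrow> 'a::euclidean_space \<Rightarrow> real"
  assumes "parabolic_holder_on k \<theta> I B u" "0 < \<theta>" "convex I" "bounded I" "convex B" "bounded B"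
  shows "uniform_Ck k (I \<times> B) u"
proof (cases "I = {} \<or> B = {}")
  case True
  then have "uniform_Ck k (I \<times> B) (\<lambda>t x. 0)" by (intro uniform_Ck_const[where M = 0]) auto
  then show ?thesis by (rule uniform_Ck_cong[rotated]) (use True in auto)
next
  case False
  then obtain t0 x0 where t0: "t0 \<in> I" and x0: "x0 \<in> B" by blast
  obtain R where R: "\<And>t s. t \<in> I \<Longrightarrow> s \<in> I \<Longrightarrow> dist t s \<le> R"
    using assms(4) diameter_bounded_bound by blast
  obtain S where S: "\<And>x y. x \<in> B \<Longrightarrow> y \<in> B \<Longrightarrow> dist x y \<le> S"
    using assms(6) diameter_bounded_bound by blast
  have slice: "{y. (t, y) \<in> I \<times> B} = B" if "t \<in> I" for t using that by auto
  \<comment> \<open>Compare \<open>u t x\<close> first with \<open>u t0 x\<close>, then with \<open>u t0 x0\<close>.\<close>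
  have bdd: "uniform_Ck 0 (I \<times> B) u"
    if D: "\<forall>t\<in>I. \<forall>x\<in>B. (u t has_derivative D t x) (at x within B)"
      "\<And>b. b \<in> Basis \<Longrightarrow> uniform_Ck 0 (I \<times> B) (\<lambda>t x. D t x b)"
      and time: "\<And>t x. t \<in> I \<Longrightarrow> x \<in> B \<Longrightarrow> \<bar>u t x - u t0 x\<bar> \<le> C" for u D C
  proof -
    have "\<forall>b\<in>Basis. \<exists>M. \<forall>t x. (t, x) \<in> I \<times> B \<longrightarrow> \<bar>D t x b\<bar> \<le> M"
      using D(2) unfolding uniform_Ck_0 by blast
    then obtain M where M: "\<And>b t x. b \<in> Basis \<Longrightarrow> (t, x) \<in> I \<times> B \<Longrightarrow> \<bar>D t x b\<bar> \<le> M b" by metis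
    have M0: "0 \<le> (\<Sum>b\<in>Basis. M b)"
      using M[of _ t0 x0] t0 x0 by (intro sum_nonneg) (metis abs_ge_zero mem_Sigma_iff order_trans)
    have "\<bar>u t x\<bar> \<le> \<bar>u t0 x0\<bar> + C + (\<Sum>b\<in>Basis. M b) * S" if t: "t \<in> I" and x: "x \<in> B" for t x
    proof -
      have "\<bar>u t0 x - u t0 x0\<bar> \<le> (\<Sum>b\<in>Basis. M b) * norm (x - x0)"
        by (rule bounded_partials_imp_Lipschitz[OF assms(5) _ _ x x0, where D = "D t0"])
          (use D(1) M t0 in auto)
      also have "\<dots> \<le> (\<Sum>b\<in>Basis. M b) * S"
        using S[OF x x0] M0 by (intro mult_left_mono) (auto simp: dist_norm)
      finally show ?thesis using time[OF t x] by linarith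
    qed
    then show ?thesis unfolding uniform_Ck_0 by blast
  qed
  show ?thesis using assms(1)
  proof (induction k arbitrary: u rule: less_induct)
    case (less k)
    have step: "uniform_Ck (Suc j) (I \<times> B) u"
      if D: "\<forall>t\<in>I. \<forall>x\<in>B. (u t has_derivative D t x) (at x within B)"
        "\<And>b. b \<in> Basis \<Longrightarrow> uniform_Ck j (I \<times> B) (\<lambda>t x. D t x b)"
        and time: "\<And>t x. t \<in> I \<Longrightarrow> x \<in> B \<Longrightarrow> \<bar>u t x - u t0 x\<bar> \<le> C" for j D C
    proof (rule uniform_Ck_SucI)
      show "uniform_Ck 0 (I \<times> B) u"
        by (rule bdd[OF D(1) _ time]) (use D(2) uniform_Ck_imp_bounded in blast)
      show "(u p has_derivative D p x) (at x within {y. (p, y) \<in> I \<times> B})" if "(p, x) \<in> I \<times> B" for p x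
        using that D(1) slice by auto
      show "uniform_Ck j (I \<times> B) (\<lambda>p x. D p x b)" if "b \<in> Basis" for b by (rule D(2)[OF that])
    qed
    consider "k = 0" | "k = Suc 0" | j where "k = Suc (Suc j)" by (cases k; cases "k - 1") auto
    then show ?case
    proof cases
      case 1
      then obtain C where C: "\<forall>s\<in>I. \<forall>t\<in>I. \<forall>x\<in>B. \<forall>y\<in>B.
          \<bar>u s x - u t y\<bar> \<le> C * (dist x y powr \<theta> + dist s t powr (\<theta> / 2))"
        using less.prems by auto
      have "\<bar>u t x\<bar> \<le> \<bar>u t0 x0\<bar> + \<bar>C\<bar> * (S powr \<theta> + R powr (\<theta> / 2))" if t: "t \<in> I" and x: "x \<in> B" for t x
      proof -
        have "\<bar>u t x - u t0 x0\<bar> \<le> C * (dist x x0 powr \<theta> + dist t t0 powr (\<theta> / 2))"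
          using C t x t0 x0 by blast
        also have "\<dots> \<le> \<bar>C\<bar> * (S powr \<theta> + R powr (\<theta> / 2))"
          using S[OF x x0] R[OF t t0] assms(2)
          by (intro mult_mono add_mono powr_mono2) auto
        finally show ?thesis by linarith
      qed
      then show ?thesis unfolding 1 uniform_Ck_0 by blast
    next
      case 2
      then obtain D C where D: "\<forall>t\<in>I. \<forall>x\<in>B. (u t has_derivative D t x) (at x within B)"
          "\<forall>b\<in>Basis. parabolic_holder_on 0 \<theta> I B (\<lambda>t x. D t x b)"
        and C: "\<forall>s\<in>I. \<forall>t\<in>I. \<forall>x\<in>B. \<bar>u s x - u t x\<bar> \<le> C * dist s t powr ((1 + \<theta>) / 2)"
        using less.prems unfolding 2 parabolic_holder_on.simps(2) by blast
      have D': "uniform_Ck 0 (I \<times> B) (\<lambda>t x. D t x b)" if "b \<in> Basis" for b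
        by (rule less.IH) (use 2 D(2) that in auto)
      have "\<bar>u t x - u t0 x\<bar> \<le> \<bar>C\<bar> * R powr ((1 + \<theta>) / 2)" if t: "t \<in> I" and x: "x \<in> B" for t x
      proof -
        have "\<bar>u t x - u t0 x\<bar> \<le> C * dist t t0 powr ((1 + \<theta>) / 2)" using C t t0 x by blast
        also have "\<dots> \<le> \<bar>C\<bar> * R powr ((1 + \<theta>) / 2)"
          using R[OF t t0] assms(2) by (intro mult_mono powr_mono2) auto
        finally show ?thesis .
      qed
      from step[OF D(1) D' this] show ?thesis unfolding 2 .
    next
      case 3
      obtain D E where D: "\<forall>t\<in>I. \<forall>x\<in>B. (u t has_derivative D t x) (at x within B)"
          "\<forall>b\<in>Basis. parabolic_holder_on (Suc j) \<theta> I B (\<lambda>t x. D t x b)"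
        and E: "\<forall>t\<in>I. \<forall>x\<in>B. ((\<lambda>s. u s x) has_real_derivative E t x) (at t within I)"
          "parabolic_holder_on j \<theta> I B E"
        using less.prems unfolding 3 parabolic_holder_on.simps(3) by blast
      have D': "uniform_Ck (Suc j) (I \<times> B) (\<lambda>t x. D t x b)" if "b \<in> Basis" for b
        by (rule less.IH) (use 3 D(2) that in auto)
      have "uniform_Ck j (I \<times> B) E" by (rule less.IH) (use 3 E(2) in auto)
      then have "uniform_Ck 0 (I \<times> B) E" by (rule uniform_Ck_imp_bounded)
      then obtain M where M: "\<And>t x. (t, x) \<in> I \<times> B \<Longrightarrow> \<bar>E t x\<bar> \<le> M" unfolding uniform_Ck_0 by auto
      have "\<bar>u t x - u t0 x\<bar> \<le> M * R" if t: "t \<in> I" and x: "x \<in> B" for t x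
      proof -
        have "norm (u t x - u t0 x) \<le> M * norm (t - t0)"
          by (rule field_differentiable_bound[OF assms(3) _ _ t t0, where f' = "\<lambda>t. E t x"])
            (use E(1) M x in auto)
        also have "\<dots> \<le> M * R"
        proof (rule mult_left_mono)
          show "norm (t - t0) \<le> R" using R[OF t t0] by (simp add: dist_norm)
          show "0 \<le> M" using M[of t0 x0] t0 x0 by (auto intro: order_trans[OF abs_ge_zero])
        qed
        finally show ?thesis by simp
      qed
      from step[OF D(1) D' this] show ?thesis unfolding 3 .
    qed
  qed
qed

lemma pderiv_along_eq:
  assumes "(F has_derivative D) (at v)" shows "pderiv_along F b v = D b"
proof -
  have "(F has_derivative D) (at (v + 0 *\<^sub>R b))" using assms by simp
  moreover have "((\<lambda>s. v + s *\<^sub>R b) has_derivative (\<lambda>s. s *\<^sub>R b)) (at 0)"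
    by (auto intro!: derivative_eq_intros)
  ultimately have "((\<lambda>s. F (v + s *\<^sub>R b)) has_derivative (\<lambda>s. D (s *\<^sub>R b))) (at 0)"
    using has_derivative_compose by fastforce
  moreover have "(\<lambda>s. D (s *\<^sub>R b)) = (*) (D b)"
    using has_derivative_bounded_linear[OF assms] by (auto simp: linear_simps)
  ultimately show ?thesis unfolding pderiv_along_def
    by (intro DERIV_imp_deriv) (simp add: has_field_derivative_def)
qed

lemma laplacian_eq:
  assumes W: "open W" "v \<in> W"
    and D: "\<And>x. x \<in> W \<Longrightarrow> (F has_derivative D x) (at x)"
    and H: "\<And>b. b \<in> Basis \<Longrightarrow> ((\<lambda>x. D x b) has_derivative H b) (at v)"
  shows "laplacian F v = (\<Sum>b\<in>Basis. H b b)"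
  unfolding laplacian_def
proof (rule sum.cong[OF refl])
  fix b :: 'a assume b: "b \<in> Basis"
  have "(pderiv_along F b has_derivative H b) (at v)"
    by (rule has_derivative_transform_within_open[OF H[OF b] W])
      (simp add: pderiv_along_eq[OF D])
  then show "pderiv_along (pderiv_along F b) b v = H b b" by (rule pderiv_along_eq)
qed

lemma laplacian_compose:
  assumes W: "open W" "v \<in> W"
    and D: "\<And>x. x \<in> W \<Longrightarrow> (F has_derivative D x) (at x)"
    and H: "\<And>b. b \<in> Basis \<Longrightarrow> ((\<lambda>x. D x b) has_derivative H b) (at v)"
    and h: "\<And>y. (h has_real_derivative h1 y) (at y)" "\<And>y. (h1 has_real_derivative h2 y) (at y)"
  shows "laplacian (\<lambda>x. h (F x)) v = (\<Sum>b\<in>Basis. h1 (F v) * H b b + h2 (F v) * D v b * D v b)"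
proof (rule laplacian_eq[OF W, where D = "\<lambda>x b. h1 (F x) * D x b" and H = "\<lambda>c b. h1 (F v) * H c b + h2 (F v) * D v b * D v c"])
  show "((\<lambda>x. h (F x)) has_derivative (\<lambda>b. h1 (F x) * D x b)) (at x)" if "x \<in> W" for x
    using has_derivative_compose[OF D[OF that] h(1)[unfolded has_field_derivative_def]] .
  show "((\<lambda>x. h1 (F x) * D x b) has_derivative (\<lambda>c. h1 (F v) * H b c + h2 (F v) * D v c * D v b)) (at v)"
    if "b \<in> Basis" for b
    by (rule has_derivative_mult[OF has_derivative_compose[OF D[OF W(2)] h(2)[unfolded has_field_derivative_def]] H[OF that]])
qed

text \<open>
  A point far from the interface is the centre of a ball that the interface misses; being connected, the
  ball lies in one of the two regions. That region is open in space-time, so a slightly smaller closed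
  ball stays in it for a short time, and the interface stays away from the centre.
\<close>
lemma stays_in_region:
  fixes v0 :: "real ^ 'n::finite"
  assumes o1: "openin (top_of_set ({0..T} \<times> UNIV)) {(t, v). t \<in> {0..T} \<and> v \<in> D1 t}"
    and o2: "openin (top_of_set ({0..T} \<times> UNIV)) {(t, v). t \<in> {0..T} \<and> v \<in> D2 t}"
    and ne: "\<And>t. t \<in> {0..T} \<Longrightarrow> \<Gamma> t \<noteq> {}"
    and cover: "\<And>t. t \<in> {0..T} \<Longrightarrow> \<Gamma> t \<union> D1 t \<union> D2 t = UNIV"
    and disj: "\<And>t. t \<in> {0..T} \<Longrightarrow> \<Gamma> t \<inter> D1 t = {} \<and> D1 t \<inter> D2 t = {}"
    and t0: "t0 \<in> {0..T}" and v0: "v0 \<in> D1 t0" and far: "3 * e \<le> infdist v0 (\<Gamma> t0)" and e: "0 < e"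
  shows "\<exists>r>0. \<forall>s\<in>{0..T} \<inter> ball t0 r. \<forall>w\<in>ball v0 r. w \<in> D1 s \<and> 2 * e \<le> infdist w (\<Gamma> s)"
proof -
  obtain O1 where O1: "open O1" "{(t, v). t \<in> {0..T} \<and> v \<in> D1 t} = ({0..T} \<times> UNIV) \<inter> O1"
    using o1 unfolding openin_open by blast
  obtain O2 where O2: "open O2" "{(t, v). t \<in> {0..T} \<and> v \<in> D2 t} = ({0..T} \<times> UNIV) \<inter> O2"
    using o2 unfolding openin_open by blast
  have m1: "x \<in> D1 t \<longleftrightarrow> (t, x) \<in> O1" and m2: "x \<in> D2 t \<longleftrightarrow> (t, x) \<in> O2" if "t \<in> {0..T}" for t x
    using O1(2) O2(2) that by blast+
  have cont: "continuous_on UNIV (\<lambda>x. (t0, x))" by (intro continuous_intros)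
  have op: "open (D1 t0)" "open (D2 t0)"
  proof -
    have "D1 t0 = (\<lambda>x. (t0, x)) -` O1" "D2 t0 = (\<lambda>x. (t0, x)) -` O2" using m1[OF t0] m2[OF t0] by auto
    then show "open (D1 t0)" "open (D2 t0)"
      using open_vimage[OF O1(1) cont] open_vimage[OF O2(1) cont] by simp_all
  qed
  have ballG: "ball v0 (3 * e) \<inter> \<Gamma> t0 = {}"
  proof -
    have "3 * e \<le> dist v0 a" if "a \<in> \<Gamma> t0" for a using infdist_le[OF that, of v0] far by linarith
    then show ?thesis by force
  qed
  have "D1 t0 \<inter> ball v0 (3 * e) = {} \<or> D2 t0 \<inter> ball v0 (3 * e) = {}"
    by (rule connectedD[OF connected_ball op]) (use disj[OF t0] cover[OF t0] ballG in blast)+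
  moreover have "v0 \<in> D1 t0 \<inter> ball v0 (3 * e)" using v0 e by simp
  ultimately have ball: "ball v0 (3 * e) \<subseteq> D1 t0" using cover[OF t0] ballG by blast
  have sub: "{t0} \<times> cball v0 (5 / 2 * e) \<subseteq> O1"
  proof
    fix p assume "p \<in> {t0} \<times> cball v0 (5 / 2 * e)"
    then obtain x where x: "p = (t0, x)" "dist v0 x \<le> 5 / 2 * e" by auto
    then have "x \<in> ball v0 (3 * e)" using e by simp
    then show "p \<in> O1" using ball m1[OF t0] x(1) by blast
  qed
  obtain \<epsilon> where eps: "\<epsilon> > 0" "(\<Union>p\<in>{t0} \<times> cball v0 (5 / 2 * e). ball p \<epsilon>) \<subseteq> O1"
    using compact_subset_open_imp_ball_epsilon_subset[OF compact_Times[OF compact_sing compact_cball] O1(1) sub]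
    by blast
  have inD: "x \<in> D1 s" if "s \<in> {0..T}" "dist t0 s < \<epsilon>" "dist v0 x \<le> 5 / 2 * e" for s x
  proof -
    have "(s, x) \<in> ball (t0, x) \<epsilon>" using that(2) by (simp add: dist_Pair_Pair)
    then have "(s, x) \<in> O1" using eps(2) that(3) by force
    then show ?thesis using m1[OF that(1)] by blast
  qed
  define r where "r = min \<epsilon> (e / 2)"
  have "w \<in> D1 s \<and> 2 * e \<le> infdist w (\<Gamma> s)" if s: "s \<in> {0..T} \<inter> ball t0 r" and w: "w \<in> ball v0 r" for s w
  proof
    have s': "s \<in> {0..T}" "dist t0 s < \<epsilon>" using s by (auto simp: r_def)
    have w': "dist v0 w < e / 2" using w by (simp add: r_def)
    show "w \<in> D1 s" by (rule inD[OF s']) (use w' e in linarith)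
    have "2 * e \<le> dist w a" if a: "a \<in> \<Gamma> s" for a
    proof (rule ccontr)
      assume "\<not> 2 * e \<le> dist w a"
      then have "dist v0 a \<le> 5 / 2 * e" using w' dist_triangle[of v0 a w] by linarith
      from inD[OF s' this] show False using a disj[OF s'(1)] by blast
    qed
    then show "2 * e \<le> infdist w (\<Gamma> s)"
      using ne[OF s'(1)] unfolding infdist_def by (auto intro: cINF_greatest)
  qed
  moreover have "0 < r" using eps(1) e by (simp add: r_def)
  ultimately show ?thesis by blast
qed

lemma parabolic_holder_SucSucE:
  assumes "parabolic_holder_on (Suc (Suc k)) \<theta> I B u"
  shows "\<exists>D E. (\<forall>t\<in>I. \<forall>x\<in>B. (u t has_derivative D t x) (at x within B)) \<and>
    (\<forall>b\<in>Basis. parabolic_holder_on (Suc k) \<theta> I B (\<lambda>t x. D t x b)) \<and>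
    (\<forall>t\<in>I. \<forall>x\<in>B. ((\<lambda>s. u s x) has_real_derivative E t x) (at t within I))"
  using assms unfolding parabolic_holder_on.simps(3) by blast

text \<open>
  The Laplacian of \<open>h(w)\<close> is a polynomial in derivatives of \<open>h\<close> at \<open>w\<close> and spatial derivatives of \<open>w\<close> of order at
  most two. In the parabolic class of order five the latter are of order at least three and hence
  differentiable in time.
\<close>
lemma composition_regularity:
  fixes w d :: "real \<Rightarrow> 'a::euclidean_space \<Rightarrow> real"
  assumes w: "parabolic_holder_on 5 \<theta> ({0..T} \<inter> ball t0 r) (ball v0 r) w"
    and \<theta>: "0 < \<theta>" and r: "0 < r" and t0: "t0 \<in> {0..T}"
    and h: "smooth_on UNIV h" and d: "\<And>t v. d t v = h (w t v)"
  shows "uniform_Ck 5 (({0..T} \<inter> ball t0 r) \<times> ball v0 r) d"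
    and "(\<lambda>s. d s v0) field_differentiable (at t0 within {0..T})"
    and "(\<lambda>s. laplacian (d s) v0) field_differentiable (at t0 within {0..T})"
proof -
  define J where "J = {0..T} \<inter> ball t0 r"
  define W where "W = ball v0 r"
  have v0: "v0 \<in> W" and t0J: "t0 \<in> J" and opW: "open W" using r t0 by (auto simp: W_def J_def)
  have atJ: "at t0 within J = at t0 within {0..T}"
    unfolding J_def by (rule at_within_nhd[of t0 "ball t0 r"]) (use r in auto)
  have w': "parabolic_holder_on (Suc (Suc 3)) \<theta> J W w" using w unfolding J_def W_def by simp
  obtain h1 where h1: "\<And>y. (h has_real_derivative h1 y) (at y)" "Ck_on (Suc (Suc 0)) UNIV h1"
  proof -
    have "Ck_on (Suc (Suc (Suc 0))) UNIV h" using h unfolding smooth_on_def by blast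
    from Ck_on_real_SucE[OF this] that show ?thesis by auto
  qed
  obtain h2 where h2: "\<And>y. (h1 has_real_derivative h2 y) (at y)" "Ck_on (Suc 0) UNIV h2"
    using Ck_on_real_SucE[OF h1(2)] by auto
  obtain h3 where h3: "\<And>y. (h2 has_real_derivative h3 y) (at y)"
    using Ck_on_real_SucE[OF h2(2)] by auto
  have conv: "convex J" "bounded J" "convex W" "bounded W"
    unfolding J_def W_def by (auto intro!: convex_Int bounded_Int)
  have Cw: "uniform_Ck 5 (J \<times> W) w"
    using parabolic_holder_uniform_Ck[OF w' \<theta> conv] by simp
  obtain R where R: "\<And>t x. (t, x) \<in> J \<times> W \<Longrightarrow> \<bar>w t x\<bar> \<le> R"
    using uniform_Ck_imp_bounded[OF Cw] unfolding uniform_Ck_0 by blast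
  have "uniform_Ck1 5 {- R..R} h"
    by (rule uniform_Ck1_of_Ck_on[where S = UNIV]) (use h in \<open>auto simp: smooth_on_def\<close>)
  then have "uniform_Ck 5 (J \<times> W) (\<lambda>t x. h (w t x))"
  proof (rule uniform_Ck_compose[OF _ _ Cw])
    show "w t x \<in> {- R..R}" if "(t, x) \<in> J \<times> W" for t x using R[OF that] by (simp add: abs_le_iff)
  qed
  then show "uniform_Ck 5 (({0..T} \<inter> ball t0 r) \<times> ball v0 r) d"
    unfolding d[abs_def] J_def W_def .
  obtain D E where D: "\<forall>t\<in>J. \<forall>x\<in>W. (w t has_derivative D t x) (at x within W)"
      "\<forall>b\<in>Basis. parabolic_holder_on (Suc 3) \<theta> J W (\<lambda>t x. D t x b)"
    and E: "\<forall>t\<in>J. \<forall>x\<in>W. ((\<lambda>s. w s x) has_real_derivative E t x) (at t within J)"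
    using parabolic_holder_SucSucE[OF w'] by blast
  have E0: "((\<lambda>s. w s v0) has_real_derivative E t0 v0) (at t0 within {0..T})"
    using E t0J v0 atJ by auto
  have "((\<lambda>s. h (w s v0)) has_real_derivative h1 (w t0 v0) * E t0 v0) (at t0 within {0..T})"
    by (rule DERIV_chain2[OF h1(1) E0])
  then show "(\<lambda>s. d s v0) field_differentiable (at t0 within {0..T})"
    unfolding d field_differentiable_def by blast
  have four: "Suc 3 = Suc (Suc 2)" and three: "Suc 2 = Suc (Suc 1)" by simp_all
  have "\<forall>b\<in>Basis. \<exists>H E. (\<forall>t\<in>J. \<forall>x\<in>W. ((\<lambda>x. D t x b) has_derivative H t x) (at x within W)) \<and>
    (\<forall>c\<in>Basis. parabolic_holder_on (Suc 2) \<theta> J W (\<lambda>t x. H t x c)) \<and>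
    (\<forall>t\<in>J. \<forall>x\<in>W. ((\<lambda>s. D s x b) has_real_derivative E t x) (at t within J))"
    using D(2) unfolding four by (intro ballI parabolic_holder_SucSucE) blast
  then obtain H where H: "\<forall>b\<in>Basis. \<exists>E. (\<forall>t\<in>J. \<forall>x\<in>W. ((\<lambda>x. D t x b) has_derivative H b t x) (at x within W)) \<and>
    (\<forall>c\<in>Basis. parabolic_holder_on (Suc 2) \<theta> J W (\<lambda>t x. H b t x c)) \<and>
    (\<forall>t\<in>J. \<forall>x\<in>W. ((\<lambda>s. D s x b) has_real_derivative E t x) (at t within J))"
    by (auto dest!: bchoice)
  have Dt: "(\<lambda>s. D s v0 b) field_differentiable (at t0 within {0..T})" if b: "b \<in> Basis" for b
  proof -
    obtain E' where "\<forall>t\<in>J. \<forall>x\<in>W. ((\<lambda>s. D s x b) has_real_derivative E' t x) (at t within J)"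
      using H b by blast
    then have "((\<lambda>s. D s v0 b) has_real_derivative E' t0 v0) (at t0 within {0..T})"
      using t0J v0 atJ by auto
    then show ?thesis unfolding field_differentiable_def by blast
  qed
  have Ht: "(\<lambda>s. H b s v0 b) field_differentiable (at t0 within {0..T})" if "b \<in> Basis" for b
  proof -
    have "parabolic_holder_on (Suc (Suc 1)) \<theta> J W (\<lambda>t x. H b t x b)"
      using H that unfolding three by blast
    then obtain E' where "\<forall>t\<in>J. \<forall>x\<in>W. ((\<lambda>s. H b s x b) has_real_derivative E' t x) (at t within J)"
      using parabolic_holder_SucSucE by blast
    then have "((\<lambda>s. H b s v0 b) has_real_derivative E' t0 v0) (at t0 within {0..T})"
      using t0J v0 atJ by auto
    then show ?thesis unfolding field_differentiable_def by blast
  qed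
  have ht: "(\<lambda>s. h1 (w s v0)) field_differentiable (at t0 within {0..T})"
    "(\<lambda>s. h2 (w s v0)) field_differentiable (at t0 within {0..T})"
    using DERIV_chain2[OF h2(1) E0] DERIV_chain2[OF h3(1) E0] unfolding field_differentiable_def by blast+
  have lap: "(\<Sum>b\<in>Basis. h1 (w s v0) * H b s v0 b + h2 (w s v0) * D s v0 b * D s v0 b) = laplacian (d s) v0"
    if s: "s \<in> J" for s
  proof -
    have "laplacian (\<lambda>x. h (w s x)) v0 = (\<Sum>b\<in>Basis. h1 (w s v0) * H b s v0 b + h2 (w s v0) * D s v0 b * D s v0 b)"
    proof (rule laplacian_compose[where F = "w s" and D = "D s" and H = "\<lambda>b. H b s v0", OF opW v0 _ _ h1(1) h2(1)])
      show "(w s has_derivative D s x) (at x)" if "x \<in> W" for x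
        using D(1)[rule_format, OF s that] at_within_open[OF that opW] by simp
      show "((\<lambda>x. D s x b) has_derivative H b s v0) (at v0)" if "b \<in> Basis" for b
      proof -
        have "((\<lambda>x. D s x b) has_derivative H b s v0) (at v0 within W)" using H s that v0 by blast
        then show ?thesis using at_within_open[OF v0 opW] by simp
      qed
    qed
    then show ?thesis unfolding d[abs_def] by simp
  qed
  show "(\<lambda>s. laplacian (d s) v0) field_differentiable (at t0 within {0..T})"
  proof (rule field_differentiable_transform_within[OF r t0])
    show "(\<Sum>b\<in>Basis. h1 (w s v0) * H b s v0 b + h2 (w s v0) * D s v0 b * D s v0 b) = laplacian (d s) v0"
      if "s \<in> {0..T}" "dist s t0 < r" for s
      by (rule lap) (use that in \<open>auto simp: J_def dist_commute\<close>)
    show "(\<lambda>s. \<Sum>b\<in>Basis. h1 (w s v0) * H b s v0 b + h2 (w s v0) * D s v0 b * D s v0 b)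
        field_differentiable (at t0 within {0..T})"
      by (intro field_differentiable_sum field_differentiable_add field_differentiable_mult ht Ht Dt)
  qed
qed

lemma locally_constant_regularity:
  fixes d :: "real \<Rightarrow> 'a::euclidean_space \<Rightarrow> real"
  assumes c: "\<And>s w. s \<in> {0..T} \<inter> ball t0 r \<Longrightarrow> w \<in> ball v0 r \<Longrightarrow> d s w = c"
    and r: "0 < r" and t0: "t0 \<in> {0..T}"
  shows "uniform_Ck k (({0..T} \<inter> ball t0 r) \<times> ball v0 r) d"
    and "(\<lambda>s. d s v0) field_differentiable (at t0 within {0..T})"
    and "(\<lambda>s. laplacian (d s) v0) field_differentiable (at t0 within {0..T})"
proof -
  have "uniform_Ck k (({0..T} \<inter> ball t0 r) \<times> ball v0 r) (\<lambda>s w. c)"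
    by (rule uniform_Ck_const) (rule order_refl)
  then show "uniform_Ck k (({0..T} \<inter> ball t0 r) \<times> ball v0 r) d"
    by (rule uniform_Ck_cong[rotated]) (use c in auto)
  show "(\<lambda>s. d s v0) field_differentiable (at t0 within {0..T})"
    by (rule field_differentiable_transform_within[OF r t0, where f = "\<lambda>_. c"])
      (use c r in \<open>auto simp: dist_commute\<close>)
  have lap: "laplacian (d s) v0 = 0" if s: "s \<in> {0..T} \<inter> ball t0 r" for s
  proof -
    have "laplacian (d s) v0 = (\<Sum>b\<in>(Basis :: 'a set). 0)"
    proof (rule laplacian_eq[where D = "\<lambda>_ _. 0" and H = "\<lambda>_ _. 0" and W = "ball v0 r"])
      show "(d s has_derivative (\<lambda>_. 0)) (at x)" if "x \<in> ball v0 r" for x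
        by (rule has_derivative_transform_within_open[OF has_derivative_const open_ball that])
          (use c[OF s] in simp)
    qed (use r in auto)
    then show ?thesis by simp
  qed
  show "(\<lambda>s. laplacian (d s) v0) field_differentiable (at t0 within {0..T})"
    by (rule field_differentiable_transform_within[OF r t0, where f = "\<lambda>_. 0"])
      (use lap in \<open>auto simp: dist_commute\<close>)
qed

lemma interface_flow_regions:
  assumes "interface_flow k \<theta> T l \<Gamma> Dp Dm"
  shows "openin (top_of_set ({0..T} \<times> UNIV)) {(t, v). t \<in> {0..T} \<and> v \<in> Dp t}"
    and "openin (top_of_set ({0..T} \<times> UNIV)) {(t, v). t \<in> {0..T} \<and> v \<in> Dm t}"
    and "t \<in> {0..T} \<Longrightarrow> torus_periodic (\<lambda>v. v \<in> \<Gamma> t) \<and> torus_periodic (\<lambda>v. v \<in> Dp t) \<and>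
      \<Gamma> t \<noteq> {} \<and> \<Gamma> t \<union> Dp t \<union> Dm t = UNIV \<and>
      \<Gamma> t \<inter> Dp t = {} \<and> \<Gamma> t \<inter> Dm t = {} \<and> Dp t \<inter> Dm t = {}"
proof -
  note c = assms[unfolded interface_flow_def]
  show "openin (top_of_set ({0..T} \<times> UNIV)) {(t, v). t \<in> {0..T} \<and> v \<in> Dp t}"
    by (rule conjunct1[OF conjunct2[OF c]])
  show "openin (top_of_set ({0..T} \<times> UNIV)) {(t, v). t \<in> {0..T} \<and> v \<in> Dm t}"
    by (rule conjunct1[OF conjunct2[OF conjunct2[OF c]]])
  assume "t \<in> {0..T}"
  from bspec[OF conjunct1[OF c] this]
  show "torus_periodic (\<lambda>v. v \<in> \<Gamma> t) \<and> torus_periodic (\<lambda>v. v \<in> Dp t) \<and>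
      \<Gamma> t \<noteq> {} \<and> \<Gamma> t \<union> Dp t \<union> Dm t = UNIV \<and>
      \<Gamma> t \<inter> Dp t = {} \<and> \<Gamma> t \<inter> Dm t = {} \<and> Dp t \<inter> Dm t = {}"
    by (elim conjE) (intro conjI)
qed

text \<open>
  Where the signed distance is less than \<open>3 * d0\<close> in absolute value it has the regularity assumed for it.
  Elsewhere its absolute value is at least \<open>2 * d0\<close> nearby in space and time, with a fixed sign, and there
  the cut-off is constant.
\<close>
lemma cut_distance_local:
  assumes flow: "interface_flow k \<theta>' T l \<Gamma> Dp Dm" and \<theta>: "0 < \<theta>" and d0: "0 < d0"
    and near: "\<And>t v. t \<in> {0..T} \<Longrightarrow> \<bar>signed_dist \<Gamma> Dp t v\<bar> < 3 * d0 \<Longrightarrow>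
         \<exists>r>0. parabolic_holder_on 5 \<theta> ({0..T} \<inter> ball t r) (ball v r) (signed_dist \<Gamma> Dp)"
    and h: "cutoff d0 h" and d: "\<And>t v. d t v = h (signed_dist \<Gamma> Dp t v)"
    and t0: "t0 \<in> {0..T}"
  shows "\<exists>r>0. uniform_Ck 5 (({0..T} \<inter> ball t0 r) \<times> ball v0 r) d \<and>
    (\<lambda>s. d s v0) field_differentiable (at t0 within {0..T}) \<and>
    (\<lambda>s. laplacian (d s) v0) field_differentiable (at t0 within {0..T})"
proof (cases "\<bar>signed_dist \<Gamma> Dp t0 v0\<bar> < 3 * d0")
  case True
  obtain r where r: "0 < r" "parabolic_holder_on 5 \<theta> ({0..T} \<inter> ball t0 r) (ball v0 r) (signed_dist \<Gamma> Dp)"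
    using near[OF t0 True] by blast
  have "smooth_on UNIV h" using h unfolding cutoff_def by blast
  from composition_regularity[OF r(2) \<theta> r(1) t0 this d] r(1) show ?thesis by blast
next
  case False
  note op = interface_flow_regions(1,2)[OF flow] and part = interface_flow_regions(3)[OF flow]
  have far: "3 * d0 \<le> infdist v0 (\<Gamma> t0)"
    using False infdist_nonneg[of v0 "\<Gamma> t0"] unfolding signed_dist_def by (auto split: if_splits)
  have "v0 \<notin> \<Gamma> t0" using far d0 by auto
  then consider "v0 \<in> Dp t0" | "v0 \<in> Dm t0" using part[OF t0] by blast
  then have "\<exists>r>0. \<exists>c. \<forall>s\<in>{0..T} \<inter> ball t0 r. \<forall>w\<in>ball v0 r. d s w = c"
  proof cases
    case 1
    have "\<exists>r>0. \<forall>s\<in>{0..T} \<inter> ball t0 r. \<forall>w\<in>ball v0 r. w \<in> Dp s \<and> 2 * d0 \<le> infdist w (\<Gamma> s)"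
      by (rule stays_in_region[where \<Gamma> = \<Gamma> and ?D1.0 = Dp and ?D2.0 = Dm, OF op _ _ _ t0 1 far d0]) (blast dest: part)+
    then obtain r where r: "0 < r"
      "\<forall>s\<in>{0..T} \<inter> ball t0 r. \<forall>w\<in>ball v0 r. w \<in> Dp s \<and> 2 * d0 \<le> infdist w (\<Gamma> s)" by blast
    have "d s w = - 2 * d0" if "s \<in> {0..T} \<inter> ball t0 r" "w \<in> ball v0 r" for s w
    proof -
      have "signed_dist \<Gamma> Dp s w \<le> - 2 * d0" using r(2) that unfolding signed_dist_def by auto
      then show ?thesis using h unfolding d cutoff_def by blast
    qed
    then show ?thesis using r(1) by blast
  next
    case 2
    have "\<exists>r>0. \<forall>s\<in>{0..T} \<inter> ball t0 r. \<forall>w\<in>ball v0 r. w \<in> Dm s \<and> 2 * d0 \<le> infdist w (\<Gamma> s)"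
      by (rule stays_in_region[where \<Gamma> = \<Gamma> and ?D1.0 = Dm and ?D2.0 = Dp, OF op(2) op(1) _ _ _ t0 2 far d0]) (blast dest: part)+
    then obtain r where r: "0 < r"
      "\<forall>s\<in>{0..T} \<inter> ball t0 r. \<forall>w\<in>ball v0 r. w \<in> Dm s \<and> 2 * d0 \<le> infdist w (\<Gamma> s)" by blast
    have "d s w = 2 * d0" if "s \<in> {0..T} \<inter> ball t0 r" "w \<in> ball v0 r" for s w
    proof -
      have "w \<notin> Dp s" using r(2) that part[of s] by auto
      then have "2 * d0 \<le> signed_dist \<Gamma> Dp s w" using r(2) that unfolding signed_dist_def by auto
      then show ?thesis using h unfolding d cutoff_def by blast
    qed
    then show ?thesis using r(1) by blast
  qed
  then obtain r c where r: "0 < r" "\<And>s w. s \<in> {0..T} \<inter> ball t0 r \<Longrightarrow> w \<in> ball v0 r \<Longrightarrow> d s w = c" by blast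
  note reg = locally_constant_regularity[where d = d and T = T and ?t0.0 = t0 and r = r and ?v0.0 = v0 and c = c, OF r(2,1) t0]
  show ?thesis using reg r(1) by blast
qed

lemma infdist_translate_le:
  fixes \<Gamma> :: "(real ^ 'n::finite) set"
  assumes "torus_periodic (\<lambda>v. v \<in> \<Gamma>)" "\<Gamma> \<noteq> {}"
  shows "infdist (v + (\<chi> i. of_int (k $ i))) \<Gamma> \<le> infdist v \<Gamma>"
proof -
  have "infdist (v + (\<chi> i. of_int (k $ i))) \<Gamma> \<le> dist v a" if "a \<in> \<Gamma>" for a
  proof -
    have "a + (\<chi> i. of_int (k $ i)) \<in> \<Gamma>" using assms(1) that unfolding torus_periodic_def by blast
    from infdist_le[OF this, of "v + (\<chi> i. of_int (k $ i))"] show ?thesis by simp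
  qed
  then show ?thesis using assms(2) unfolding infdist_def[of v] by (auto intro: cINF_greatest)
qed

lemma signed_dist_periodic:
  assumes flow: "interface_flow k \<theta> T l \<Gamma> Dp Dm" and t: "t \<in> {0..T}"
  shows "torus_periodic (signed_dist \<Gamma> Dp t)"
  unfolding torus_periodic_def
proof (intro allI)
  fix v and j :: "int ^ 'a"
  have per: "torus_periodic (\<lambda>v. v \<in> \<Gamma> t)" "torus_periodic (\<lambda>v. v \<in> Dp t)" "\<Gamma> t \<noteq> {}"
    using interface_flow_regions(3)[OF flow t] by auto
  have "infdist ((v + (\<chi> i. of_int (j $ i))) + (\<chi> i. of_int ((- j) $ i))) (\<Gamma> t) \<le> infdist (v + (\<chi> i. of_int (j $ i))) (\<Gamma> t)"
    by (rule infdist_translate_le[OF per(1,3)])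
  moreover have "(v + (\<chi> i. of_int (j $ i))) + (\<chi> i. of_int ((- j) $ i)) = v" by (simp add: vec_eq_iff)
  ultimately have "infdist v (\<Gamma> t) \<le> infdist (v + (\<chi> i. of_int (j $ i))) (\<Gamma> t)" by (simp only:)
  then have "infdist (v + (\<chi> i. of_int (j $ i))) (\<Gamma> t) = infdist v (\<Gamma> t)"
    using infdist_translate_le[OF per(1,3), of v j] by simp
  moreover have "v + (\<chi> i. of_int (j $ i)) \<in> Dp t \<longleftrightarrow> v \<in> Dp t"
    using per(2) unfolding torus_periodic_def by blast
  ultimately show "signed_dist \<Gamma> Dp t (v + (\<chi> i. of_int (j $ i))) = signed_dist \<Gamma> Dp t v"
    unfolding signed_dist_def by simp
qed

text \<open>
  Finitely many local pieces cover \<open>[0,T]\<close> times the unit cube, and their largest bound is valid everywhere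
  by periodicity.
\<close>
lemma uniform_Ck_of_local_periodic:
  fixes F :: "real \<Rightarrow> real ^ 'n::finite \<Rightarrow> real"
  assumes loc: "\<And>t v. t \<in> {0..T} \<Longrightarrow> \<exists>r>0. uniform_Ck k (({0..T} \<inter> ball t r) \<times> ball v r) F"
    and per: "\<And>t. t \<in> {0..T} \<Longrightarrow> torus_periodic (F t)"
  shows "uniform_Ck k ({0..T} \<times> UNIV) F"
proof -
  define C where "C = {0..T} \<times> cbox 0 (1 :: real ^ 'n)"
  have "\<forall>p\<in>C. \<exists>r M. 0 < r \<and> bounded_Ck k M (({0..T} \<inter> ball (fst p) r) \<times> ball (snd p) r) F"
    using loc unfolding C_def uniform_Ck_def by fastforce
  then obtain r M where rM: "\<And>p. p \<in> C \<Longrightarrow> 0 < r p"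
      "\<And>p. p \<in> C \<Longrightarrow> bounded_Ck k (M p) (({0..T} \<inter> ball (fst p) (r p)) \<times> ball (snd p) (r p)) F"
    by metis
  have comp: "compact C" unfolding C_def by (intro compact_Times compact_Icc compact_cbox)
  have cover: "C \<subseteq> (\<Union>p\<in>C. ball (fst p) (r p) \<times> ball (snd p) (r p))"
    using rM(1) by (force intro: centre_in_ball[THEN iffD2])
  obtain C' where C': "C' \<subseteq> C" "finite C'" "C \<subseteq> (\<Union>p\<in>C'. ball (fst p) (r p) \<times> ball (snd p) (r p))"
    by (rule compactE_image[OF comp _ cover]) (auto intro: open_Times)
  define m where "m = Max (M ` C')"
  have "bounded_Ck k m ({0..T} \<times> UNIV) F"
  proof (rule bounded_Ck_local)
    show "open {x. (p, x) \<in> {0..T} \<times> (UNIV :: (real ^ 'n) set)}" for p by (cases "p \<in> {0..T}") auto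
    fix t and x :: "real ^ 'n" assume "(t, x) \<in> {0..T} \<times> UNIV"
    then have t: "t \<in> {0..T}" by simp
    define j :: "int ^ 'n" where "j = (\<chi> i. - \<lfloor>x $ i\<rfloor>)"
    define c :: "real ^ 'n" where "c = (\<chi> i. of_int (j $ i))"
    have "x + c \<in> cbox 0 1"
    proof -
      have "0 \<le> x $ i - of_int \<lfloor>x $ i\<rfloor> \<and> x $ i - of_int \<lfloor>x $ i\<rfloor> \<le> 1" for i by linarith
      then show ?thesis by (simp add: mem_box_cart c_def j_def)
    qed
    then have "(t, x + c) \<in> C" using t by (simp add: C_def)
    then obtain p where p: "p \<in> C'" "(t, x + c) \<in> ball (fst p) (r p) \<times> ball (snd p) (r p)" using C'(3) by blast
    define Q where "Q = ({0..T} \<inter> ball (fst p) (r p)) \<times> ball (snd p) (r p)"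
    have "M p \<le> m" unfolding m_def using p(1) C'(2) by simp
    then have "bounded_Ck k m Q F"
      using bounded_Ck_mono[OF rM(2)] p(1) C'(1) unfolding Q_def by blast
    then have "bounded_Ck k m {(t, y). (t, y + c) \<in> Q} (\<lambda>t y. F t (y + c))" by (rule bounded_Ck_translate)
    then have b: "bounded_Ck k m {(t, y). (t, y + c) \<in> Q} F"
      by (rule bounded_Ck_cong[rotated]) (use per in \<open>auto simp: Q_def c_def torus_periodic_def\<close>)
    have "open {y. (s, y) \<in> {(t, y). (t, y + c) \<in> Q}}" for s
    proof (cases "s \<in> {0..T} \<inter> ball (fst p) (r p)")
      case True
      have "open ((\<lambda>y. y + c) -` ball (snd p) (r p))" by (intro open_vimage open_ball continuous_intros)
      then show ?thesis using True by (simp add: Q_def vimage_def)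
    next
      case False
      then have "{y. (s, y) \<in> {(t, y). (t, y + c) \<in> Q}} = {}" by (auto simp: Q_def)
      then show ?thesis by (simp only: open_empty)
    qed
    then show "\<exists>R\<subseteq>{0..T} \<times> UNIV. (t, x) \<in> R \<and> (\<forall>p. open {x. (p, x) \<in> R}) \<and> bounded_Ck k m R F"
      using b p(2) t by (intro exI[of _ "{(t, y). (t, y + c) \<in> Q}"]) (auto simp: Q_def)
  qed
  then show ?thesis unfolding uniform_Ck_def by blast
qed

lemma uniform_Ck_laplacian:
  fixes F :: "'p \<Rightarrow> 'a::euclidean_space \<Rightarrow> real"
  assumes "uniform_Ck (Suc (Suc k)) (I \<times> UNIV) F"
  shows "uniform_Ck k (I \<times> UNIV) (\<lambda>t. laplacian (F t))"
proof -
  obtain D where D: "\<And>p x. (p, x) \<in> I \<times> UNIV \<Longrightarrow> (F p has_derivative D p x) (at x within {y. (p, y) \<in> I \<times> UNIV})"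
      "\<And>b. b \<in> Basis \<Longrightarrow> uniform_Ck (Suc k) (I \<times> UNIV) (\<lambda>p x. D p x b)"
    using uniform_Ck_SucE[OF assms] by blast
  have "\<forall>b\<in>Basis. \<exists>H. (\<forall>p x. (p, x) \<in> I \<times> UNIV \<longrightarrow> ((\<lambda>x. D p x b) has_derivative H p x) (at x within {y. (p, y) \<in> I \<times> UNIV}))
      \<and> (\<forall>c\<in>Basis. uniform_Ck k (I \<times> UNIV) (\<lambda>p x. H p x c))"
    using D(2) unfolding uniform_Ck_Suc by blast
  then obtain H where H: "\<forall>b\<in>Basis. (\<forall>p x. (p, x) \<in> I \<times> UNIV \<longrightarrow> ((\<lambda>x. D p x b) has_derivative H b p x) (at x within {y. (p, y) \<in> I \<times> UNIV}))
      \<and> (\<forall>c\<in>Basis. uniform_Ck k (I \<times> UNIV) (\<lambda>p x. H b p x c))"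
    by (auto dest!: bchoice)
  have "uniform_Ck k (I \<times> UNIV) (\<lambda>p x. \<Sum>b\<in>Basis. H b p x b)"
    by (rule uniform_Ck_sum) (use H in auto)
  moreover have "(\<Sum>b\<in>Basis. H b p x b) = laplacian (F p) x" if "(p, x) \<in> I \<times> UNIV" for p x
    by (rule laplacian_eq[symmetric, where W = UNIV and D = "D p"]) (use D(1) H that in auto)
  ultimately show ?thesis by (rule uniform_Ck_cong[rotated])
qed

section \<open>The discretisation error\<close>

lemma second_difference_error:
  fixes W :: "real \<Rightarrow> real"
  assumes W: "\<And>s. (W has_real_derivative W1 s) (at s)" "\<And>s. (W1 has_real_derivative W2 s) (at s)"
      "\<And>s. (W2 has_real_derivative W3 s) (at s)" and M: "\<And>s. \<bar>W3 s\<bar> \<le> M" and \<delta>: "0 < \<delta>"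
  shows "\<bar>W \<delta> + W (- \<delta>) - 2 * W 0 - \<delta>\<^sup>2 * W2 0\<bar> \<le> M * \<delta> ^ 3"
proof -
  define diff where "diff m = (if m = 0 then W else if m = 1 then W1 else if m = 2 then W2 else W3)" for m :: nat
  have taylor: "\<bar>W x - (W 0 + W1 0 * x + W2 0 / 2 * x\<^sup>2)\<bar> \<le> M / 6 * \<bar>x\<bar> ^ 3"
    if x: "x \<noteq> 0" "- \<delta> \<le> x" "x \<le> \<delta>" for x
  proof -
    have "\<forall>m t. m < 3 \<and> - \<delta> \<le> t \<and> t \<le> \<delta> \<longrightarrow> (diff m has_real_derivative diff (Suc m) t) (at t)"
      using W unfolding diff_def by (auto simp: less_Suc_eq numeral_eq_Suc)
    then have "\<exists>t. (if x < 0 then x < t \<and> t < 0 else 0 < t \<and> t < x) \<and>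
        W x = (\<Sum>m<3. diff m 0 / fact m * (x - 0) ^ m) + diff 3 t / fact 3 * (x - 0) ^ 3"
      by (intro Taylor[of 3 diff W "- \<delta>" \<delta> 0 x]) (use x \<delta> in \<open>auto simp: diff_def\<close>)
    then obtain t where "W x = (\<Sum>m<3. diff m 0 / fact m * (x - 0) ^ m) + diff 3 t / fact 3 * (x - 0) ^ 3"
      by blast
    then have "W x - (W 0 + W1 0 * x + W2 0 / 2 * x\<^sup>2) = W3 t / 6 * x ^ 3"
      by (simp add: diff_def numeral_eq_Suc)
    moreover have "\<bar>W3 t / 6 * x ^ 3\<bar> \<le> M / 6 * \<bar>x\<bar> ^ 3"
      unfolding abs_mult power_abs by (intro mult_right_mono) (use M[of t] in auto)
    ultimately show ?thesis by (simp only:)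
  qed
  have M0: "0 \<le> M" using M[of 0] by linarith
  have key: "\<bar>a + b - 2 * c - s\<bar> \<le> e + e"
    if "\<bar>a - (c + r1 + r2)\<bar> \<le> e" "\<bar>b - (c - r1 + r2)\<bar> \<le> e" "s = 2 * r2" for a b c e s r1 r2 :: real
    using that by linarith
  have "\<bar>W \<delta> - (W 0 + W1 0 * \<delta> + W2 0 / 2 * \<delta>\<^sup>2)\<bar> \<le> M / 6 * \<delta> ^ 3"
    using taylor[of \<delta>] \<delta> by simp
  moreover have "\<bar>W (- \<delta>) - (W 0 - W1 0 * \<delta> + W2 0 / 2 * \<delta>\<^sup>2)\<bar> \<le> M / 6 * \<delta> ^ 3"
    using taylor[of "- \<delta>"] \<delta> by simp
  ultimately have "\<bar>W \<delta> + W (- \<delta>) - 2 * W 0 - \<delta>\<^sup>2 * W2 0\<bar> \<le> M / 6 * \<delta> ^ 3 + M / 6 * \<delta> ^ 3"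
    by (rule key) simp
  also have "\<dots> \<le> M * \<delta> ^ 3" using M0 \<delta> by simp
  finally show ?thesis .
qed

lemma sum_Basis_axis:
  fixes G :: "real ^ 'n::finite \<Rightarrow> real"
  shows "(\<Sum>b\<in>Basis. G b) = (\<Sum>i\<in>UNIV. G (axis i 1))"
proof -
  have B: "(Basis :: (real ^ 'n) set) = (\<lambda>i. axis i 1) ` UNIV" by (auto simp: Basis_vec_def)
  have inj: "inj (\<lambda>i. axis i 1 :: real ^ 'n)" by (auto simp: inj_on_def axis_eq_axis)
  show ?thesis unfolding B by (simp add: sum.reindex[OF inj])
qed

text \<open>
  The error of the second difference quotient with step \<open>1 / N\<close>, computed in the variable stretched by
  \<open>1 / e\<close>: there the step is \<open>\<delta> = 1 / (N e)\<close>, Taylor's formula leaves a remainder of order \<open>\<delta>\<^sup>3\<close>, and the factor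
  \<open>N\<^sup>2\<close> of the discrete Laplacian turns it into \<open>1 / (N e\<^sup>3)\<close>.
\<close>
lemma discretisation_error:
  fixes w :: "'q \<Rightarrow> real ^ 'n::finite \<Rightarrow> real"
  assumes C: "uniform_Ck 3 (P \<times> UNIV) (\<lambda>q x. w q (e q *\<^sub>R x))" and e: "\<And>q. q \<in> P \<Longrightarrow> 0 < e q"
  shows "\<exists>M. \<forall>q\<in>P. \<forall>N\<ge>1. \<forall>x.
    \<bar>discrete_laplacian N (\<lambda>y. w q (grid_point N y)) x - laplacian (w q) (grid_point N x)\<bar>
      \<le> M / (real N * e q ^ 3)"
proof -
  define F where "F q x = w q (e q *\<^sub>R x)" for q x
  have "uniform_Ck (Suc (Suc (Suc 0))) (P \<times> UNIV) F" using C by (simp add: F_def[abs_def] numeral_3_eq_3)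
  then obtain D where D': "\<And>q x. (q, x) \<in> P \<times> UNIV \<Longrightarrow> (F q has_derivative D q x) (at x within {y. (q, y) \<in> P \<times> UNIV})"
      "\<And>b. b \<in> Basis \<Longrightarrow> uniform_Ck (Suc (Suc 0)) (P \<times> UNIV) (\<lambda>q x. D q x b)"
    using uniform_Ck_SucE[of "Suc (Suc 0)" "P \<times> UNIV" F] by blast
  have "\<forall>b\<in>Basis. \<exists>H. (\<forall>q x. (q, x) \<in> P \<times> UNIV \<longrightarrow> ((\<lambda>x. D q x b) has_derivative H q x) (at x within {y. (q, y) \<in> P \<times> UNIV}))
      \<and> (\<forall>c\<in>Basis. uniform_Ck (Suc 0) (P \<times> UNIV) (\<lambda>q x. H q x c))"
    using D'(2) unfolding uniform_Ck_Suc[of "Suc 0"] by blast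
  then obtain H where H': "\<forall>b\<in>Basis. (\<forall>q x. (q, x) \<in> P \<times> UNIV \<longrightarrow> ((\<lambda>x. D q x b) has_derivative H b q x) (at x within {y. (q, y) \<in> P \<times> UNIV}))
      \<and> (\<forall>c\<in>Basis. uniform_Ck (Suc 0) (P \<times> UNIV) (\<lambda>q x. H b q x c))"
    by (auto dest!: bchoice)
  have "\<forall>b\<in>Basis. \<exists>G. (\<forall>q x. (q, x) \<in> P \<times> UNIV \<longrightarrow> ((\<lambda>x. H b q x b) has_derivative G q x) (at x within {y. (q, y) \<in> P \<times> UNIV}))
      \<and> (\<forall>c\<in>Basis. uniform_Ck 0 (P \<times> UNIV) (\<lambda>q x. G q x c))"
    using H' unfolding uniform_Ck_Suc[of 0] by blast
  then obtain G where G': "\<forall>b\<in>Basis. (\<forall>q x. (q, x) \<in> P \<times> UNIV \<longrightarrow> ((\<lambda>x. H b q x b) has_derivative G b q x) (at x within {y. (q, y) \<in> P \<times> UNIV}))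
      \<and> (\<forall>c\<in>Basis. uniform_Ck 0 (P \<times> UNIV) (\<lambda>q x. G b q x c))"
    by (auto dest!: bchoice)
  have D: "(F q has_derivative D q x) (at x)" if "q \<in> P" for q x
    using D'(1)[of q x] that by simp
  have H: "((\<lambda>x. D q x b) has_derivative H b q x) (at x)" if "q \<in> P" "b \<in> Basis" for q x b
    using H'[rule_format, OF that(2), THEN conjunct1, rule_format, of q x] that by simp
  have G: "((\<lambda>x. H b q x b) has_derivative G b q x) (at x)" if "q \<in> P" "b \<in> Basis" for q x b
    using G'[rule_format, OF that(2), THEN conjunct1, rule_format, of q x] that by simp
  have "\<forall>b\<in>Basis. \<exists>m. \<forall>q x. (q, x) \<in> P \<times> UNIV \<longrightarrow> \<bar>G b q x b\<bar> \<le> m"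
    using G' unfolding uniform_Ck_0 by blast
  then obtain m where m: "\<And>b q x. b \<in> Basis \<Longrightarrow> q \<in> P \<Longrightarrow> \<bar>G b q x b\<bar> \<le> m b" by (metis UNIV_I mem_Sigma_iff)
  have line: "\<bar>F q (y + \<delta> *\<^sub>R b) + F q (y - \<delta> *\<^sub>R b) - 2 * F q y - \<delta>\<^sup>2 * H b q y b\<bar> \<le> m b * \<delta> ^ 3"
    if q: "q \<in> P" and b: "b \<in> Basis" and \<delta>: "0 < \<delta>" for q y b \<delta>
  proof -
    have chain: "((\<lambda>s. A (y + s *\<^sub>R b)) has_real_derivative A' b) (at s)"
      if A: "(A has_derivative A') (at (y + s *\<^sub>R b))" for A :: "real ^ 'n \<Rightarrow> real" and A' s
    proof -
      have "((\<lambda>s. y + s *\<^sub>R b) has_derivative (\<lambda>s. s *\<^sub>R b)) (at s)" by (auto intro!: derivative_eq_intros)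
      from has_derivative_compose[OF this A]
      have "((\<lambda>s. A (y + s *\<^sub>R b)) has_derivative (\<lambda>s. A' (s *\<^sub>R b))) (at s)" .
      moreover have "(\<lambda>s. A' (s *\<^sub>R b)) = (*) (A' b)"
        using has_derivative_bounded_linear[OF A] by (auto simp: linear_simps)
      ultimately show ?thesis by (simp add: has_field_derivative_def)
    qed
    have "\<bar>F q (y + \<delta> *\<^sub>R b) + F q (y + (- \<delta>) *\<^sub>R b) - 2 * F q (y + 0 *\<^sub>R b) - \<delta>\<^sup>2 * H b q (y + 0 *\<^sub>R b) b\<bar> \<le> m b * \<delta> ^ 3"
      by (rule second_difference_error[where W = "\<lambda>s. F q (y + s *\<^sub>R b)" and ?W1.0 = "\<lambda>s. D q (y + s *\<^sub>R b) b"
            and ?W2.0 = "\<lambda>s. H b q (y + s *\<^sub>R b) b" and ?W3.0 = "\<lambda>s. G b q (y + s *\<^sub>R b) b",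
            OF chain[OF D[OF q]] chain[OF H[OF q b]] chain[OF G[OF q b]] m[OF b q] \<delta>])
    then show ?thesis by simp
  qed
  have "\<bar>discrete_laplacian N (\<lambda>y. w q (grid_point N y)) x - laplacian (w q) (grid_point N x)\<bar>
      \<le> (\<Sum>b\<in>Basis. m b) / (real N * e q ^ 3)" if q: "q \<in> P" and N: "1 \<le> N" for q N x
  proof -
    have eq: "0 < e q" and N0: "0 < real N" using e[OF q] N by auto
    define v where "v = grid_point N x"
    define y where "y = inverse (e q) *\<^sub>R v"
    define \<delta> where "\<delta> = 1 / (real N * e q)"
    have \<delta>: "0 < \<delta>" using eq N0 by (simp add: \<delta>_def)
    have wF: "w q u = F q (inverse (e q) *\<^sub>R u)" for u using eq by (simp add: F_def)
    have grid: "grid_point N (x + axis i 1) = v + (1 / real N) *\<^sub>R axis i 1"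
      "grid_point N (x - axis i 1) = v - (1 / real N) *\<^sub>R axis i 1" for i
      by (simp_all add: grid_point_def v_def vec_eq_iff axis_def add_divide_distrib diff_divide_distrib)
    have grid': "w q (grid_point N (x + axis i 1)) = F q (y + \<delta> *\<^sub>R axis i 1)"
      "w q (grid_point N (x - axis i 1)) = F q (y - \<delta> *\<^sub>R axis i 1)" "w q (grid_point N x) = F q y" for i
      unfolding wF grid y_def \<delta>_def using eq
      by (simp_all add: scaleR_right_distrib scaleR_diff_right v_def inverse_eq_divide mult.commute)
    have lap: "laplacian (w q) v = (\<Sum>b\<in>Basis. inverse (e q) * (inverse (e q) * H b q y b))"
    proof (rule laplacian_eq[where W = UNIV and D = "\<lambda>u h. inverse (e q) * D q (inverse (e q) *\<^sub>R u) h"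
            and H = "\<lambda>b h. inverse (e q) * (inverse (e q) * H b q y h)"])
      have sc: "((\<lambda>u. A (inverse (e q) *\<^sub>R u)) has_derivative (\<lambda>h. inverse (e q) * A' h)) (at u)"
        if A: "(A has_derivative A') (at (inverse (e q) *\<^sub>R u))" for A :: "real ^ 'n \<Rightarrow> real" and A' u
      proof -
        have "((\<lambda>u. inverse (e q) *\<^sub>R u) has_derivative (\<lambda>u. inverse (e q) *\<^sub>R u)) (at u)"
          by (auto intro!: derivative_eq_intros)
        from has_derivative_compose[OF this A] show ?thesis
          using has_derivative_bounded_linear[OF A] by (simp add: linear_simps)
      qed
      show "(w q has_derivative (\<lambda>h. inverse (e q) * D q (inverse (e q) *\<^sub>R u) h)) (at u)" for u
        using sc[OF D[OF q]] unfolding wF[abs_def] .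
      show "((\<lambda>u. inverse (e q) * D q (inverse (e q) *\<^sub>R u) b) has_derivative
          (\<lambda>h. inverse (e q) * (inverse (e q) * H b q y h))) (at v)" if "b \<in> Basis" for b
        using has_derivative_mult_right[OF sc[OF H[OF q that]], of "inverse (e q)" v] unfolding y_def .
    qed auto
    have sq: "(real N)\<^sup>2 * (\<delta>\<^sup>2 * c) = inverse (e q) * (inverse (e q) * c)" for c
      using eq N0 by (simp add: \<delta>_def power2_eq_square field_simps)
    have "discrete_laplacian N (\<lambda>y. w q (grid_point N y)) x - laplacian (w q) v
        = (real N)\<^sup>2 * (\<Sum>b\<in>Basis. F q (y + \<delta> *\<^sub>R b) + F q (y - \<delta> *\<^sub>R b) - 2 * F q y)
          - (\<Sum>b\<in>Basis. (real N)\<^sup>2 * (\<delta>\<^sup>2 * H b q y b))"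
      unfolding discrete_laplacian_def grid' lap sq sum_Basis_axis ..
    also have "\<dots> = (real N)\<^sup>2 * (\<Sum>b\<in>Basis. F q (y + \<delta> *\<^sub>R b) + F q (y - \<delta> *\<^sub>R b) - 2 * F q y - \<delta>\<^sup>2 * H b q y b)"
      by (simp only: sum_distrib_left right_diff_distrib[symmetric] sum_subtractf[symmetric])
    finally have "\<bar>discrete_laplacian N (\<lambda>y. w q (grid_point N y)) x - laplacian (w q) v\<bar>
        = (real N)\<^sup>2 * \<bar>\<Sum>b\<in>Basis. F q (y + \<delta> *\<^sub>R b) + F q (y - \<delta> *\<^sub>R b) - 2 * F q y - \<delta>\<^sup>2 * H b q y b\<bar>"
      by (simp add: abs_mult)
    also have "\<dots> \<le> (real N)\<^sup>2 * (\<Sum>b\<in>Basis. m b * \<delta> ^ 3)"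
      by (intro mult_left_mono order_trans[OF sum_abs] sum_mono line q \<delta>) auto
    also have "\<dots> = (\<Sum>b\<in>Basis. m b) * ((real N)\<^sup>2 * \<delta> ^ 3)"
      by (simp add: sum_distrib_right[symmetric])
    also have "(real N)\<^sup>2 * \<delta> ^ 3 = 1 / (real N * e q ^ 3)"
      using eq N0 by (simp add: \<delta>_def field_simps power2_eq_square power3_eq_cube)
    finally show ?thesis unfolding v_def by simp
  qed
  then show ?thesis by blast
qed

section \<open>Regularity of the barriers\<close>

lemma smooth_half_line_Lipschitz:
  assumes "smooth_on {0..} g"
  shows "\<exists>\<Lambda>. \<forall>a\<in>{0..B}. \<forall>b\<in>{0..B}. \<bar>g a - g b\<bar> \<le> \<Lambda> * \<bar>a - b\<bar>"
proof -
  obtain g' where g': "\<And>x. x \<in> {0..B} \<Longrightarrow> (g has_real_derivative g' x) (at x within {0..B})"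
      "uniform_Ck1 0 {0..B} g'"
    using uniform_Ck1_SucE[OF smooth_half_line_uniform_Ck1[OF assms order_refl, of "Suc 0" B]] by blast
  then obtain \<Lambda> where "\<forall>x\<in>{0..B}. \<bar>g' x\<bar> \<le> \<Lambda>" unfolding uniform_Ck1_0 by blast
  then have "\<bar>g a - g b\<bar> \<le> \<Lambda> * \<bar>a - b\<bar>" if "a \<in> {0..B}" "b \<in> {0..B}" for a b
    using field_differentiable_bound[of "{0..B}" g g' \<Lambda> a b] g'(1) that by simp
  then show ?thesis by blast
qed

lemma torus_periodic_laplacian:
  assumes "torus_periodic u" shows "torus_periodic (laplacian u)"
proof -
  have p: "torus_periodic (pderiv_along w b)" if "torus_periodic w" for w :: "real ^ 'a \<Rightarrow> real" and b
    unfolding torus_periodic_def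
  proof (intro allI)
    fix v :: "real ^ 'a" and k :: "int ^ 'a"
    have "w (v + (\<chi> i. of_int (k $ i)) + s *\<^sub>R b) = w (v + s *\<^sub>R b)" for s
    proof -
      have "v + (\<chi> i. of_int (k $ i)) + s *\<^sub>R b = v + s *\<^sub>R b + (\<chi> i. of_int (k $ i))" by simp
      then show ?thesis using that unfolding torus_periodic_def by (simp only:)
    qed
    then show "pderiv_along w b (v + (\<chi> i. of_int (k $ i))) = pderiv_along w b v"
      unfolding pderiv_along_def by simp
  qed
  have "torus_periodic (pderiv_along (pderiv_along u b) b)" for b by (intro p assms)
  then show ?thesis unfolding torus_periodic_def laplacian_def by simp
qed

lemma grid_point_discrete_periodic:
  fixes u :: "real ^ 'n::finite \<Rightarrow> 'b"
  assumes "torus_periodic u" "1 \<le> N" shows "discrete_periodic N (\<lambda>x. u (grid_point N x))"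
  unfolding discrete_periodic_def
proof (intro allI)
  fix x k :: "int ^ 'n"
  have "grid_point N (x + (\<chi> i. int N * k $ i)) = grid_point N x + (\<chi> i. of_int (k $ i))"
    using assms(2) by (simp add: grid_point_def vec_eq_iff add_divide_distrib)
  then show "u (grid_point N (x + (\<chi> i. int N * k $ i))) = u (grid_point N x)"
    using assms(1) unfolding torus_periodic_def by simp
qed

lemma q_fun_bounds:
  assumes "0 \<le> \<beta>" "0 \<le> \<sigma>" "0 \<le> L" "0 \<le> t" "t \<le> T" "0 < e" "e \<le> 1"
  shows "\<bar>q_fun \<beta> \<sigma> L e t\<bar> \<le> \<sigma> * (\<beta> + L * exp (L * T))"
proof -
  have "exp (- \<beta> * t / e\<^sup>2) \<le> 1" using assms by simp
  then have 1: "\<beta> * exp (- \<beta> * t / e\<^sup>2) \<le> \<beta> * 1" using assms(1) by (rule mult_left_mono)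
  have "e\<^sup>2 * L \<le> 1 * L" using assms by (intro mult_right_mono) (auto simp: power_le_one)
  then have "e\<^sup>2 * L * exp (L * t) \<le> L * exp (L * T)"
    using assms by (intro mult_mono) (auto intro!: mult_left_mono)
  then have "\<beta> * exp (- \<beta> * t / e\<^sup>2) + e\<^sup>2 * L * exp (L * t) \<le> \<beta> + L * exp (L * T)" using 1 by linarith
  then have "q_fun \<beta> \<sigma> L e t \<le> \<sigma> * (\<beta> + L * exp (L * T))"
    unfolding q_fun_def using assms(2) by (rule mult_left_mono)
  moreover have "0 \<le> q_fun \<beta> \<sigma> L e t" unfolding q_fun_def using assms by simp
  ultimately show ?thesis by simp
qed

text \<open>
  In the stretched variable the argument \<open>z\<close> of the profiles is unbounded as \<open>e\<close> tends to \<open>0\<close>, but its gradient is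
  that of \<open>d\<close> at the point \<open>e x\<close>. Its derivatives are thus bounded uniformly in \<open>e\<close>, and so are those of \<open>U(z)\<close> and
  \<open>V(z)\<close>. The hypothesis \<open>nonneg\<close> keeps the barrier in the half-line on which \<open>\<phi>\<close> is smooth. It may attain
  the end point \<open>0\<close>, where the one-sided derivatives of \<open>\<phi>\<close> are the relevant ones.
\<close>
lemma barrier_regularity:
  fixes d :: "real \<Rightarrow> real ^ 'n::finite \<Rightarrow> real"
  assumes U: "\<And>k. uniform_Ck1 k UNIV U" and V: "\<And>k. uniform_Ck1 k UNIV V"
    and U1: "\<And>t v z. t \<in> {0..T} \<Longrightarrow> U1 t v z = laplacian (d t) v * V z"
    and d: "uniform_Ck 5 ({0..T} \<times> UNIV) d"
    and const: "0 < \<beta>" "0 < \<sigma>" "0 < L" and e1: "e1 \<le> 1"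
    and nonneg: "\<And>t e v. t \<in> {0..T} \<Longrightarrow> 0 < e \<Longrightarrow> e < e1 \<Longrightarrow> 0 \<le> barrier U U1 d \<beta> \<sigma> L Lh sg (1 / e\<^sup>2) t v"
    and sg: "\<bar>sg\<bar> = 1" and phi: "smooth_on {0..} \<phi>"
  shows "uniform_Ck 3 (({0..T} \<times> {0<..<e1}) \<times> UNIV)
    (\<lambda>q x. \<phi> (barrier U U1 d \<beta> \<sigma> L Lh sg (1 / (snd q)\<^sup>2) (fst q) (snd q *\<^sub>R x)))"
proof -
  define P where "P = {0..T} \<times> {0<..<e1}"
  define z where "z q x = 1 / snd q * d (fst q) (snd q *\<^sub>R x) + sg * p_fun \<beta> L Lh (snd q) (fst q)" for q x
  define b where "b q x = U (z q x) + snd q * (laplacian (d (fst q)) (snd q *\<^sub>R x) * V (z q x))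
      + sg * q_fun \<beta> \<sigma> L (snd q) (fst q)" for q x
  have P: "fst q \<in> {0..T}" "0 < snd q" "snd q < e1" "\<bar>snd q\<bar> \<le> 1" if "q \<in> P" for q
    using that e1 unfolding P_def by auto
  have b: "b q x = barrier U U1 d \<beta> \<sigma> L Lh sg (1 / (snd q)\<^sup>2) (fst q) (snd q *\<^sub>R x)" if "q \<in> P" for q x
  proof -
    have "(1 / (snd q)\<^sup>2) powr (1 / 2) = 1 / snd q" "(1 / (snd q)\<^sup>2) powr (- 1 / 2) = snd q"
      using P(2)[OF that] by (simp_all add: powr_half_sqrt powr_minus_divide real_sqrt_divide)
    then show ?thesis
      unfolding b_def z_def barrier_def Let_def by (simp add: U1[OF P(1)[OF that]] mult.assoc)
  qed
  have "uniform_Ck (Suc 4) ({0..T} \<times> UNIV) d" using d by simp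
  then obtain D where D: "\<And>t x. (t, x) \<in> {0..T} \<times> UNIV \<Longrightarrow> (d t has_derivative D t x) (at x within {y. (t, y) \<in> {0..T} \<times> UNIV})"
      "\<And>c. c \<in> Basis \<Longrightarrow> uniform_Ck 4 ({0..T} \<times> UNIV) (\<lambda>t x. D t x c)"
    using uniform_Ck_SucE[of 4 "{0..T} \<times> UNIV" d] by blast
  have Dz: "(z q has_derivative D (fst q) (snd q *\<^sub>R x)) (at x within {y. (q, y) \<in> P \<times> UNIV})"
    if "(q, x) \<in> P \<times> UNIV" for q x
  proof -
    have q: "q \<in> P" using that by simp
    have A: "(d (fst q) has_derivative D (fst q) (snd q *\<^sub>R x)) (at (snd q *\<^sub>R x))"
      using D(1)[of "fst q" "snd q *\<^sub>R x"] P(1)[OF q] by simp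
    have "((\<lambda>x. snd q *\<^sub>R x) has_derivative (\<lambda>h. snd q *\<^sub>R h)) (at x)" by (auto intro!: derivative_eq_intros)
    from has_derivative_compose[OF this A]
    have "((\<lambda>x. d (fst q) (snd q *\<^sub>R x)) has_derivative (\<lambda>h. snd q * D (fst q) (snd q *\<^sub>R x) h)) (at x)"
      using has_derivative_bounded_linear[OF A] by (simp add: linear_simps)
    from has_derivative_add[OF has_derivative_mult_right[OF this, of "1 / snd q"]
        has_derivative_const[of "sg * p_fun \<beta> L Lh (snd q) (fst q)"]]
    have "(z q has_derivative (\<lambda>h. 1 / snd q * (snd q * D (fst q) (snd q *\<^sub>R x) h) + 0)) (at x)"
      unfolding z_def[abs_def] .
    then show ?thesis using P(2)[OF q] q by simp
  qed
  have Dz': "uniform_Ck 4 (P \<times> UNIV) (\<lambda>q x. D (fst q) (snd q *\<^sub>R x) c)" if "c \<in> Basis" for c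
    by (rule uniform_Ck_rescale[OF D(2)[OF that], where \<tau> = fst and e = snd]) (use P in auto)
  have Uz: "uniform_Ck 3 (P \<times> UNIV) (\<lambda>q x. U (z q x))"
    by (rule uniform_Ck_compose_gen[OF U _ Dz Dz']) auto
  have Vz: "uniform_Ck 3 (P \<times> UNIV) (\<lambda>q x. V (z q x))"
    by (rule uniform_Ck_compose_gen[OF V _ Dz Dz']) auto
  have "uniform_Ck (Suc (Suc 3)) ({0..T} \<times> UNIV) d" using d by simp
  then have "uniform_Ck 3 ({0..T} \<times> UNIV) (\<lambda>t. laplacian (d t))" by (rule uniform_Ck_laplacian)
  then have a: "uniform_Ck 3 (P \<times> UNIV) (\<lambda>q x. laplacian (d (fst q)) (snd q *\<^sub>R x))"
    by (rule uniform_Ck_rescale[where \<tau> = fst and e = snd]) (use P in auto)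
  have eps: "uniform_Ck 3 (P \<times> (UNIV :: (real ^ 'n) set)) (\<lambda>q x. snd q)"
    by (rule uniform_Ck_const[where M = 1]) (use P in auto)
  have q: "uniform_Ck 3 (P \<times> (UNIV :: (real ^ 'n) set)) (\<lambda>q x. sg * q_fun \<beta> \<sigma> L (snd q) (fst q))"
  proof (rule uniform_Ck_const[where M = "\<sigma> * (\<beta> + L * exp (L * T))"])
    fix q and x :: "real ^ 'n" assume "(q, x) \<in> P \<times> UNIV"
    then have "q \<in> P" by simp
    from P[OF this] show "\<bar>sg * q_fun \<beta> \<sigma> L (snd q) (fst q)\<bar> \<le> \<sigma> * (\<beta> + L * exp (L * T))"
      using q_fun_bounds[of \<beta> \<sigma> L "fst q" T "snd q"] const sg e1 by (simp add: abs_mult)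
  qed
  have breg: "uniform_Ck 3 (P \<times> UNIV) b"
    unfolding b_def[abs_def] by (intro uniform_Ck_add uniform_Ck_mult Uz Vz a eps q)
  obtain B where B: "\<And>q x. (q, x) \<in> P \<times> UNIV \<Longrightarrow> \<bar>b q x\<bar> \<le> B"
    using uniform_Ck_imp_bounded[OF breg] unfolding uniform_Ck_0 by blast
  have "uniform_Ck 3 (P \<times> UNIV) (\<lambda>q x. \<phi> (b q x))"
  proof (rule uniform_Ck_compose[OF smooth_half_line_uniform_Ck1[OF phi order_refl, where b = B] _ breg])
    show "b q x \<in> {0..B}" if "(q, x) \<in> P \<times> UNIV" for q x
    proof -
      have q: "q \<in> P" using that by simp
      have "0 \<le> b q x" unfolding b[OF q] by (rule nonneg) (use P[OF q] in auto)
      then show ?thesis using B[OF that] by simp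
    qed
  qed
  then show ?thesis
    unfolding P_def[symmetric] by (rule uniform_Ck_cong[rotated]) (use b in auto)
qed

lemma barrier_time_differentiable:
  assumes U: "uniform_Ck1 (Suc 0) UNIV U" and V: "uniform_Ck1 (Suc 0) UNIV V"
    and U1: "\<And>t z. t \<in> {0..T} \<Longrightarrow> U1 t v z = laplacian (d t) v * V z"
    and d: "(\<lambda>s. d s v) field_differentiable (at t within {0..T})"
    and lap: "(\<lambda>s. laplacian (d s) v) field_differentiable (at t within {0..T})"
    and t: "t \<in> {0..T}" and k: "0 < k"
  shows "(\<lambda>s. barrier U U1 d \<beta> \<sigma> L Lh sg k s v) field_differentiable (at t within {0..T})"
proof -
  define e where "e = k powr (- 1/2)"
  have e: "e\<^sup>2 \<noteq> 0" using k by (simp add: e_def)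
  define z where "z s = k powr (1/2) * d s v + sg * p_fun \<beta> L Lh e s" for s
  have "(\<lambda>s. p_fun \<beta> L Lh e s) field_differentiable (at t within {0..T})"
    unfolding p_fun_def field_differentiable_def by (rule exI) (rule derivative_eq_intros refl e)+
  then have zd: "z field_differentiable (at t within {0..T})"
    unfolding z_def[abs_def] by (intro field_differentiable_add field_differentiable_mult d field_differentiable_const)
  have comp: "(\<lambda>s. g (z s)) field_differentiable (at t within {0..T})" if g: "uniform_Ck1 (Suc 0) UNIV g" for g
  proof -
    obtain g' where g': "\<And>x. x \<in> UNIV \<Longrightarrow> (g has_real_derivative g' x) (at x within UNIV)"
      using uniform_Ck1_SucE[OF g] by blast
    obtain z' where "(z has_real_derivative z') (at t within {0..T})" using zd unfolding field_differentiable_def by blast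
    from DERIV_chain2[OF g'[of "z t"] this] show ?thesis unfolding field_differentiable_def by auto
  qed
  have qd: "(\<lambda>s. q_fun \<beta> \<sigma> L e s) field_differentiable (at t within {0..T})"
    unfolding q_fun_def field_differentiable_def by (rule exI) (rule derivative_eq_intros refl e)+
  have "(\<lambda>s. U (z s) + e * (laplacian (d s) v * V (z s)) + sg * q_fun \<beta> \<sigma> L e s) field_differentiable (at t within {0..T})"
    by (intro field_differentiable_add field_differentiable_mult field_differentiable_const comp U V lap qd)
  then show ?thesis
    by (rule field_differentiable_transform_within[OF zero_less_one t, rotated])
      (simp add: barrier_def Let_def z_def e_def U1)
qed

section \<open>Comparison with the barriers\<close>

lemma admissible_barriers_inequalities:
  assumes "admissible_barriers \<phi> f \<gamma> T um up ue"
  shows "\<exists>e0 C. 0 < e0 \<and> 0 < C \<and> (\<forall>\<epsilon> t v. 0 < \<epsilon> \<and> \<epsilon> < e0 \<and> t \<in> {0..T} \<longrightarrow>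
    0 \<le> um \<epsilon> t v \<and> 0 \<le> up \<epsilon> t v \<and>
    ac_operator \<phi> f T \<epsilon> (um \<epsilon>) t v \<le> - C \<and> C \<le> ac_operator \<phi> f T \<epsilon> (up \<epsilon>) t v)"
  using assms unfolding admissible_barriers_def by meson

theorem theorem6p2:
  fixes g :: "nat \<Rightarrow> real"
    and cp cm :: "'n::finite config \<Rightarrow> real"
    and \<phi> f :: "real \<Rightarrow> real"
    and \<alpha>m \<alpha>s \<alpha>p \<gamma> \<theta> T l um up d0 \<beta> \<sigma> L Lh :: real
    and K tN :: "nat \<Rightarrow> real"
    and uN :: "nat \<Rightarrow> real \<Rightarrow> int ^ 'n \<Rightarrow> real"
    and u0 :: "real ^ 'n \<Rightarrow> real"
    and \<Gamma> Dp Dm :: "real \<Rightarrow> (real ^ 'n) set"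
    and h U0 :: "real \<Rightarrow> real"
    and d :: "real \<Rightarrow> real ^ 'n \<Rightarrow> real"
    and U1 :: "real \<Rightarrow> real ^ 'n \<Rightarrow> real \<Rightarrow> real"
    and ue :: "real \<Rightarrow> real \<Rightarrow> real ^ 'n \<Rightarrow> real"
    and u_minus u_plus :: "real \<Rightarrow> real \<Rightarrow> real ^ 'n \<Rightarrow> real"
  assumes dim: "2 \<le> CARD('n)"
    and zero_range: "zero_range_setting g cp cm"
    and phi: "\<phi> = fugacity g"
    and f: "f = net_rate g cp cm"
    and regular: "smooth_on {0..} \<phi>" "smooth_on {0..} f" "\<And>\<rho>. 0 < \<rho> \<Longrightarrow> 0 < deriv \<phi> \<rho>" "0 < f 0"
    and BS: "bistable \<phi> f \<alpha>m \<alpha>s \<alpha>p"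
    and gamma: "\<gamma> = deriv f \<alpha>s"
    and K: "\<And>N. 1 \<le> N \<Longrightarrow> 0 < K N" "incseq K" "filterlim K at_top sequentially"
      "K \<in> o(\<lambda>N. real N powr (2/3))"
    and tN: "\<And>N. tN N = ln (K N) / (2 * \<gamma> * K N)"
    and uN: "\<And>N. 1 \<le> N \<Longrightarrow> discrete_solution \<phi> f N (K N) (uN N)"
    and BIP1: "0 < um" "um < up" "\<And>N x. 1 \<le> N \<Longrightarrow> um \<le> uN N 0 x \<and> uN N 0 x \<le> up"
    and BIP2: "\<And>N x. 1 \<le> N \<Longrightarrow> uN N 0 x = u0 (grid_point N x)"
      "torus_periodic u0" "Ck_on 5 UNIV u0"
      "0 < \<theta>" "\<theta> < 1" "\<Gamma> 0 = {v. u0 v = \<alpha>s}" "holder_hypersurface 5 \<theta> (\<Gamma> 0)"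
      "\<And>v n. v \<in> \<Gamma> 0 \<Longrightarrow> unit_normal (\<Gamma> 0) v n \<Longrightarrow> grad u0 v \<bullet> n \<noteq> 0"
      "\<And>v. v \<in> Dp 0 \<Longrightarrow> \<alpha>s < u0 v"
      "\<And>v. v \<in> Dm 0 \<Longrightarrow> um < u0 v \<and> u0 v < \<alpha>s"
    and flow: "0 < T" "l = flow_speed \<phi> f \<alpha>m \<alpha>p" "interface_flow 5 \<theta> T l \<Gamma> Dp Dm"
    and dist: "0 < d0"
      "\<And>t v. t \<in> {0..T} \<Longrightarrow> \<bar>signed_dist \<Gamma> Dp t v\<bar> < 3 * d0 \<Longrightarrow>
         \<exists>r>0. parabolic_holder_on 5 \<theta> ({0..T} \<inter> ball t r) (ball v r) (signed_dist \<Gamma> Dp)"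
      "cutoff d0 h"
      "\<And>t v. d t v = h (signed_dist \<Gamma> Dp t v)"
    and profiles: "profile0 \<phi> f \<alpha>m \<alpha>s \<alpha>p U0" "profile1 \<phi> f l T d U0 U1"
    and u_minus: "\<And>k. u_minus k = barrier U0 U1 d \<beta> \<sigma> L Lh (- 1) k"
    and u_plus: "\<And>k. u_plus k = barrier U0 U1 d \<beta> \<sigma> L Lh 1 k"
    and ue: "\<And>\<epsilon>. 0 < \<epsilon> \<Longrightarrow> continuum_solution \<phi> f \<epsilon> u0 (ue \<epsilon>)"
    and constants: "0 < \<beta>" "0 < \<sigma>" "0 < L" "1 < Lh"
      "admissible_barriers \<phi> f \<gamma> T (\<lambda>\<epsilon>. u_minus (1 / \<epsilon>\<^sup>2)) (\<lambda>\<epsilon>. u_plus (1 / \<epsilon>\<^sup>2)) ue"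
    and initial: "\<forall>\<^sub>F N in sequentially. \<forall>x.
        u_minus (K N) 0 (grid_point N x) \<le> uN N (0 + tN N) x \<and>
        uN N (0 + tN N) x \<le> u_plus (K N) 0 (grid_point N x)"
  shows "\<exists>N0. \<forall>N\<ge>N0. \<forall>t\<in>{0..T - tN N}. \<forall>x.
        u_minus (K N) t (grid_point N x) \<le> uN N (t + tN N) x \<and>
        uN N (t + tN N) x \<le> u_plus (K N) t (grid_point N x)"
proof -
  have zeros: "{\<rho>. 0 \<le> \<rho> \<and> f \<rho> = 0} = {\<alpha>m, \<alpha>s, \<alpha>p}" and order: "0 < \<alpha>m" "\<alpha>m < \<alpha>s" "\<alpha>s < \<alpha>p"
    and \<gamma>: "0 < \<gamma>"
    using BS gamma unfolding bistable_def by auto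
  have fm: "f \<alpha>m = 0" using zeros by blast
  have fnz: "f \<rho> \<noteq> 0" if "\<alpha>m < \<rho>" "\<rho> < \<alpha>s" for \<rho>
  proof
    assume "f \<rho> = 0"
    then have "\<rho> \<in> {\<alpha>m, \<alpha>s, \<alpha>p}" using that order zeros by auto
    then show False using that order by auto
  qed
  obtain W m B where wave: "standing_wave \<phi> f U0 W m B"
      and W: "\<And>z. ((\<lambda>y. \<phi> (U0 y)) has_real_derivative W z) (at z)"
    using profile0_standing_wave[OF regular(1,2,3,4) order(1,2) fm _ fnz profiles(1)] order by auto
  interpret standing_wave \<phi> f U0 W m B by (rule wave)
  define r where "r z = l * deriv U0 z - deriv (\<lambda>y. \<phi> (U0 y)) z" for z
  have r: "r = (\<lambda>z. l * (W z * inverse (deriv \<phi> (U0 z))) + - W z)"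
    using DERIV_imp_deriv[OF DERIV_U] DERIV_imp_deriv[OF W] by (simp add: r_def fun_eq_iff divide_inverse)
  have rreg: "uniform_Ck1 k UNIV r" for k
    unfolding r by (rule uniform_Ck_add[OF uniform_Ck_cmult[OF uniform_Ck_mult[OF uniform_Ck1_D
            uniform_Ck1_inverse_phi_U[OF uniform_Ck1_U]]] uniform_Ck_minus[OF uniform_Ck1_D]])
  have prof1: "(\<exists>D. \<forall>z. ((\<lambda>y. deriv \<phi> (U0 y) * U1 t v y) has_real_derivative D z) (at z) \<and>
           (D has_real_derivative r z * laplacian (d t) v - deriv f (U0 z) * U1 t v z) (at z))"
      "U1 t v 0 = 0" "bounded (range (\<lambda>z. deriv \<phi> (U0 z) * U1 t v z))" if "t \<in> {0..T}" for t v
    using profiles(2) that unfolding profile1_def r_def by blast+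
  have "\<exists>V. (\<forall>k. uniform_Ck1 k UNIV V) \<and>
      (\<forall>i\<in>{0..T} \<times> UNIV. \<forall>z. U1 (fst i) (snd i) z = laplacian (d (fst i)) (snd i) * V z)"
  proof (rule corrector_separates[where r = r])
    fix i :: "real \<times> (real ^ 'n)" assume "i \<in> {0..T} \<times> UNIV"
    then have i: "fst i \<in> {0..T}" by auto
    show "\<exists>Y. \<forall>z. ((\<lambda>y. deriv \<phi> (U0 y) * U1 (fst i) (snd i) y) has_real_derivative Y z) (at z) \<and>
        (Y has_real_derivative r z * laplacian (d (fst i)) (snd i) - deriv f (U0 z) * U1 (fst i) (snd i) z) (at z)"
      by (rule prof1(1)[OF i])
    show "U1 (fst i) (snd i) 0 = 0" by (rule prof1(2)[OF i])
    show "bounded (range (\<lambda>z. deriv \<phi> (U0 z) * U1 (fst i) (snd i) z))" by (rule prof1(3)[OF i])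
  qed (rule rreg)
  then obtain V where V: "\<And>k. uniform_Ck1 k UNIV V"
      and U1V: "\<And>t v z. t \<in> {0..T} \<Longrightarrow> U1 t v z = laplacian (d t) v * V z"
    by fastforce
  have dloc: "\<exists>r>0. uniform_Ck 5 (({0..T} \<inter> ball t r) \<times> ball v r) d \<and>
      (\<lambda>s. d s v) field_differentiable (at t within {0..T}) \<and>
      (\<lambda>s. laplacian (d s) v) field_differentiable (at t within {0..T})" if "t \<in> {0..T}" for t v
    by (rule cut_distance_local[OF flow(3) BIP2(4) dist(1) dist(2) dist(3,4) that])
  have dper: "torus_periodic (d t)" if "t \<in> {0..T}" for t
    using signed_dist_periodic[OF flow(3) that] unfolding torus_periodic_def dist(4) by simp
  have dC: "uniform_Ck 5 ({0..T} \<times> UNIV) d"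
  proof (rule uniform_Ck_of_local_periodic[OF _ dper])
    show "\<exists>r>0. uniform_Ck 5 (({0..T} \<inter> ball t r) \<times> ball v r) d" if "t \<in> {0..T}" for t v
      using dloc[OF that, of v] by (elim exE conjE) (intro exI conjI)
  qed
  obtain e0 C where e0: "0 < e0" and C: "0 < C" and adm: "\<forall>\<epsilon> t v. 0 < \<epsilon> \<and> \<epsilon> < e0 \<and> t \<in> {0..T} \<longrightarrow>
      0 \<le> u_minus (1 / \<epsilon>\<^sup>2) t v \<and> 0 \<le> u_plus (1 / \<epsilon>\<^sup>2) t v \<and>
      ac_operator \<phi> f T \<epsilon> (u_minus (1 / \<epsilon>\<^sup>2)) t v \<le> - C \<and>
      C \<le> ac_operator \<phi> f T \<epsilon> (u_plus (1 / \<epsilon>\<^sup>2)) t v"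
    using admissible_barriers_inequalities[OF constants(5)] by (elim exE conjE) (rule that)
  define e1 where "e1 = min e0 1"
  have e1: "0 < e1" "e1 \<le> 1" "e1 \<le> e0" using e0 by (auto simp: e1_def)
  let ?b = "\<lambda>sg k. barrier U0 U1 d \<beta> \<sigma> L Lh sg k"
  have sgn: "0 \<le> ?b sg (1 / e\<^sup>2) t v" if "sg = 1 \<or> sg = - 1" "t \<in> {0..T}" "0 < e" "e < e1" for sg e t v
    using adm[rule_format, of e t v] that e1 unfolding u_minus u_plus by auto
  have err: "\<exists>M. \<forall>q\<in>{0..T} \<times> {0<..<e1}. \<forall>N\<ge>1. \<forall>x.
      \<bar>discrete_laplacian N (\<lambda>y. \<phi> (?b sg (1 / (snd q)\<^sup>2) (fst q) (grid_point N y))) x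
        - laplacian (\<lambda>v. \<phi> (?b sg (1 / (snd q)\<^sup>2) (fst q) v)) (grid_point N x)\<bar> \<le> M / (real N * snd q ^ 3)"
    if sg: "sg = 1 \<or> sg = - 1" for sg
  proof (rule discretisation_error[where w = "\<lambda>q v. \<phi> (?b sg (1 / (snd q)\<^sup>2) (fst q) v)" and e = snd])
    show "uniform_Ck 3 (({0..T} \<times> {0<..<e1}) \<times> UNIV) (\<lambda>q x. \<phi> (?b sg (1 / (snd q)\<^sup>2) (fst q) (snd q *\<^sub>R x)))"
      by (rule barrier_regularity[OF uniform_Ck1_U V U1V dC constants(1-3) e1(2) sgn[OF sg] _ regular(1)])
        (use sg in auto)
  qed auto
  obtain M1 where M1: "\<And>q N x. q \<in> {0..T} \<times> {0<..<e1} \<Longrightarrow> 1 \<le> N \<Longrightarrow>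
      \<bar>discrete_laplacian N (\<lambda>y. \<phi> (?b 1 (1 / (snd q)\<^sup>2) (fst q) (grid_point N y))) x
        - laplacian (\<lambda>v. \<phi> (?b 1 (1 / (snd q)\<^sup>2) (fst q) v)) (grid_point N x)\<bar> \<le> M1 / (real N * snd q ^ 3)"
    using err[of 1] by blast
  obtain M2 where M2: "\<And>q N x. q \<in> {0..T} \<times> {0<..<e1} \<Longrightarrow> 1 \<le> N \<Longrightarrow>
      \<bar>discrete_laplacian N (\<lambda>y. \<phi> (?b (- 1) (1 / (snd q)\<^sup>2) (fst q) (grid_point N y))) x
        - laplacian (\<lambda>v. \<phi> (?b (- 1) (1 / (snd q)\<^sup>2) (fst q) v)) (grid_point N x)\<bar> \<le> M2 / (real N * snd q ^ 3)"
    using err[of "- 1"] by blast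
  \<comment> \<open>The maximum with \<open>1\<close> makes \<open>M\<close> positive; \<open>c\<close> is chosen such that \<open>K \<le> c * N powr (2/3)\<close> implies
    \<open>M * K powr (3/2) / N \<le> C\<close>.\<close>
  define M where "M = max 1 (max M1 M2)"
  have M: "0 < M" "M1 \<le> M" "M2 \<le> M" by (auto simp: M_def)
  define c where "c = (C / M) powr (2/3)"
  have c: "0 < c" using C M by (simp add: c_def)
  have "\<forall>\<^sub>F N in sequentially. norm (K N) \<le> c * norm (real N powr (2/3))"
    by (rule landau_o.smallD[OF K(4) c])
  moreover have "\<forall>\<^sub>F N in sequentially. max 1 (1 / e1\<^sup>2) < K N"
    using K(3) unfolding filterlim_at_top_dense by blast
  ultimately have "\<forall>\<^sub>F N in sequentially. 1 \<le> N \<and> norm (K N) \<le> c * norm (real N powr (2/3)) \<and>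
      max 1 (1 / e1\<^sup>2) < K N \<and> (\<forall>x.
        u_minus (K N) 0 (grid_point N x) \<le> uN N (0 + tN N) x \<and>
        uN N (0 + tN N) x \<le> u_plus (K N) 0 (grid_point N x))"
    using initial eventually_ge_at_top[of 1] by eventually_elim blast
  then obtain N0 where N0: "\<And>N. N0 \<le> N \<Longrightarrow> 1 \<le> N \<and> norm (K N) \<le> c * norm (real N powr (2/3)) \<and>
      max 1 (1 / e1\<^sup>2) < K N \<and> (\<forall>x.
        u_minus (K N) 0 (grid_point N x) \<le> uN N (0 + tN N) x \<and>
        uN N (0 + tN N) x \<le> u_plus (K N) 0 (grid_point N x))"
    unfolding eventually_sequentially by blast
  have "u_minus (K N) t (grid_point N x) \<le> uN N (t + tN N) x \<and>
        uN N (t + tN N) x \<le> u_plus (K N) t (grid_point N x)"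
    if N: "N0 \<le> N" and t: "t \<in> {0..T - tN N}" for N t x
  proof -
    have N1: "1 \<le> N" and KN: "K N \<le> c * real N powr (2/3)" and K1: "1 < K N" "1 / e1\<^sup>2 < K N"
      and init: "\<And>x. u_minus (K N) 0 (grid_point N x) \<le> uN N (0 + tN N) x"
        "\<And>x. uN N (0 + tN N) x \<le> u_plus (K N) 0 (grid_point N x)"
      using N0[OF N] by auto
    have N': "0 < real N" using N1 by simp
    define \<epsilon> where "\<epsilon> = K N powr (- 1/2)"
    have \<epsilon>: "0 < \<epsilon>" using K1 by (simp add: \<epsilon>_def)
    have \<epsilon>2: "1 / \<epsilon>\<^sup>2 = K N"
      using K1 by (simp add: \<epsilon>_def powr_minus_divide powr_half_sqrt power_divide)
    have \<epsilon>3: "1 / \<epsilon> ^ 3 = K N powr (3/2)"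
    proof -
      have "\<epsilon> ^ 3 = K N powr (- 3/2)" using K1 by (simp add: \<epsilon>_def powr_power)
      then show ?thesis by (simp add: powr_minus_divide)
    qed
    have "\<epsilon> < e1"
    proof (rule power_less_imp_less_base)
      have "1 < K N * e1\<^sup>2" using K1(2) e1(1) by (simp add: pos_divide_less_eq)
      then show "\<epsilon>\<^sup>2 < e1\<^sup>2" unfolding \<epsilon>2[symmetric] using \<epsilon> by (simp add: field_simps)
      show "0 \<le> e1" using e1(1) by simp
    qed
    then have \<epsilon>e: "\<epsilon> < e1" .
    have small: "A / (real N * \<epsilon> ^ 3) \<le> C" if A: "A \<le> M" for A
    proof -
      have "K N powr (3/2) \<le> (c * real N powr (2/3)) powr (3/2)"
        using KN K1 by (intro powr_mono2) auto
      also have "\<dots> = C / M * real N"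
        using c C M N' by (simp add: powr_mult powr_powr c_def)
      finally have "K N powr (3/2) / real N \<le> C / M" using N' by (simp add: pos_divide_le_eq)
      then have "M * (K N powr (3/2) / real N) \<le> C" using M by (simp add: pos_le_divide_eq mult.commute)
      moreover have "A * (K N powr (3/2) / real N) \<le> M * (K N powr (3/2) / real N)"
        using A N' by (intro mult_right_mono) auto
      moreover have "A / (real N * \<epsilon> ^ 3) = A * (K N powr (3/2) / real N)"
        unfolding \<epsilon>3[symmetric] by (simp add: field_simps)
      ultimately show ?thesis by linarith
    qed
    have tN0: "0 \<le> tN N" unfolding tN using K1 \<gamma> by (simp add: ln_ge_zero)
    define T' where "T' = T - tN N"
    have sub: "{0..T'} \<subseteq> {0..T}" using tN0 by (auto simp: T'_def)
    define u where "u s y = uN N (s + tN N) y" for s y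
    define u' where "u' s y = discrete_laplacian N (\<lambda>y. \<phi> (u s y)) y + K N * f (u s y)" for s y
    have sol: "discrete_periodic N (u s) \<and> (\<forall>y. 0 \<le> u s y) \<and>
        (\<forall>y. ((\<lambda>s. u s y) has_real_derivative u' s y) (at s within {0..T'}))" if s: "s \<in> {0..T'}" for s
    proof (intro conjI allI)
      note S = uN[OF N1, unfolded discrete_solution_def, rule_format, of "s + tN N"]
      have s0: "0 \<le> s + tN N" using s tN0 by simp
      show "discrete_periodic N (u s)" using S s0 unfolding u_def[abs_def] by blast
      show "0 \<le> u s y" for y using S s0 unfolding u_def by blast
      show "((\<lambda>s. u s y) has_real_derivative u' s y) (at s within {0..T'})" for y
      proof -
        have "((\<lambda>s. uN N s y) has_real_derivative u' s y) (at (s + tN N) within {0..})"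
          using S s0 unfolding u_def u'_def by blast
        then have "((\<lambda>s. uN N s y) has_real_derivative u' s y) (at (s + tN N) within (\<lambda>s. s + tN N) ` {0..T'})"
          by (rule has_field_derivative_subset) (use tN0 in auto)
        moreover have "((\<lambda>s. s + tN N) has_real_derivative 1) (at s within {0..T'})"
          by (auto intro!: derivative_eq_intros)
        ultimately show ?thesis
          using DERIV_image_chain[of "\<lambda>s. uN N s y" "u' s y" "\<lambda>s. s + tN N" s "{0..T'}" 1]
          by (simp add: u_def[abs_def] comp_def)
      qed
    qed
    define b where "b sg s y = ?b sg (K N) s (grid_point N y)" for sg s y
    define b' where "b' sg s y = vector_derivative (\<lambda>s. ?b sg (K N) s (grid_point N y)) (at s within {0..T})" for sg s y
    have bar: "discrete_periodic N (b sg s) \<and> (\<forall>y. 0 \<le> b sg s y) \<and>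
        (\<forall>y. ((\<lambda>s. b sg s y) has_real_derivative b' sg s y) (at s within {0..T'}))"
      if s: "s \<in> {0..T'}" and sg: "sg = 1 \<or> sg = - 1" for s sg
    proof (intro conjI allI)
      have sT: "s \<in> {0..T}" using s sub by blast
      have "torus_periodic (?b sg (K N) s)"
        using dper[OF sT] torus_periodic_laplacian[OF dper[OF sT]]
        unfolding torus_periodic_def barrier_def Let_def U1V[OF sT] by simp
      then show "discrete_periodic N (b sg s)"
        unfolding b_def[abs_def] by (rule grid_point_discrete_periodic[OF _ N1])
      show "0 \<le> b sg s y" for y
        using sgn[OF sg sT \<epsilon> \<epsilon>e] unfolding b_def \<epsilon>2 .
      show "((\<lambda>s. b sg s y) has_real_derivative b' sg s y) (at s within {0..T'})" for y
      proof -
        have "(\<lambda>s. ?b sg (K N) s (grid_point N y)) field_differentiable (at s within {0..T})"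
          by (rule barrier_time_differentiable[OF uniform_Ck1_U V U1V _ _ sT])
            (use dloc[OF sT] K1 in auto)
        then obtain D where D: "((\<lambda>s. b sg s y) has_real_derivative D) (at s within {0..T})"
          unfolding field_differentiable_def b_def by blast
        have "((\<lambda>s. b sg s y) has_vector_derivative D) (at s within cbox 0 T)"
          using D by (simp add: has_real_derivative_iff_has_vector_derivative)
        from vector_derivative_within_cbox[OF flow(1) _ this] sT
        have "b' sg s y = D" by (simp add: b'_def b_def)
        then show ?thesis using has_field_derivative_subset[OF D sub] by simp
      qed
    qed
    have lapl: "\<bar>discrete_laplacian N (\<lambda>y. \<phi> (b sg s y)) y - laplacian (\<lambda>v. \<phi> (?b sg (K N) s v)) (grid_point N y)\<bar> \<le> C"
      if s: "s \<in> {0..T'}" and sg: "sg = 1 \<or> sg = - 1" for s y sg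
    proof -
      have q: "(s, \<epsilon>) \<in> {0..T} \<times> {0<..<e1}" using s sub \<epsilon> \<epsilon>e by auto
      show ?thesis
        using sg M1[OF q N1, of y] M2[OF q N1, of y] small[OF M(2)] small[OF M(3)]
        unfolding b_def fst_conv snd_conv \<epsilon>2 by fastforce
    qed
    have ac: "ac_operator \<phi> f T \<epsilon> (?b sg (K N)) s (grid_point N y)
        = b' sg s y - laplacian (\<lambda>v. \<phi> (?b sg (K N) s v)) (grid_point N y) - K N * f (b sg s y)" for sg s y
      unfolding ac_operator_def b'_def b_def \<epsilon>2[symmetric] by simp
    have lower: "b' (- 1) s y \<le> discrete_laplacian N (\<lambda>y. \<phi> (b (- 1) s y)) y + K N * f (b (- 1) s y)"
      and upper: "discrete_laplacian N (\<lambda>y. \<phi> (b 1 s y)) y + K N * f (b 1 s y) \<le> b' 1 s y"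
      if s: "s \<in> {0..T'}" for s y
    proof -
      have "0 < \<epsilon> \<and> \<epsilon> < e0 \<and> s \<in> {0..T}" using s sub \<epsilon> \<epsilon>e e1(3) by auto
      from adm[rule_format, OF this, of "grid_point N y"]
      have a: "ac_operator \<phi> f T \<epsilon> (?b (- 1) (K N)) s (grid_point N y) \<le> - C"
        "C \<le> ac_operator \<phi> f T \<epsilon> (?b 1 (K N)) s (grid_point N y)"
        unfolding u_minus u_plus \<epsilon>2 by auto
      show "b' (- 1) s y \<le> discrete_laplacian N (\<lambda>y. \<phi> (b (- 1) s y)) y + K N * f (b (- 1) s y)"
        using a(1) lapl[OF s, of "- 1" y] unfolding ac by linarith
      show "discrete_laplacian N (\<lambda>y. \<phi> (b 1 s y)) y + K N * f (b 1 s y) \<le> b' 1 s y"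
        using a(2) lapl[OF s, of 1 y] unfolding ac by linarith
    qed
    have K0: "0 \<le> K N" using K1 by simp
    have mono: "\<phi> a \<le> \<phi> b" if "0 \<le> a" "a \<le> b" for a b
      using strictly_increasing_half_line[OF regular(1,3) that(1), of b] that by (cases "a = b") auto
    note lip = smooth_half_line_Lipschitz[OF regular(1)] smooth_half_line_Lipschitz[OF regular(2)]
    have tT: "t \<in> {0..T'}" using t by (simp add: T'_def)
    have "b (- 1) t x \<le> u t x"
    proof (rule discrete_comparison[where v = "b (- 1)" and u = u and v' = "b' (- 1)" and u' = u' and K = "K N" and T = T', OF N1 K0 mono lip])
      show "b (- 1) 0 y \<le> u 0 y" for y using init(1) unfolding b_def u_def u_minus .
    qed (use bar sol lower tT in \<open>auto simp: u'_def\<close>)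
    moreover have "u t x \<le> b 1 t x"
    proof (rule discrete_comparison[where v = u and u = "b 1" and v' = u' and u' = "b' 1" and K = "K N" and T = T', OF N1 K0 mono lip])
      show "u 0 y \<le> b 1 0 y" for y using init(2) unfolding b_def u_def u_plus .
    qed (use bar sol upper tT in \<open>auto simp: u'_def\<close>)
    ultimately show ?thesis unfolding b_def u_def u_minus u_plus by blast
  qed
  then show ?thesis by blast
qed

end
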